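(* Let $X$ be a separable real Banach space equipped with a centred nondegenerate Gaussian measure $\mu_0$ with Cameron--Martin space $E$. Let $\Phi \colon X \to \mathbb{R}$ be continuous, and let $\mu^y$ be the Borel probability measure on $X$ given by $\mu^y(\mathrm{d}x) = \exp(-\Phi(x))\,\mu_0(\mathrm{d}x)$ (the additive normalisation constant being absorbed into $\Phi$). Suppose that for each $\eta > 0$ there exists $K(\eta) \in \mathbb{R}$ such that $$\Phi(x) \geq K(\eta) - \eta \|x\|_X^2 \quad \text{for all } x \in X.$$ Then: (a) $\mu^y$ has a strong mode, and any strong mode of $\mu^y$ lies in $E$; (b) strong modes, generalised strong modes, weak modes and minimisers of an Onsager--Machlup functional for $\mu^y$ coincide; that is, there is an Onsager--Machlup functional $I^y \colon E \to \mathbb{R}$ for $\mu^y$ and, for every $x^\star \in X$, the following are equivalent: $x^\star$ is a strong mode of $\mu^y$; $x^\star$ is a generalised strong mode of $\mu^y$; $x^\star$ is a weak mode of $\mu^y$; $x^\star \in E$ and $x^\star$ minimises $I^y$ over $E$.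
   Context: All measures are Borel measures. $B_r(x)$ denotes the closed ball of radius $r$ centred at $x$. For a Borel probability measure $\mu$ on a separable metric space $X$, $\operatorname{supp}(\mu) = \{x \in X : \mu(B_r(x)) > 0 \text{ for all } r > 0\}$ and $M_r = \sup_{x \in X} \mu(B_r(x))$ for $r>0$. Strong mode of $\mu$: a point $x^\star \in \operatorname{supp}(\mu)$ with $\lim_{r \to 0} \mu(B_r(x^\star))/M_r = 1$. Weak mode of $\mu$: a point $x^\star \in \operatorname{supp}(\mu)$ such that $\limsup_{r \to 0} \mu(B_r(x))/\mu(B_r(x^\star)) \leq 1$ for all $x \in X$. Generalised strong mode of $\mu$: a point $x^\star \in X$ such that for each sequence $(r_n)_{n\in\mathbb{N}}$ of positive radii with $r_n \to 0$ there exists a sequence $x_n \to x^\star$ in $X$ with $\lim_{n \to \infty} \mu(B_{r_n}(x_n))/M_{r_n} = 1$. Onsager--Machlup (OM) functional for $\mu$ on a nonempty set $D \subseteq \operatorname{supp}(\mu)$: a function $I \colon D \to \mathbb{R}$ such that $\lim_{r \to 0} \mu(B_r(x))/\mu(B_r(x')) = \exp(I(x') - I(x))$ for all $x, x' \in D$. A Borel probability measure $\gamma$ on a separable Banach space $X$ is Gaussian if its pushforward under every $f \in X^*$ is a Gaussian measure on $\mathbb{R}$; it is centred if it has mean zero and nondegenerate if $\operatorname{supp}(\gamma) = X$. Let $X_\gamma^*$ be the closure of $X^*$ in $L^2(\gamma)$, and for $f \in X_\gamma^*$ let $R_\gamma f \in X$ be the element representing the functional $g \mapsto \int_X f(x)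 g(x)\,\gamma(\mathrm{d}x)$ on $X^*$. The Cameron--Martin space of $\gamma$ is $E = R_\gamma(X_\gamma^* ) \subset X$, a separable Hilbert space with norm $\|h\|_E = \|R_\gamma^{-1} h\|_{L^2(\gamma)}$. *)

theory Defs
  imports "HOL-Probability.Probability"
begin

text \<open>These notions are meant for Borel probability measures; ball masses are therefore reals and the
  supremum in \<open>max_ball_mass\<close> is over a bounded set.\<close>

definition msupport :: "'a::metric_space measure \<Rightarrow> 'a set" where
  "msupport M = {x. \<forall>r>0. measure M (cball x r) > 0}"

definition max_ball_mass :: "'a::metric_space measure \<Rightarrow> real \<Rightarrow> real" where
  "max_ball_mass M r = (SUP x. measure M (cball x r))"

definition strong_mode :: "'a::metric_space measure \<Rightarrow> 'a \<Rightarrow> bool" where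
  "strong_mode M x \<longleftrightarrow> x \<in> msupport M \<and>
     ((\<lambda>r. measure M (cball x r) / max_ball_mass M r) \<longlongrightarrow> 1) (at_right 0)"

text \<open>The limit superior is taken in the extended reals, where it always exists. The denominator is
  positive because \<open>x\<close> lies in the support.\<close>

definition weak_mode :: "'a::metric_space measure \<Rightarrow> 'a \<Rightarrow> bool" where
  "weak_mode M x \<longleftrightarrow> x \<in> msupport M \<and>
     (\<forall>x'. Limsup (at_right 0)
             (\<lambda>r. ereal (measure M (cball x' r) / measure M (cball x r))) \<le> 1)"

definition generalised_strong_mode :: "'a::metric_space measure \<Rightarrow> 'a \<Rightarrow> bool" where
  "generalised_strong_mode M x \<longleftrightarrow>
     (\<forall>r :: nat \<Rightarrow> real. (\<forall>n. r n > 0) \<and> r \<longlonglongrightarrow> 0 \<longrightarrow>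
        (\<exists>z :: nat \<Rightarrow> 'a. z \<longlonglongrightarrow> x \<and>
           (\<lambda>n. measure M (cball (z n) (r n)) / max_ball_mass M (r n)) \<longlonglongrightarrow> 1))"

text \<open>A functional \<open>D \<rightarrow> \<real>\<close> is modelled by a total function whose values outside \<open>D\<close> are
  irrelevant.\<close>

definition OM_functional :: "'a::metric_space measure \<Rightarrow> 'a set \<Rightarrow> ('a \<Rightarrow> real) \<Rightarrow> bool" where
  "OM_functional M D I \<longleftrightarrow> D \<noteq> {} \<and> D \<subseteq> msupport M \<and>
     (\<forall>x\<in>D. \<forall>x'\<in>D.
        ((\<lambda>r. measure M (cball x r) / measure M (cball x' r)) \<longlongrightarrow> exp (I x' - I x)) (at_right 0))"

text \<open>Degenerate Gaussian measures on the line (point masses) are included.\<close>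

definition gaussian_on_real :: "real measure \<Rightarrow> bool" where
  "gaussian_on_real N \<longleftrightarrow>
     (\<exists>m. N = return borel m) \<or>
     (\<exists>m s. s > 0 \<and> N = density lborel (\<lambda>x. ennreal (normal_density m s x)))"

definition gaussian_measure :: "'a::{banach, second_countable_topology} measure \<Rightarrow> bool" where
  "gaussian_measure \<gamma> \<longleftrightarrow> prob_space \<gamma> \<and> sets \<gamma> = sets borel \<and>
     (\<forall>f. bounded_linear f \<longrightarrow> gaussian_on_real (distr \<gamma> borel f))"

text \<open>Mean zero is expressed through the mean functional \<open>f \<mapsto> \<integral>f d\<gamma>\<close> on the dual space. For a
  Gaussian measure all these integrals converge.\<close>

definition centred :: "'a::{banach, second_countable_topology} measure \<Rightarrow> bool" where
  "centred \<gamma> \<longleftrightarrow> (\<forall>f. bounded_linear f \<longrightarrow> (\<integral>x. f x \<partial>\<gamma>) = (0::real))"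

definition nondegenerate :: "'a::{banach, second_countable_topology} measure \<Rightarrow> bool" where
  "nondegenerate \<gamma> \<longleftrightarrow> msupport \<gamma> = UNIV"

text \<open>The closure of the dual space in \<open>L\<^sup>2(\<gamma>)\<close>, as a set of square-integrable
  functions rather than of their almost-everywhere classes.\<close>

definition dual_L2_closure ::
    "'a::{banach, second_countable_topology} measure \<Rightarrow> ('a \<Rightarrow> real) set" where
  "dual_L2_closure \<gamma> =
     {f. f \<in> borel_measurable \<gamma> \<and> integrable \<gamma> (\<lambda>x. (f x)\<^sup>2) \<and>
         (\<forall>e>0. \<exists>g. bounded_linear g \<and> (\<integral>x. (f x - g x)\<^sup>2 \<partial>\<gamma>) < e)}"

text \<open>The graph of the operator \<open>R\<^sub>\<gamma>\<close>: the point \<open>h\<close> represents the functional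
  \<open>g \<mapsto> \<integral>f g d\<gamma>\<close> on the dual space. Such an \<open>h\<close> is unique by Hahn--Banach.\<close>

definition R_graph ::
    "'a::{banach, second_countable_topology} measure \<Rightarrow> ('a \<Rightarrow> real) \<Rightarrow> 'a \<Rightarrow> bool" where
  "R_graph \<gamma> f h \<longleftrightarrow> (\<forall>g. bounded_linear g \<longrightarrow> g h = (\<integral>x. f x * g x \<partial>\<gamma>))"

definition cameron_martin_space ::
    "'a::{banach, second_countable_topology} measure \<Rightarrow> 'a set" where
  "cameron_martin_space \<gamma> = {h. \<exists>f \<in> dual_L2_closure \<gamma>. R_graph \<gamma> f h}"

end

theory Submission
  imports Defs
begin

text \<open>
  The argument compares all ball masses with \<open>\<gamma>(B\<^sub>r(0))\<close>. For a functional \<open>f\<close> of variance \<open>\<sigma>\<^sup>2\<close>, the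
  Cameron--Martin shift and Anderson's inequality give
  \<open>\<gamma>(B\<^sub>r(x)) \<le> exp (\<sigma>\<^sup>2 / 2 - f(x) + r \<parallel>f\<parallel>) \<gamma>(B\<^sub>r(0))\<close> for every \<open>x\<close>. Optimising over \<open>f\<close> yields the sharp
  small-ball exponent \<open>\<parallel>x\<parallel>\<^sub>E\<^sup>2 / 2\<close> along any \<open>x\<^sub>n \<rightarrow> x\<close>; choosing \<open>f\<close> norming at \<open>x\<close> yields Gaussian decay in
  \<open>\<parallel>x\<parallel>\<close>, which absorbs \<open>exp (\<eta> \<parallel>x\<parallel>\<^sup>2)\<close>; and choosing \<open>f\<close> a large multiple of a difference of two functionals
  that are close in \<open>L\<^sup>2(\<gamma>)\<close> shows that centres of asymptotically heavy balls form a precompact set. Hence the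
  maximal ball mass is asymptotically attained along a convergent sequence of centres, whose limit
  minimises \<open>\<Phi> + \<parallel>\<cdot>\<parallel>\<^sub>E\<^sup>2 / 2\<close>, and every notion of mode amounts to this minimality.

  Anderson's inequality reduces to finitely many functionals. Splitting off one of them at a time writes
  \<open>\<gamma>\<close> as the sum of an independent line Gaussian and another Gaussian measure, so the
  Prekopa--Leindler inequality on the real line tensorises.
\<close>

section \<open>The Hahn--Banach theorem\<close>

text \<open>One asymmetry shapes the proof. For a fixed centre the mass of a small ball divided by
  \<open>b r\<close> has the limit \<open>weight x\<close>; along moving centres only an upper bound
  by the weight of the limit point is established. This suffices, since lower bounds are needed only
  at fixed competitors and upper bounds only at unknown near-optimal centres. Points outside the
  Cameron--Martin space fit in with weight 0, because there the exponents
  \<open>f x - sq_norm \<gamma> f / 2\<close> are unbounded in \<open>f\<close>. Tail information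
  enters through one constant \<open>S\<close>, with the variance of \<open>f\<close> at most
  \<open>S\<close> times its squared norm. It comes from tightness: a compact set of mass one half,
  on which \<open>f\<close> is bounded, already limits the variance. \<open>S\<close> also dictates
  the choice of \<open>\<eta>\<close>: ball masses decay at rate \<open>1 / (2 * S)\<close>, and
  \<open>\<eta> = 1 / (8 * S)\<close> leaves a definite part of that decay. The supremum over
  centres need not be attained, so near-maximisers and subsequences replace maximisers; since all
  limits have the same maximal weight, the full limit is recovered.\<close>

definition sublinear :: "('a::real_vector \<Rightarrow> real) \<Rightarrow> bool" where
  "sublinear p \<longleftrightarrow> (\<forall>x y. p (x + y) \<le> p x + p y) \<and> (\<forall>t>0. \<forall>x. p (t *\<^sub>R x) = t * p x)"

lemma sublinear_zero: "sublinear p \<Longrightarrow> p 0 = 0"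
proof -
  assume "sublinear p"
  then have "p (2 *\<^sub>R 0) = 2 * p 0" unfolding sublinear_def by (metis zero_less_numeral)
  then show ?thesis by simp
qed

lemma sublinear_lower:
  assumes "sublinear p" shows "- p (- x) \<le> p x"
proof -
  have "p (x + - x) \<le> p x + p (- x)" using assms unfolding sublinear_def by blast
  then show ?thesis using sublinear_zero[OF assms] by simp
qed

text \<open>For sublinear \<open>p\<close> this is the greatest sublinear functional below
  \<open>p\<close> whose value at \<open>- a\<close> is at most \<open>- p a\<close>: any such
  \<open>q\<close> satisfies \<open>q x \<le> q (x + t *\<^sub>R a) + t * q (- a)\<close>, which is
  bounded by every term of the infimum.\<close>

definition tilt :: "('a::real_vector \<Rightarrow> real) \<Rightarrow> 'a \<Rightarrow> 'a \<Rightarrow> real" where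
  "tilt p a x = (INF t\<in>{0..}. p (x + t *\<^sub>R a) - t * p a)"

lemma sublinear_scale:
  assumes "sublinear p" "t \<ge> 0" shows "p (t *\<^sub>R x) = t * p x"
  using assms sublinear_zero[OF assms(1)] unfolding sublinear_def by (cases "t = 0") auto

lemma tilt_bdd:
  assumes "sublinear p" shows "bdd_below ((\<lambda>t. p (x + t *\<^sub>R a) - t * p a) ` {0..})"
proof (rule bdd_belowI2)
  fix t :: real assume t: "t \<in> {0..}"
  have "p (t *\<^sub>R a) \<le> p (x + t *\<^sub>R a) + p (- x)"
    using assms unfolding sublinear_def
    by (elim conjE allE[of _ "x + t *\<^sub>R a"] allE[of _ "- x"]) simp
  then show "- p (- x) \<le> p (x + t *\<^sub>R a) - t * p a"
    using sublinear_scale[OF assms] t by simp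
qed

lemma tilt_le:
  assumes "sublinear p" "t \<ge> 0" shows "tilt p a x \<le> p (x + t *\<^sub>R a) - t * p a"
  unfolding tilt_def using tilt_bdd[OF assms(1)] assms(2) by (intro cINF_lower) auto

lemma tilt_greatest:
  assumes "\<And>t. t \<ge> 0 \<Longrightarrow> c \<le> p (x + t *\<^sub>R a) - t * p a" shows "c \<le> tilt p a x"
  unfolding tilt_def using assms by (intro cINF_greatest) auto

lemma sublinear_tilt:
  assumes p: "sublinear p" shows "sublinear (tilt p a)"
  unfolding sublinear_def
proof (intro conjI allI impI)
  fix x y
  have *: "tilt p a (x + y) \<le> (p (x + t *\<^sub>R a) - t * p a) + (p (y + s *\<^sub>R a) - s * p a)"
    if "t \<ge> 0" "s \<ge> 0" for t s
  proof -
    have "p (x + y + (t + s) *\<^sub>R a) \<le> p (x + t *\<^sub>R a) + p (y + s *\<^sub>R a)"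
      using p unfolding sublinear_def
      by (elim conjE allE[of _ "x + t *\<^sub>R a"] allE[of _ "y + s *\<^sub>R a"])
        (simp add: scaleR_add_left algebra_simps)
    then show ?thesis using tilt_le[OF p, of "t + s" a "x + y"] that by (simp add: algebra_simps)
  qed
  have "tilt p a (x + y) - (p (x + t *\<^sub>R a) - t * p a) \<le> tilt p a y" if "t \<ge> 0" for t
    using *[OF that] by (intro tilt_greatest) (simp add: algebra_simps)
  then have "tilt p a (x + y) - tilt p a y \<le> tilt p a x"
    by (intro tilt_greatest) (simp add: algebra_simps)
  then show "tilt p a (x + y) \<le> tilt p a x + tilt p a y" by simp
next
  have le: "tilt p a (s *\<^sub>R x) \<le> s * tilt p a x" if s: "s > 0" for s x
  proof -
    have "tilt p a (s *\<^sub>R x) / s \<le> tilt p a x"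
    proof (rule tilt_greatest)
      fix t :: real assume t: "t \<ge> 0"
      have "tilt p a (s *\<^sub>R x) \<le> p (s *\<^sub>R x + (s * t) *\<^sub>R a) - s * t * p a"
        using tilt_le[OF p, of "s * t" a "s *\<^sub>R x"] s t by simp
      also have "p (s *\<^sub>R x + (s * t) *\<^sub>R a) = s * p (x + t *\<^sub>R a)"
        using sublinear_scale[OF p, of s "x + t *\<^sub>R a"] s by (simp add: scaleR_add_right)
      finally show "tilt p a (s *\<^sub>R x) / s \<le> p (x + t *\<^sub>R a) - t * p a"
        using s by (simp add: field_simps)
    qed
    then show ?thesis using s by (simp add: field_simps)
  qed
  fix s :: real and x assume s: "s > 0"
  have "tilt p a ((1 / s) *\<^sub>R (s *\<^sub>R x)) \<le> (1 / s) * tilt p a (s *\<^sub>R x)"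
    using s by (intro le) auto
  then have "s * tilt p a x \<le> tilt p a (s *\<^sub>R x)" using s by (simp add: field_simps)
  with le[OF s, of x] show "tilt p a (s *\<^sub>R x) = s * tilt p a x" by simp
qed

text \<open>Zorn's lemma for the reversed pointwise order. Every sublinear \<open>q \<le> p\<close>
  satisfies \<open>- p (- x) \<le> - q (- x) \<le> q x\<close>, so pointwise infima over a chain
  stay finite.\<close>

lemma minimal_sublinear_below:
  fixes p :: "'a::real_vector \<Rightarrow> real"
  assumes p: "sublinear p"
  obtains q where "sublinear q" "q \<le> p" "\<And>q'. sublinear q' \<Longrightarrow> q' \<le> q \<Longrightarrow> q' = q"
proof -
  define A where "A = {q. sublinear q \<and> q \<le> p}"
  have "\<exists>m\<in>A. \<forall>a\<in>A. (\<lambda>u v. v \<le> u) m a \<longrightarrow> a = m"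
  proof (rule predicate_Zorn)
    show "partial_order_on A (relation_of (\<lambda>u v. v \<le> u) A)"
      by (rule partial_order_on_relation_ofI) auto
    fix C assume C: "C \<in> Chains (relation_of (\<lambda>u v. v \<le> u) A)"
    have CA: "C \<subseteq> A" using C unfolding Chains_def relation_of_def by auto
    have Ct: "u \<le> v \<or> v \<le> u" if "u \<in> C" "v \<in> C" for u v
      using C that unfolding Chains_def relation_of_def by auto
    show "\<exists>u\<in>A. \<forall>a\<in>C. u \<le> a"
    proof (cases "C = {}")
      case True then show ?thesis using p by (intro bexI[of _ p]) (auto simp: A_def)
    next
      case False
      define u where "u x = (INF q\<in>C. q x)" for x
      have bdd: "bdd_below ((\<lambda>q. q x) ` C)" for x
      proof (rule bdd_belowI2)
        fix q assume "q \<in> C"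
        then have q: "sublinear q" "q \<le> p" using CA by (auto simp: A_def)
        show "- p (- x) \<le> q x" using sublinear_lower[OF q(1), of x] le_funD[OF q(2), of "- x"] by simp
      qed
      have uq: "u x \<le> q x" if "q \<in> C" for q x
        unfolding u_def using bdd that by (rule cINF_lower)
      have ug: "c \<le> u x" if "\<And>q. q \<in> C \<Longrightarrow> c \<le> q x" for c x
        unfolding u_def using False that by (rule cINF_greatest)
      have sub: "sublinear q" if "q \<in> C" for q using CA that by (auto simp: A_def)
      have "sublinear u"
        unfolding sublinear_def
      proof (intro conjI allI impI)
        fix x y
        \<comment> \<open>The infima at \<open>x\<close> and at \<open>y\<close> are approached by
          different members \<open>q\<close> and \<open>r\<close>. In a chain one of them lies below
          both, and its own subadditivity gives the bound.\<close>
        have *: "u (x + y) \<le> q x + r y" if qr: "q \<in> C" "r \<in> C" for q r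
        proof -
          obtain s where s: "s \<in> C" "s \<le> q" "s \<le> r" using Ct[OF qr] qr by blast
          have "s (x + y) \<le> s x + s y" using sub[OF s(1)] unfolding sublinear_def by blast
          then have "u (x + y) \<le> s x + s y" using uq[OF s(1), of "x + y"] by simp
          then show ?thesis using le_funD[OF s(2), of x] le_funD[OF s(3), of y] by simp
        qed
        have "u (x + y) - q x \<le> u y" if "q \<in> C" for q
          using *[OF that] by (intro ug) (simp add: algebra_simps)
        then have "u (x + y) - u y \<le> u x" by (intro ug) (simp add: algebra_simps)
        then show "u (x + y) \<le> u x + u y" by simp
      next
        fix t :: real and x assume t: "t > 0"
        have "u (t *\<^sub>R x) / t \<le> u x"
        proof (rule ug)
          fix q assume q: "q \<in> C"
          show "u (t *\<^sub>R x) / t \<le> q x"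
            using uq[OF q, of "t *\<^sub>R x"] sublinear_scale[OF sub[OF q], of t x] t by (simp add: field_simps)
        qed
        moreover have "t * u x \<le> u (t *\<^sub>R x)"
        proof (rule ug)
          fix q assume q: "q \<in> C"
          show "t * u x \<le> q (t *\<^sub>R x)"
            using uq[OF q, of x] sublinear_scale[OF sub[OF q], of t x] t by simp
        qed
        ultimately show "u (t *\<^sub>R x) = t * u x" using t by (simp add: field_simps)
      qed
      moreover have "u \<le> p"
      proof (rule le_funI)
        fix x
        obtain q where q: "q \<in> C" using False by blast
        then have "q x \<le> p x" using CA by (auto simp: A_def le_fun_def)
        then show "u x \<le> p x" using uq[OF q, of x] by simp
      qed
      ultimately show ?thesis using uq by (intro bexI[of _ u]) (auto simp: A_def le_fun_def)
    qed
  qed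
  then obtain m where m: "m \<in> A" "\<And>a. a \<in> A \<Longrightarrow> a \<le> m \<Longrightarrow> a = m" by blast
  show ?thesis
  proof (rule that)
    show "sublinear m" "m \<le> p" using m(1) by (auto simp: A_def)
    fix q' assume "sublinear q'" "q' \<le> m"
    moreover from this m(1) have "q' \<in> A" unfolding A_def by (auto intro: order_trans)
    ultimately show "q' = m" by (intro m(2))
  qed
qed

text \<open>A pointwise minimal sublinear functional equals each of its tilts, hence is additive.\<close>

lemma minimal_sublinear_linear:
  assumes q: "sublinear q" and min: "\<And>q'. sublinear q' \<Longrightarrow> q' \<le> q \<Longrightarrow> q' = q"
  shows "linear q"
proof -
  have "tilt q a \<le> q" for a
    using tilt_le[OF q, of 0 a] by (auto simp: le_fun_def)
  then have eq: "tilt q a = q" for a using min sublinear_tilt[OF q] by blast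
  have add: "q (x + a) = q x + q a" for x a
  proof (rule antisym)
    show "q (x + a) \<le> q x + q a" using q by (auto simp: sublinear_def)
    show "q x + q a \<le> q (x + a)" using tilt_le[OF q, of 1 a x] eq[of a] by simp
  qed
  have neg: "q (- x) = - q x" for x using add[of x "- x"] sublinear_zero[OF q] by simp
  show ?thesis
  proof (rule linearI)
    show "q (x + a) = q x + q a" for x a by (rule add)
    fix r :: real and x
    show "q (r *\<^sub>R x) = r *\<^sub>R q x"
      using sublinear_scale[OF q, of r x] sublinear_scale[OF q, of "- r" x] neg[of "r *\<^sub>R x"]
      by (cases "r \<ge> 0") auto
  qed
qed

text \<open>Instead of extending from the line through \<open>a\<close>, a minimal functional is
  taken below \<open>tilt norm a\<close>. The tilt is at most \<open>- norm a\<close> at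
  \<open>- a\<close>, so linearity forces the value \<open>norm a\<close> at
  \<open>a\<close>.\<close>

theorem Hahn_Banach_norm:
  fixes a :: "'a::real_normed_vector"
  obtains f :: "'a \<Rightarrow> real" where "bounded_linear f" "\<And>x. \<bar>f x\<bar> \<le> norm x" "f a = norm a"
proof -
  have n: "sublinear (norm :: 'a \<Rightarrow> real)"
    by (auto simp: sublinear_def norm_triangle_ineq)
  obtain q where q: "sublinear q" "q \<le> tilt norm a" "\<And>q'. sublinear q' \<Longrightarrow> q' \<le> q \<Longrightarrow> q' = q"
    using minimal_sublinear_below[OF sublinear_tilt[OF n]] by blast
  have lin: "linear q" using q(1,3) by (rule minimal_sublinear_linear)
  have le: "q x \<le> norm x" for x
    using le_funD[OF q(2), of x] tilt_le[OF n, of 0 a x] by simp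
  have ab: "\<bar>q x\<bar> \<le> norm x" for x
    using le[of x] le[of "- x"] linear_neg[OF lin, of x] by auto
  have "q (- a) \<le> - norm a"
    using le_funD[OF q(2), of "- a"] tilt_le[OF n, of 1 a "- a"] by simp
  then have "norm a \<le> q a" using linear_neg[OF lin, of a] by simp
  then have "q a = norm a" using le[of a] by simp
  moreover have "bounded_linear q"
    using lin ab by (intro bounded_linear_intro[where K=1]) (auto simp: linear_add linear_scale)
  ultimately show ?thesis using that ab by blast
qed

text \<open>By separability it is enough to norm the points of a countable dense set. Each closed
  ball becomes a countable intersection of slabs, which is how inequalities for finitely many
  functionals reach it.\<close>

lemma norming_sequence:
  obtains g :: "nat \<Rightarrow> 'a::{real_normed_vector, second_countable_topology} \<Rightarrow> real"
  where "\<And>n. bounded_linear (g n)" "\<And>n x. \<bar>g n x\<bar> \<le> norm x"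
    "\<And>x r. norm x \<le> r \<longleftrightarrow> (\<forall>n. \<bar>g n x\<bar> \<le> r)"
proof -
  obtain D :: "'a set" where D: "countable D" "\<And>X. open X \<Longrightarrow> X \<noteq> {} \<Longrightarrow> \<exists>d\<in>D. d \<in> X"
    using countable_dense_setE by blast
  have "\<exists>f :: 'a \<Rightarrow> real. bounded_linear f \<and> (\<forall>x. \<bar>f x\<bar> \<le> norm x) \<and> f a = norm a" for a
    using Hahn_Banach_norm[of a] by metis
  then obtain F :: "'a \<Rightarrow> 'a \<Rightarrow> real" where
    F: "\<And>a. bounded_linear (F a)" "\<And>a x. \<bar>F a x\<bar> \<le> norm x" "\<And>a. F a a = norm a"
    by metis
  define g where "g n = F (from_nat_into D n)" for n
  have "norm x \<le> r" if *: "\<And>n. \<bar>g n x\<bar> \<le> r" for x r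
  proof (rule field_le_epsilon)
    fix e :: real assume "e > 0"
    then obtain d where d: "d \<in> D" "dist x d < e / 2"
      using D(2)[of "ball x (e/2)"] by auto
    obtain n where n: "from_nat_into D n = d" using d(1) D(1) by (metis from_nat_into_surj)
    have "norm x \<le> norm d + norm (x - d)" by (metis norm_triangle_sub)
    also have "norm d = F d x - F d (x - d)"
      using F(3)[of d] linear_diff[OF bounded_linear.linear[OF F(1)[of d]], of x d] by simp
    also have "\<dots> \<le> r + norm (x - d)" using *[of n] F(2)[of d "x - d"] n by (auto simp: g_def)
    finally show "norm x \<le> r + e" using d(2) by (simp add: dist_norm)
  qed
  moreover have "\<bar>g n x\<bar> \<le> r" if "norm x \<le> r" for n x r
    using F(2)[of "from_nat_into D n" x] that by (simp add: g_def)
  ultimately show ?thesis using F by (intro that[of g]) (auto simp: g_def)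
qed

section \<open>Uniqueness of characteristic functionals\<close>

text \<open>The algebra for Stone--Weierstrass. The phase \<open>b\<close> covers sines and
  constants and makes a product of two generators a sum of two generators; integrals of members are
  determined by the characteristic functional.\<close>

inductive_set trig_poly :: "('a::real_normed_vector \<Rightarrow> real) set" where
  cos: "bounded_linear f \<Longrightarrow> (\<lambda>x. c * cos (f x + b)) \<in> trig_poly"
| add: "p \<in> trig_poly \<Longrightarrow> q \<in> trig_poly \<Longrightarrow> (\<lambda>x. p x + q x) \<in> trig_poly"

lemma trig_poly_const: "(\<lambda>_. c) \<in> trig_poly"
  using trig_poly.cos[of "\<lambda>_. 0" c 0] by (simp add: bounded_linear_zero)

lemma trig_poly_mult:
  assumes p: "p \<in> trig_poly" and q: "q \<in> trig_poly"
  shows "(\<lambda>x. p x * q x) \<in> trig_poly"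
  using p
proof induction
  case (cos f c b)
  from q show ?case
  proof induction
    case (cos g d a)
    have "(\<lambda>x. (c * d / 2) * cos (f x - g x + (b - a)) + (c * d / 2) * cos (f x + g x + (b + a))) \<in> trig_poly"
      by (intro trig_poly.intros bounded_linear_sub bounded_linear_add cos \<open>bounded_linear f\<close>)
    moreover have "(c * d / 2) * cos (f x - g x + (b - a)) + (c * d / 2) * cos (f x + g x + (b + a))
        = c * cos (f x + b) * (d * cos (g x + a))" for x
      using cos_times_cos[of "f x + b" "g x + a"] by (simp add: algebra_simps add_divide_distrib)
    ultimately show ?case by simp
  next
    case (add p q)
    from trig_poly.add[OF add.IH] show ?case by (simp add: algebra_simps)
  qed
next
  case (add p p')
  from trig_poly.add[OF add.IH] show ?case by (simp add: algebra_simps)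
qed

lemma trig_poly_continuous:
  assumes "p \<in> trig_poly" shows "continuous_on S p"
  using assms
proof induction
  case (cos f c b)
  then show ?case by (intro continuous_intros linear_continuous_on)
next
  case (add p q)
  then show ?case by (intro continuous_on_add)
qed

lemma trig_poly_bounded:
  assumes "p \<in> trig_poly" shows "\<exists>C. \<forall>x. \<bar>p x\<bar> \<le> C"
  using assms
proof induction
  case (cos f c b)
  have "\<bar>c * cos (f x + b)\<bar> \<le> \<bar>c\<bar>" for x
    using mult_left_mono[OF abs_cos_le_one[of "f x + b"], of "\<bar>c\<bar>"] by (simp add: abs_mult)
  then show ?case by blast
next
  case (add p q)
  then obtain C D where "\<forall>x. \<bar>p x\<bar> \<le> C" "\<forall>x. \<bar>q x\<bar> \<le> D" by blast
  then have "\<forall>x. \<bar>p x + q x\<bar> \<le> C + D" by (meson abs_triangle_ineq add_mono order_trans)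
  then show ?case by blast
qed

text \<open>Permits clipping within the algebra: the clipping function is replaced by a nearby
  polynomial and composed.\<close>

lemma trig_poly_compose_polynomial:
  assumes "real_polynomial_function r" "p \<in> trig_poly"
  shows "(\<lambda>x. r (p x)) \<in> trig_poly"
  using assms(1)
proof induction
  case (linear f)
  then obtain c where "f = (\<lambda>u. u * c)" by (auto simp: real_bounded_linear)
  then show ?case using trig_poly_mult[OF assms(2) trig_poly_const[of c]] by simp
next
  case (const c)
  then show ?case by (rule trig_poly_const)
next
  case (add f g)
  then show ?case by (intro trig_poly.add)
next
  case (mult f g)
  then show ?case by (intro trig_poly_mult)
qed

lemma bounded_continuous_integrable:
  fixes p :: "'a::topological_space \<Rightarrow> real"
  assumes "prob_space M" "sets M = sets borel" "continuous_on UNIV p" "\<And>x. \<bar>p x\<bar> \<le> C"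
  shows "integrable M p"
proof -
  interpret prob_space M by fact
  have "p \<in> borel_measurable M"
    using borel_measurable_continuous_onI[OF assms(3)] assms(2) by (simp cong: measurable_cong_sets)
  then show ?thesis using assms(4) by (intro integrable_const_bound[where B=C]) auto
qed

lemma trig_poly_integral_eq:
  fixes M N :: "'a::real_normed_vector measure"
  assumes M: "prob_space M" "sets M = sets borel" and N: "prob_space N" "sets N = sets borel"
    and eq: "\<And>f. bounded_linear f \<Longrightarrow> (CLINT x|M. iexp (f x)) = (CLINT x|N. iexp (f x))"
    and p: "p \<in> trig_poly"
  shows "(LINT x|M. p x) = (LINT x|N. p x)"
  using p
proof induction
  case (cos f c b)
  have cf: "continuous_on UNIV f" using cos by (rule linear_continuous_on)
  have int: "integrable L (\<lambda>x. iexp (f x))" "integrable L (\<lambda>x. cos (f x))" "integrable L (\<lambda>x. sin (f x))"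
    if "prob_space L" "sets L = sets borel" for L
  proof -
    interpret prob_space L by fact
    have [measurable]: "f \<in> borel_measurable L"
      using borel_measurable_continuous_onI[OF cf] that(2) by (simp cong: measurable_cong_sets)
    show "integrable L (\<lambda>x. iexp (f x))"
      by (intro integrable_const_bound[where B=1]) auto
    show "integrable L (\<lambda>x. cos (f x))" "integrable L (\<lambda>x. sin (f x))"
      by (intro integrable_const_bound[where B=1]; simp)+
  qed
  have Re: "(LINT x|L. cos (f x)) = Re (CLINT x|L. iexp (f x))" "(LINT x|L. sin (f x)) = Im (CLINT x|L. iexp (f x))"
    if "prob_space L" "sets L = sets borel" for L
    using int[OF that] integral_Re[of L "\<lambda>x. iexp (f x)"] integral_Im[of L "\<lambda>x. iexp (f x)"]
    by (simp_all add: Re_exp Im_exp)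
  have "(LINT x|L. c * cos (f x + b)) = c * (cos b * (LINT x|L. cos (f x)) - sin b * (LINT x|L. sin (f x)))"
    if "prob_space L" "sets L = sets borel" for L
    using int[OF that] by (simp add: cos_add mult.commute)
  from this[OF M] this[OF N] show ?case
    unfolding Re(1)[OF M] Re(2)[OF M] Re(1)[OF N] Re(2)[OF N] eq[OF cos] by (simp only:)
next
  case (add p q)
  have "integrable L r" if r: "r \<in> trig_poly" and L: "prob_space L" "sets L = sets borel"
    for r :: "'a \<Rightarrow> real" and L
  proof -
    obtain C where "\<And>x. \<bar>r x\<bar> \<le> C" using trig_poly_bounded[OF r] by blast
    then show ?thesis by (rule bounded_continuous_integrable[OF L trig_poly_continuous[OF r]])
  qed
  then show ?case using add M N by simp
qed

text \<open>Tightness of one probability measure on a complete separable space (Ulam), read off from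
  inner regularity.\<close>

lemma compact_mass_near_one:
  fixes M :: "'a::{second_countable_topology, complete_space} measure"
  assumes "prob_space M" "sets M = sets borel" "e > 0"
  obtains K where "compact K" "measure M (- K) < e"
proof -
  interpret prob_space M by fact
  have sp: "space M = UNIV" using sets_eq_imp_space_eq[OF assms(2)] by simp
  have "emeasure M UNIV = (SUP K \<in> {K. K \<subseteq> UNIV \<and> compact K}. emeasure M K)"
    using assms(2) by (intro inner_regular) auto
  then have "1 = (SUP K \<in> {K. K \<subseteq> UNIV \<and> compact K}. emeasure M K)"
    using emeasure_space_1 sp by simp
  then have "ennreal (1 - e) < (SUP K \<in> {K. K \<subseteq> UNIV \<and> compact K}. emeasure M K)"
    using \<open>e > 0\<close> by (metis diff_less_eq ennreal_less_one_iff less_add_same_cancel1)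
  then obtain K where K: "compact K" "ennreal (1 - e) < emeasure M K"
    by (auto simp: less_SUP_iff)
  have "K \<in> sets M" using K(1) assms(2) by (simp add: compact_imp_closed)
  then have "measure M (- K) = 1 - measure M K" using prob_compl[of K] sp by (simp add: Compl_eq_Diff_UNIV)
  moreover have "1 - e < measure M K"
    using K(2) measure_nonneg[of M K] \<open>e > 0\<close>
    by (cases "1 - e \<ge> 0") (auto simp: emeasure_eq_measure ennreal_less_iff intro: less_le_trans[of _ 0])
  ultimately show ?thesis using that K(1) by auto
qed

text \<open>Stone--Weierstrass controls the approximant \<open>g\<close> only on the compact set
  \<open>K\<close>; elsewhere it may be as large as \<open>C\<close>, which depends on
  \<open>K\<close>. Composing with a polynomial close to the clipping \<open>T\<close> on
  \<open>{-C..C}\<close> keeps it within \<open>e\<close> of the interval from 0 to 1 everywhere, so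
  the small mass outside \<open>K\<close> costs only a multiple of \<open>e\<close>.\<close>

lemma continuous_integral_eq:
  fixes M N :: "'a::{banach, second_countable_topology} measure"
  assumes M: "prob_space M" "sets M = sets borel" and N: "prob_space N" "sets N = sets borel"
    and eq: "\<And>f. bounded_linear f \<Longrightarrow> (CLINT x|M. iexp (f x)) = (CLINT x|N. iexp (f x))"
    and cont: "continuous_on UNIV \<phi>" and range: "\<And>x. 0 \<le> \<phi> x" "\<And>x. \<phi> x \<le> (1::real)"
  shows "(LINT x|M. \<phi> x) = (LINT x|N. \<phi> x)"
proof -
  have "\<bar>(LINT x|M. \<phi> x) - (LINT x|N. \<phi> x)\<bar> \<le> 10 * e" if e: "0 < e" "e < 1" for e
  proof -
    obtain K1 where K1: "compact K1" "measure M (- K1) < e" using compact_mass_near_one[OF M e(1)] by blast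
    obtain K2 where K2: "compact K2" "measure N (- K2) < e" using compact_mass_near_one[OF N e(1)] by blast
    define K where "K = K1 \<union> K2"
    have K: "compact K" using K1 K2 by (simp add: K_def compact_Un)
    interpret T: function_ring_on "trig_poly :: ('a \<Rightarrow> real) set" K
    proof
      fix x y :: 'a assume "x \<noteq> y"
      obtain f where f: "bounded_linear f" "f (x - y) = norm (x - y)" using Hahn_Banach_norm[of "x - y"] by metis
      define a where "a = norm (x - y)"
      have a: "a > 0" using \<open>x \<noteq> y\<close> by (simp add: a_def)
      have fx: "f x - f y = a" using f by (simp add: a_def linear_diff bounded_linear.linear)
      \<comment> \<open>Frequency and phase put the argument of the cosine at \<open>pi\<close> for
        \<open>x\<close> and at 0 for \<open>y\<close>, so the values are -1 and 1.\<close>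
      have "(\<lambda>z. 1 * cos (pi / a * f z + (- (pi / a * f y)))) \<in> trig_poly"
        using f by (intro trig_poly.cos bounded_linear_const_mult)
      moreover have "pi / a * f x + (- (pi / a * f y)) = pi"
        using fx a by (simp add: field_simps flip: right_diff_distrib)
      ultimately show "\<exists>f\<in>trig_poly. f x \<noteq> f y" by (intro bexI) auto
    qed (auto simp: K trig_poly_continuous trig_poly.add trig_poly_mult trig_poly_const)
    obtain g where g: "g \<in> trig_poly" "\<And>x. x \<in> K \<Longrightarrow> \<bar>\<phi> x - g x\<bar> < e"
      using T.Stone_Weierstrass_basic[OF continuous_on_subset[OF cont] e(1)] by auto
    obtain C where C: "\<And>x. \<bar>g x\<bar> \<le> C" using trig_poly_bounded[OF g(1)] by blast
    define T where "T u = max 0 (min 1 u)" for u :: real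
    have "continuous_on {-C..C} T" unfolding T_def by (intro continuous_intros)
    then obtain r where r: "real_polynomial_function r" "\<And>u. u \<in> {-C..C} \<Longrightarrow> \<bar>T u - r u\<bar> < e"
      using Stone_Weierstrass_real_polynomial_function[of "{-C..C}" T e] e(1) by auto
    define q where "q x = r (g x)" for x
    have q: "q \<in> trig_poly" unfolding q_def using trig_poly_compose_polynomial[OF r(1) g(1)] .
    have rq: "\<bar>T (g x) - q x\<bar> < e" for x using r(2)[of "g x"] C[of x] by (auto simp: q_def abs_le_iff)
    have bnd: "\<bar>\<phi> x - q x\<bar> \<le> 2 * e + 3 * indicator (- K) x" for x
    proof (cases "x \<in> K")
      case True
      have "\<bar>\<phi> x - T (g x)\<bar> \<le> e" using g(2)[OF True] range[of x] by (auto simp: T_def)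
      then show ?thesis using rq[of x] True by simp
    next
      case False
      have "\<bar>\<phi> x - T (g x)\<bar> \<le> 1" using range[of x] by (auto simp: T_def)
      then show ?thesis using rq[of x] False e by simp
    qed
    have est: "\<bar>(LINT x|L. \<phi> x) - (LINT x|L. q x)\<bar> \<le> 5 * e"
      if L: "prob_space L" "sets L = sets borel" and LK: "measure L (- K) \<le> e" for L
    proof -
      interpret prob_space L by fact
      have i1: "integrable L \<phi>" using bounded_continuous_integrable[OF L cont, of 1] range
        by (simp add: abs_le_iff order_trans[of _ 0])
      have i2: "integrable L q"
        using bounded_continuous_integrable[OF L trig_poly_continuous[OF q]] trig_poly_bounded[OF q] by blast
      have Ks: "- K \<in> sets L" using K L(2) by (simp add: compact_imp_closed borel_closed borel_comp)
      have i3: "integrable L (indicator (- K) :: 'a \<Rightarrow> real)" using Ks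
        by (intro integrable_const_bound[where B=1]) auto
      have "\<bar>(LINT x|L. \<phi> x) - (LINT x|L. q x)\<bar> = \<bar>LINT x|L. \<phi> x - q x\<bar>" using i1 i2 by simp
      also have "\<dots> \<le> (LINT x|L. \<bar>\<phi> x - q x\<bar>)" by (rule integral_abs_bound)
      also have "\<dots> \<le> (LINT x|L. 2 * e + 3 * indicator (- K) x)"
        using i1 i2 i3 bnd by (intro integral_mono) auto
      also have "\<dots> = 2 * e + 3 * measure L (- K)" using i3 Ks by (simp add: prob_space)
      finally show ?thesis using LK by simp
    qed
    have mono: "measure L (- K) \<le> measure L (- K')" if "prob_space L" "sets L = sets borel" "compact K'" "K' \<subseteq> K"
      for L :: "'a measure" and K'
    proof -
      interpret prob_space L by fact
      show ?thesis using that by (intro finite_measure_mono) (auto simp: compact_imp_closed borel_closed borel_comp)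
    qed
    have "measure M (- K) \<le> e" "measure N (- K) \<le> e"
      using mono[OF M K1(1)] mono[OF N K2(1)] K1(2) K2(2) by (auto simp: K_def)
    then show ?thesis using est[OF M] est[OF N] trig_poly_integral_eq[OF M N eq q] by linarith
  qed
  note * = this
  have "\<bar>(LINT x|M. \<phi> x) - (LINT x|N. \<phi> x)\<bar> \<le> 0"
  proof (rule field_le_epsilon)
    fix d :: real assume "d > 0"
    then have "0 < min (d / 10) (1 / 2)" "min (d / 10) (1 / 2) < (1::real)" by auto
    from *[OF this] show "\<bar>(LINT x|M. \<phi> x) - (LINT x|N. \<phi> x)\<bar> \<le> 0 + d" by linarith
  qed
  then show ?thesis by simp
qed

theorem char_functional_unique:
  fixes M N :: "'a::{banach, second_countable_topology} measure"
  assumes M: "prob_space M" "sets M = sets borel" and N: "prob_space N" "sets N = sets borel"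
    and eq: "\<And>f. bounded_linear f \<Longrightarrow> (CLINT x|M. iexp (f x)) = (CLINT x|N. iexp (f x))"
  shows "M = N"
proof (rule measure_eqI_generator_eq)
  show "Int_stable {A::'a set. closed A}" by (auto simp: Int_stable_def)
  show "{A::'a set. closed A} \<subseteq> Pow UNIV" by auto
  show "sets M = sigma_sets UNIV {A. closed A}" "sets N = sigma_sets UNIV {A. closed A}"
    using M(2) N(2) by (simp_all add: borel_eq_closed)
  show "range (\<lambda>_. UNIV) \<subseteq> {A::'a set. closed A}" "(\<Union>i::nat. UNIV) = (UNIV::'a set)" by auto
  show "emeasure M UNIV \<noteq> \<infinity>"
    using finite_measure.emeasure_finite[OF prob_space.axioms(1)[OF M(1)]] by (simp add: infinity_ennreal_def)
  fix A :: "'a set" assume "A \<in> {A. closed A}"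
  then have A: "closed A" by simp
  show "emeasure M A = emeasure N A"
  \<comment> \<open>\<open>infdist\<close> to the empty set is 0 by convention, so there the
    functions \<open>\<phi> n\<close> would be constantly 1 instead of approximating the
    indicator.\<close>
  proof (cases "A = {}")
    case False
    define \<phi> where "\<phi> n x = max 0 (1 - real n * infdist x A)" for n x
    have cont: "continuous_on UNIV (\<phi> n)" for n unfolding \<phi>_def by (intro continuous_intros)
    have range: "0 \<le> \<phi> n x" "\<phi> n x \<le> 1" for n x by (auto simp: \<phi>_def infdist_nonneg)
    have lim: "(\<lambda>n. \<phi> n x) \<longlonglongrightarrow> indicator A x" for x
    proof (cases "x \<in> A")
      case True then show ?thesis by (simp add: \<phi>_def)
    next
      case False
      then have "infdist x A > 0" using A \<open>A \<noteq> {}\<close> by (metis in_closed_iff_infdist_zero infdist_nonneg less_eq_real_def)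
      then obtain k where k: "1 < real k * infdist x A" using reals_Archimedean3 by blast
      have "\<phi> n x = 0" if "n \<ge> k" for n
      proof -
        have "real k * infdist x A \<le> real n * infdist x A" using that infdist_nonneg by (intro mult_right_mono) auto
        then show ?thesis using k by (simp add: \<phi>_def)
      qed
      then show ?thesis using False by (intro tendsto_eventually) (auto simp: eventually_sequentially)
    qed
    have "(\<lambda>n. LINT x|L. \<phi> n x) \<longlonglongrightarrow> measure L A" if L: "prob_space L" "sets L = sets borel" for L
    proof -
      interpret prob_space L by fact
      have As: "A \<in> sets L" using A L by simp
      have [measurable]: "\<phi> n \<in> borel_measurable L" for n
        using borel_measurable_continuous_onI[OF cont] L(2) by (simp cong: measurable_cong_sets)
      have "(\<lambda>n. LINT x|L. \<phi> n x) \<longlonglongrightarrow> (LINT x|L. indicator A x)"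
        by (rule integral_dominated_convergence[where w="\<lambda>_. 1"]) (use As lim range in \<open>auto simp: abs_le_iff order_trans[of _ 0]\<close>)
      then show ?thesis using As by simp
    qed
    note this[OF M] this[OF N]
    moreover have "(LINT x|M. \<phi> n x) = (LINT x|N. \<phi> n x)" for n
      by (rule continuous_integral_eq[OF M N eq cont range])
    ultimately have "measure M A = measure N A" using LIMSEQ_unique by force
    then show ?thesis using M(1) N(1) by (simp add: finite_measure.emeasure_eq_measure prob_space.axioms(1))
  qed simp
qed

section \<open>Gaussian measures\<close>

definition square_integrable :: "'a measure \<Rightarrow> ('a \<Rightarrow> real) \<Rightarrow> bool" where
  "square_integrable M f \<longleftrightarrow> f \<in> borel_measurable M \<and> integrable M (\<lambda>x. (f x)\<^sup>2)"

definition sq_norm :: "'a measure \<Rightarrow> ('a \<Rightarrow> real) \<Rightarrow> real" where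
  "sq_norm M f = (LINT x|M. (f x)\<^sup>2)"

lemma sq_norm_nonneg: "0 \<le> sq_norm M f"
  by (simp add: sq_norm_def)

lemma square_integrable_mult:
  assumes "square_integrable M f" "square_integrable M g"
  shows "integrable M (\<lambda>x. f x * g x)"
proof (rule Bochner_Integration.integrable_bound)
  show "integrable M (\<lambda>x. (f x)\<^sup>2 + (g x)\<^sup>2)" using assms by (simp add: square_integrable_def)
  show "(\<lambda>x. f x * g x) \<in> borel_measurable M" using assms by (auto simp: square_integrable_def)
  have "\<bar>a * b\<bar> \<le> a\<^sup>2 + b\<^sup>2" for a b :: real
    using sum_squares_bound[of "\<bar>a\<bar>" "\<bar>b\<bar>"] abs_ge_zero[of "a * b"]
    unfolding abs_mult mult.assoc power2_abs by linarith
  then show "AE x in M. norm (f x * g x) \<le> norm ((f x)\<^sup>2 + (g x)\<^sup>2)" by simp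
qed

lemma square_integrable_add:
  assumes "square_integrable M f" "square_integrable M g"
  shows "square_integrable M (\<lambda>x. f x + g x)"
  using assms square_integrable_mult[OF assms] unfolding square_integrable_def
  by (auto simp add: power2_sum mult.assoc)

lemma square_integrable_scale:
  assumes "square_integrable M f" shows "square_integrable M (\<lambda>x. c * f x)"
  using assms unfolding square_integrable_def by (auto simp add: power_mult_distrib)

lemma square_integrable_diff:
  assumes "square_integrable M f" "square_integrable M g"
  shows "square_integrable M (\<lambda>x. f x - g x)"
  using square_integrable_add[OF assms(1) square_integrable_scale[OF assms(2), of "-1"]] by simp

lemma sq_norm_scale: "sq_norm M (\<lambda>x. c * f x) = c\<^sup>2 * sq_norm M f"
  by (simp add: sq_norm_def power_mult_distrib)

lemma sq_norm_add:
  assumes "square_integrable M f" "square_integrable M g"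
  shows "sq_norm M (\<lambda>x. f x + g x) = sq_norm M f + sq_norm M g + 2 * (LINT x|M. f x * g x)"
  using assms square_integrable_mult[OF assms] unfolding square_integrable_def sq_norm_def
  by (simp add: power2_sum mult.assoc)

lemma sq_norm_diff:
  assumes "square_integrable M f" "square_integrable M g"
  shows "sq_norm M (\<lambda>x. f x - g x) = sq_norm M f + sq_norm M g - 2 * (LINT x|M. f x * g x)"
  using assms square_integrable_mult[OF assms] unfolding square_integrable_def sq_norm_def
  by (simp add: power2_diff mult.assoc)

text \<open>Besides Cauchy--Schwarz this yields an Euler--Lagrange equation: for
  \<open>a = 0\<close> it forces \<open>b = 0\<close>.\<close>

lemma nonneg_quadratic_discriminant:
  fixes a b c :: real
  assumes "\<And>t. 0 \<le> a - 2 * t * b + t\<^sup>2 * c" and "0 \<le> c"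
  shows "b\<^sup>2 \<le> a * c"
proof (cases "c = 0")
  case True
  have "b = 0"
  proof (rule ccontr)
    assume "b \<noteq> 0"
    \<comment> \<open>With \<open>c = 0\<close> this \<open>t\<close> gives the value
      \<open>a - (a + 1) = -1\<close>.\<close>
    then show False using assms(1)[of "(a + 1) / (2 * b)"] True by (simp add: field_simps)
  qed
  then show ?thesis using True by simp
next
  case False
  then have "c > 0" using assms by simp
  then show ?thesis using assms(1)[of "b / c"] by (simp add: field_simps power2_eq_square)
qed

lemma integral_Cauchy_Schwarz:
  assumes "square_integrable M f" "square_integrable M g"
  shows "(LINT x|M. f x * g x)\<^sup>2 \<le> sq_norm M f * sq_norm M g"
proof (rule nonneg_quadratic_discriminant)
  fix t
  have "0 \<le> sq_norm M (\<lambda>x. f x - t * g x)" by (rule sq_norm_nonneg)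
  also have "\<dots> = sq_norm M f - 2 * t * (LINT x|M. f x * g x) + t\<^sup>2 * sq_norm M g"
    using sq_norm_diff[OF assms(1) square_integrable_scale[OF assms(2), of t]] sq_norm_scale[of M t g]
    by (simp add: mult.left_commute)
  finally show "0 \<le> sq_norm M f - 2 * t * (LINT x|M. f x * g x) + t\<^sup>2 * sq_norm M g" .
qed (rule sq_norm_nonneg)

section \<open>One-dimensional marginals, variance bounds and representers\<close>

locale centred_gaussian =
  fixes \<gamma> :: "'a::{banach, second_countable_topology} measure"
  assumes gaussian: "gaussian_measure \<gamma>" and cent: "centred \<gamma>"

sublocale centred_gaussian \<subseteq> prob_space \<gamma>
  using gaussian by (simp add: gaussian_measure_def)

context centred_gaussian
begin

lemma sets_eq [simp, measurable_cong]: "sets \<gamma> = sets borel"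
  using gaussian by (simp add: gaussian_measure_def)

lemma space_eq [simp]: "space \<gamma> = UNIV"
  using sets_eq_imp_space_eq[OF sets_eq] by simp

lemma bounded_linear_measurable: "bounded_linear f \<Longrightarrow> (f :: 'a \<Rightarrow> 'b::real_normed_vector) \<in> borel_measurable borel"
  by (intro borel_measurable_continuous_onI linear_continuous_on)

lemma bounded_linear_measurable': "bounded_linear f \<Longrightarrow> (f :: 'a \<Rightarrow> 'b::real_normed_vector) \<in> borel_measurable \<gamma>"
  using bounded_linear_measurable by (simp cong: measurable_cong_sets)

lemma law_cases:
  assumes f: "bounded_linear (f :: 'a \<Rightarrow> real)"
  obtains (degenerate) "distr \<gamma> borel f = return borel 0" "sq_norm \<gamma> f = 0" "square_integrable \<gamma> f"
    | (normal) s where "s > 0" "distr \<gamma> borel f = density lborel (\<lambda>x. ennreal (normal_density 0 s x))"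
        "sq_norm \<gamma> f = s\<^sup>2" "square_integrable \<gamma> f"
proof -
  have m [measurable]: "f \<in> borel_measurable \<gamma>" using bounded_linear_measurable'[OF f] .
  have mean: "(LINT x|distr \<gamma> borel f. x) = 0"
    using cent f by (simp add: centred_def integral_distr)
  have sq: "sq_norm \<gamma> f = (LINT x|distr \<gamma> borel f. x\<^sup>2)" by (simp add: sq_norm_def integral_distr)
  have si: "square_integrable \<gamma> f \<longleftrightarrow> integrable (distr \<gamma> borel f) (\<lambda>x. x\<^sup>2)"
    by (simp add: square_integrable_def integrable_distr_eq)
  consider c where "distr \<gamma> borel f = return borel c"
    | c s where "s > 0" "distr \<gamma> borel f = density lborel (\<lambda>x. ennreal (normal_density c s x))"
    using gaussian f unfolding gaussian_measure_def gaussian_on_real_def by blast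
  then show thesis
  proof cases
    case 1
    then have "c = 0" using mean by (simp add: integral_return)
    moreover have "integrable (return borel (0::real)) (\<lambda>x. x\<^sup>2)"
      by (simp add: integrable_iff_bounded nn_integral_return)
    ultimately show thesis using 1 sq si by (intro degenerate) (auto simp: integral_return)
  next
    case 2
    have "(LINT x|distr \<gamma> borel f. x) = c"
      unfolding 2(2) using integral_normal_moment_nz_1[OF 2(1), of c] integrable_normal_moment_nz_1[OF 2(1), of c]
      by (subst integral_density) (auto simp: normal_density_nonneg)
    then have c: "c = 0" using mean by simp
    have "integrable (distr \<gamma> borel f) (\<lambda>x. x\<^sup>2)"
      unfolding 2(2) c using integrable_normal_moment[OF 2(1), of 0 2]
      by (subst integrable_density) (auto simp: normal_density_nonneg)
    moreover have "(LINT x|distr \<gamma> borel f. x\<^sup>2) = s\<^sup>2"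
      unfolding 2(2) c using integral_normal_moment_even[OF 2(1), of 0 1]
      by (subst integral_density) (auto simp: normal_density_nonneg)
    ultimately show thesis using 2 c sq si by (intro normal) auto
  qed
qed

lemma square_integrable_linear: "bounded_linear f \<Longrightarrow> square_integrable \<gamma> f"
  by (rule law_cases) auto

lemma char_functional:
  assumes f: "bounded_linear f"
  shows "(CLINT x|\<gamma>. iexp (f x)) = exp (- complex_of_real (sq_norm \<gamma> f) / 2)"
proof -
  have [measurable]: "f \<in> borel_measurable \<gamma>" using bounded_linear_measurable'[OF f] .
  have eq: "(CLINT x|\<gamma>. iexp (f x)) = (CLINT x|distr \<gamma> borel f. iexp x)"
    by (simp add: integral_distr)
  show ?thesis
  proof (cases rule: law_cases[OF f])
    case 1
    then show ?thesis unfolding eq by (simp add: integral_return)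
  next
    case (2 s)
    have "(CLINT x|distr \<gamma> borel f. iexp x) = (CLINT x|lborel. normal_density 0 s x *\<^sub>R iexp x)"
      unfolding 2(2) by (subst integral_density) (auto simp: normal_density_nonneg)
    also have "\<dots> = \<bar>s\<bar> *\<^sub>R (CLINT x|lborel. normal_density 0 s (0 + s * x) *\<^sub>R iexp (0 + s * x))"
      using 2(1) by (intro lborel_integral_real_affine) auto
    also have "\<dots> = (CLINT x|lborel. s *\<^sub>R (normal_density 0 s (0 + s * x) *\<^sub>R iexp (0 + s * x)))"
      using 2(1) by (simp only: integral_scaleR_right) simp
    also have "\<dots> = (CLINT x|lborel. normal_density 0 1 x *\<^sub>R iexp (s * x))"
      using 2(1)
      by (intro Bochner_Integration.integral_cong)
         (auto simp: normal_density_def power_mult_distrib real_sqrt_mult)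
    also have "\<dots> = char std_normal_distribution s"
      unfolding char_def by (subst integral_density) (auto simp: normal_density_nonneg)
    also have "\<dots> = exp (- complex_of_real (sq_norm \<gamma> f) / 2)"
      unfolding char_std_normal_distribution 2(3) by (simp flip: exp_of_real)
    finally show ?thesis unfolding eq .
  qed
qed

text \<open>A centred normal density with deviation \<open>s\<close> is at most
  \<open>1 / (2 * s)\<close>, because \<open>sqrt (2 * pi) \<ge> 2\<close>. An interval of length
  \<open>2 * R\<close> carrying mass at least one half therefore forces
  \<open>s \<le> 2 * R\<close>.\<close>

lemma sq_norm_le_of_bound:
  assumes f: "bounded_linear f" and K: "K \<in> sets borel" "1/2 \<le> measure \<gamma> K"
    and R: "\<And>x. x \<in> K \<Longrightarrow> \<bar>f x\<bar> \<le> R"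
  shows "sq_norm \<gamma> f \<le> (2 * R)\<^sup>2"
proof (cases rule: law_cases[OF f])
  case 1
  then show ?thesis by simp
next
  case (2 s)
  have [measurable]: "f \<in> borel_measurable \<gamma>" "f \<in> borel_measurable borel"
    using bounded_linear_measurable'[OF f] bounded_linear_measurable[OF f] .
  have "K \<noteq> {}" using K(2) by auto
  then have R0: "R \<ge> 0" using R by (metis abs_ge_zero all_not_in_conv order_trans)
  have "ennreal (1/2) \<le> emeasure \<gamma> K" using K(2) unfolding emeasure_eq_measure by (rule ennreal_leI)
  also have "\<dots> \<le> emeasure \<gamma> (f -` {-R..R} \<inter> space \<gamma>)"
    using R measurable_sets[OF bounded_linear_measurable'[OF f], of "{-R..R}"] by (intro emeasure_mono) (auto simp: abs_le_iff minus_le_iff)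
  also have "\<dots> = emeasure (distr \<gamma> borel f) {-R..R}" by (simp add: emeasure_distr)
  also have "\<dots> = (\<integral>\<^sup>+x. ennreal (normal_density 0 s x) * indicator {-R..R} x \<partial>lborel)"
    unfolding 2(2) by (subst emeasure_density) auto
  also have "\<dots> \<le> (\<integral>\<^sup>+x. ennreal (1 / (2 * s)) * indicator {-R..R} x \<partial>lborel)"
  proof (intro nn_integral_mono mult_right_mono ennreal_leI)
    fix x
    have "2 * s \<le> sqrt (2 * pi * s\<^sup>2)"
      using pi_ge_two 2(1) by (intro real_le_rsqrt) (simp add: power_mult_distrib)
    then have "1 / sqrt (2 * pi * s\<^sup>2) \<le> 1 / (2 * s)" using 2(1) by (intro divide_left_mono) auto
    moreover have "exp (- ((x - 0)\<^sup>2) / (2 * s\<^sup>2)) \<le> 1" by simp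
    ultimately have "1 / sqrt (2 * pi * s\<^sup>2) * exp (- ((x - 0)\<^sup>2) / (2 * s\<^sup>2)) \<le> 1 / (2 * s) * 1"
      using 2(1) by (intro mult_mono) auto
    then show "normal_density 0 s x \<le> 1 / (2 * s)" by (simp add: normal_density_def)
  qed simp
  also have "\<dots> = ennreal (1 / (2 * s)) * emeasure lborel {-R..R}"
    by (rule nn_integral_cmult_indicator) simp
  also have "emeasure lborel {-R..R} = ennreal (2 * R)" using R0 by simp
  also have "ennreal (1 / (2 * s)) * ennreal (2 * R) = ennreal (1 / (2 * s) * (2 * R))"
    using 2(1) R0 by (intro ennreal_mult[symmetric]) auto
  finally have "1/2 \<le> 1 / (2 * s) * (2 * R)" using R0 2(1) by (subst (asm) ennreal_le_iff) auto
  then have "s \<le> 2 * R" using 2(1) by (simp add: field_simps)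
  then show ?thesis unfolding 2(3) using 2(1) by (intro power_mono) auto
qed

lemma half_compact:
  obtains K :: "'a set" where "compact K" "1/2 \<le> measure \<gamma> K"
proof -
  obtain K where K: "compact K" "measure \<gamma> (- K) < 1/2"
    using compact_mass_near_one[of \<gamma> "1/2"] prob_space_axioms by auto
  have "K \<in> sets \<gamma>" using K(1) by (simp add: compact_imp_closed borel_closed)
  then have "measure \<gamma> (- K) = 1 - measure \<gamma> K" using prob_compl[of K] by (simp add: Compl_eq_Diff_UNIV)
  then show thesis using that K by auto
qed

text \<open>A compact set of mass at least one half is bounded, which compares variances with
  squared operator norms. The constant governs all later estimates: convergence of representers,
  decay of ball masses and the choice of \<open>\<eta>\<close>.\<close>

lemma sq_norm_bound:
  obtains S where "S > 0" "\<And>f c. bounded_linear f \<Longrightarrow> (\<And>x. \<bar>f x\<bar> \<le> c * norm x) \<Longrightarrow> sq_norm \<gamma> f \<le> S * c\<^sup>2"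
proof -
  obtain K where K: "compact K" "1/2 \<le> measure \<gamma> K" by (rule half_compact)
  obtain R where R: "R > 0" "\<And>x. x \<in> K \<Longrightarrow> norm x \<le> R"
    using compact_imp_bounded[OF K(1)] bounded_pos by metis
  show thesis
  proof (rule that)
    show "(2 * R)\<^sup>2 > 0" using R(1) by simp
    fix f c assume f: "bounded_linear f" "\<And>x. \<bar>f x\<bar> \<le> c * norm (x::'a)"
    show "sq_norm \<gamma> f \<le> (2 * R)\<^sup>2 * c\<^sup>2"
    proof (cases "c \<ge> 0")
      case True
      have "sq_norm \<gamma> f \<le> (2 * (c * R))\<^sup>2"
      proof (rule sq_norm_le_of_bound[OF f(1) _ K(2)])
        show "K \<in> sets borel" using K(1) by (simp add: compact_imp_closed borel_closed)
        show "\<bar>f x\<bar> \<le> c * R" if "x \<in> K" for x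
          using f(2)[of x] mult_left_mono[OF R(2)[OF that] True] by linarith
      qed
      then show ?thesis by (simp add: power_mult_distrib mult_ac)
    next
      case False
      have "f x = 0" for x
        using f(2)[of x] mult_nonpos_nonneg[of c "norm x"] False by auto
      then show ?thesis by (simp add: sq_norm_def)
    qed
  qed
qed

text \<open>The natural candidate is the integral of \<open>F x *\<^sub>R x\<close>; truncation to
  \<open>norm x \<le> n\<close> secures its convergence. The truncated integrals \<open>h n\<close>
  are Cauchy: a functional norming \<open>h n - h m\<close> has variance at most \<open>S\<close>,
  so by Cauchy--Schwarz it sees only the L2 truncation errors of \<open>F\<close>.\<close>

lemma R_graph_exists:
  assumes F: "square_integrable \<gamma> F"
  obtains h where "R_graph \<gamma> F h"
proof -
  have [measurable]: "F \<in> borel_measurable \<gamma>" using F by (simp add: square_integrable_def)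
  obtain S where S: "S > 0" "\<And>f c. bounded_linear f \<Longrightarrow> (\<And>x. \<bar>f x\<bar> \<le> c * norm x) \<Longrightarrow> sq_norm \<gamma> f \<le> S * c\<^sup>2"
    by (rule sq_norm_bound) blast
  define B where "B n = {x::'a. norm x \<le> real n}" for n
  have [measurable]: "B n \<in> sets borel" for n unfolding B_def by measurable
  define G where "G n x = indicator (B n) x * F x" for n x
  have Gm [measurable]: "G n \<in> borel_measurable \<gamma>" for n
    unfolding G_def by (measurable) 
  have G2: "(G n x)\<^sup>2 \<le> (F x)\<^sup>2" for n x by (auto simp: G_def indicator_def)
  have Gsq: "square_integrable \<gamma> (G n)" for n
    using F G2 unfolding square_integrable_def
    by (auto intro: Bochner_Integration.integrable_bound[where f="\<lambda>x. (F x)\<^sup>2"])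
  have intF: "integrable \<gamma> (\<lambda>x. \<bar>F x\<bar>)"
    using square_integrable_mult[OF F, of "\<lambda>_. 1"] by (simp add: square_integrable_def)
  have intGx: "integrable \<gamma> (\<lambda>x. G n x *\<^sub>R x)" for n
  proof (rule Bochner_Integration.integrable_bound)
    show "integrable \<gamma> (\<lambda>x. real n * \<bar>F x\<bar>)" using intF by simp
    show "AE x in \<gamma>. norm (G n x *\<^sub>R x) \<le> norm (real n * \<bar>F x\<bar>)"
      by (intro AE_I2) (auto simp: G_def B_def indicator_def mult.commute intro: mult_right_mono)
  qed measurable
  define h where "h n = (LINT x|\<gamma>. G n x *\<^sub>R x)" for n
  have gh: "g (h n) = (LINT x|\<gamma>. G n x * g x)" if g: "bounded_linear g" for g :: "'a \<Rightarrow> real" and n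
    unfolding h_def using integral_bounded_linear[OF g intGx[of n]]
    by (simp add: linear_cmul[OF bounded_linear.linear[OF g]])
  have lim2: "(\<lambda>n. sq_norm \<gamma> (\<lambda>x. G n x - F x)) \<longlonglongrightarrow> 0"
  proof -
    have "(\<lambda>n. LINT x|\<gamma>. (G n x - F x)\<^sup>2) \<longlonglongrightarrow> (LINT x|\<gamma>. 0)"
    proof (rule integral_dominated_convergence[where w="\<lambda>x. (F x)\<^sup>2"])
      show "integrable \<gamma> (\<lambda>x. (F x)\<^sup>2)" using F by (simp add: square_integrable_def)
      show "AE x in \<gamma>. (\<lambda>n. (G n x - F x)\<^sup>2) \<longlonglongrightarrow> 0"
      proof (rule AE_I2)
        fix x :: 'a
        obtain k :: nat where "norm x \<le> real k" using real_arch_simple by blast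
        then have "(G n x - F x)\<^sup>2 = 0" if "n \<ge> k" for n using that by (auto simp: G_def B_def)
        then show "(\<lambda>n. (G n x - F x)\<^sup>2) \<longlonglongrightarrow> 0"
          by (intro tendsto_eventually) (auto simp: eventually_sequentially)
      qed
      show "AE x in \<gamma>. norm ((G n x - F x)\<^sup>2) \<le> (F x)\<^sup>2" for n
        by (intro AE_I2) (auto simp: G_def indicator_def)
    qed measurable
    then show ?thesis by (simp add: sq_norm_def)
  qed
  have diff: "(g (h n) - (LINT x|\<gamma>. F x * g x))\<^sup>2 \<le> sq_norm \<gamma> (\<lambda>x. G n x - F x) * sq_norm \<gamma> g"
    if g: "bounded_linear g" for g n
  proof -
    note gs = square_integrable_linear[OF g]
    have "g (h n) - (LINT x|\<gamma>. F x * g x) = (LINT x|\<gamma>. (G n x - F x) * g x)"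
      using gh[OF g, of n] square_integrable_mult[OF Gsq gs, of n] square_integrable_mult[OF F gs]
      by (simp add: left_diff_distrib)
    then show ?thesis using integral_Cauchy_Schwarz[OF square_integrable_diff[OF Gsq F] gs] by simp
  qed
  have nd: "norm (h n - h m) \<le> sqrt S * (sqrt (sq_norm \<gamma> (\<lambda>x. G n x - F x)) + sqrt (sq_norm \<gamma> (\<lambda>x. G m x - F x)))" for n m
  proof -
    obtain g where g: "bounded_linear g" "\<And>x. \<bar>g x\<bar> \<le> norm x" "g (h n - h m) = norm (h n - h m)"
      using Hahn_Banach_norm[of "h n - h m"] by metis
    have gS: "sq_norm \<gamma> g \<le> S" using S(2)[OF g(1), of 1] g(2) by simp
    have b: "\<bar>g (h n) - (LINT x|\<gamma>. F x * g x)\<bar> \<le> sqrt S * sqrt (sq_norm \<gamma> (\<lambda>x. G n x - F x))" for n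
    proof -
      have "sq_norm \<gamma> (\<lambda>x. G n x - F x) * sq_norm \<gamma> g \<le> S * sq_norm \<gamma> (\<lambda>x. G n x - F x)"
        using mult_right_mono[OF gS sq_norm_nonneg] by (subst mult.commute)
      then have "(g (h n) - (LINT x|\<gamma>. F x * g x))\<^sup>2 \<le> S * sq_norm \<gamma> (\<lambda>x. G n x - F x)"
        using diff[OF g(1), of n] by linarith
      with real_le_rsqrt[of "\<bar>g (h n) - (LINT x|\<gamma>. F x * g x)\<bar>"] show ?thesis
        by (simp flip: real_sqrt_mult)
    qed
    have "norm (h n - h m) = (g (h n) - (LINT x|\<gamma>. F x * g x)) - (g (h m) - (LINT x|\<gamma>. F x * g x))"
      using g by (simp add: linear_diff bounded_linear.linear)
    then show ?thesis using b[of n] b[of m] by (simp add: distrib_left)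
  qed
  have "Cauchy h"
  proof (rule CauchyI)
    fix e :: real assume e: "e > 0"
    have "(\<lambda>n. sqrt S * sqrt (sq_norm \<gamma> (\<lambda>x. G n x - F x))) \<longlonglongrightarrow> sqrt S * sqrt 0"
      by (intro tendsto_intros lim2)
    then have "\<forall>\<^sub>F n in sequentially. sqrt S * sqrt (sq_norm \<gamma> (\<lambda>x. G n x - F x)) < e / 2"
      using e by (intro order_tendstoD) auto
    then obtain N where N: "\<And>n. n \<ge> N \<Longrightarrow> sqrt S * sqrt (sq_norm \<gamma> (\<lambda>x. G n x - F x)) < e / 2"
      by (auto simp: eventually_sequentially)
    have "norm (h m - h n) < e" if "m \<ge> N" "n \<ge> N" for m n
      using nd[of m n] N[OF that(1)] N[OF that(2)] by (simp add: distrib_left)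
    then show "\<exists>M. \<forall>m\<ge>M. \<forall>n\<ge>M. norm (h m - h n) < e" by blast
  qed
  then obtain h0 where h0: "h \<longlonglongrightarrow> h0" using Cauchy_convergent convergent_def by blast
  have "R_graph \<gamma> F h0"
    unfolding R_graph_def
  proof (intro allI impI)
    fix g :: "'a \<Rightarrow> real" assume g: "bounded_linear g"
    have "(\<lambda>n. g (h n)) \<longlonglongrightarrow> g h0" using h0 by (rule bounded_linear.tendsto[OF g])
    then have "(\<lambda>n. (g (h n) - (LINT x|\<gamma>. F x * g x))\<^sup>2) \<longlonglongrightarrow> (g h0 - (LINT x|\<gamma>. F x * g x))\<^sup>2"
      by (intro tendsto_intros)
    moreover have "(\<lambda>n. sq_norm \<gamma> (\<lambda>x. G n x - F x) * sq_norm \<gamma> g) \<longlonglongrightarrow> 0 * sq_norm \<gamma> g"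
      by (intro tendsto_intros lim2)
    ultimately have "(g h0 - (LINT x|\<gamma>. F x * g x))\<^sup>2 \<le> 0 * sq_norm \<gamma> g"
      using diff[OF g] by (intro LIMSEQ_le) auto
    then show "g h0 = (LINT x|\<gamma>. F x * g x)" by simp
  qed
  then show thesis by (rule that)
qed

end

section \<open>The Cameron--Martin theorem\<close>

text \<open>Completing the square: shifting a centred normal density by its variance multiplies it
  by \<open>exp (t - s\<^sup>2 / 2)\<close>. This is Cameron--Martin on the line for the identity
  functional, whose representer is \<open>s\<^sup>2\<close>.\<close>

lemma nn_integral_normal_shift:
  fixes K :: "real \<Rightarrow> ennreal"
  assumes [measurable]: "K \<in> borel_measurable borel" and s: "s > 0"
  shows "(\<integral>\<^sup>+t. K t * ennreal (exp (t - s\<^sup>2 / 2)) \<partial>density lborel (\<lambda>x. ennreal (normal_density 0 s x)))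
       = (\<integral>\<^sup>+t. K (t + s\<^sup>2) \<partial>density lborel (\<lambda>x. ennreal (normal_density 0 s x)))"
proof -
  have e: "normal_density 0 s t * exp (t - s\<^sup>2 / 2) = normal_density 0 s (t - s\<^sup>2)" for t
  proof -
    have "- (t - 0)\<^sup>2 / (2 * s\<^sup>2) + (t - s\<^sup>2 / 2) = - (t - s\<^sup>2 - 0)\<^sup>2 / (2 * s\<^sup>2)"
      using s by (simp add: field_simps power2_eq_square)
    then show ?thesis by (simp add: normal_density_def flip: exp_add)
  qed
  have "(\<integral>\<^sup>+t. K t * ennreal (exp (t - s\<^sup>2 / 2)) \<partial>density lborel (\<lambda>x. ennreal (normal_density 0 s x)))
      = (\<integral>\<^sup>+t. ennreal (normal_density 0 s t) * (K t * ennreal (exp (t - s\<^sup>2 / 2))) \<partial>lborel)"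
    by (subst nn_integral_density) auto
  also have "\<dots> = (\<integral>\<^sup>+t. K t * ennreal (normal_density 0 s (t - s\<^sup>2)) \<partial>lborel)"
    by (intro nn_integral_cong) (simp add: normal_density_nonneg mult.left_commute flip: e ennreal_mult)
  also have "\<dots> = ennreal \<bar>1\<bar> * (\<integral>\<^sup>+t. K (s\<^sup>2 + 1 * t) * ennreal (normal_density 0 s (s\<^sup>2 + 1 * t - s\<^sup>2)) \<partial>lborel)"
    by (rule nn_integral_real_affine) auto
  also have "\<dots> = (\<integral>\<^sup>+t. ennreal (normal_density 0 s t) * K (t + s\<^sup>2) \<partial>lborel)"
    by (simp add: add.commute mult.commute)
  also have "\<dots> = (\<integral>\<^sup>+t. K (t + s\<^sup>2) \<partial>density lborel (\<lambda>x. ennreal (normal_density 0 s x)))"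
    by (subst nn_integral_density) auto
  finally show ?thesis .
qed

context centred_gaussian
begin

lemma linear_image_gaussian:
  fixes L :: "'a \<Rightarrow> 'a"
  assumes L: "bounded_linear L"
  shows "centred_gaussian (distr \<gamma> borel L)"
proof -
  have [measurable]: "L \<in> borel_measurable \<gamma>" using bounded_linear_measurable'[OF L] .
  have 1: "gaussian_on_real (distr (distr \<gamma> borel L) borel f)" if f: "bounded_linear f" for f :: "'a \<Rightarrow> real"
  proof -
    have "distr (distr \<gamma> borel L) borel f = distr \<gamma> borel (\<lambda>x. f (L x))"
      using bounded_linear_measurable[OF f] by (subst distr_distr) (auto simp: comp_def)
    then show ?thesis using gaussian bounded_linear_compose[OF f L] by (simp add: gaussian_measure_def)
  qed
  have 2: "(LINT x|distr \<gamma> borel L. f x) = 0" if f: "bounded_linear f" for f :: "'a \<Rightarrow> real"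
    using cent bounded_linear_compose[OF f L] bounded_linear_measurable[OF f]
    by (subst integral_distr) (auto simp: centred_def)
  show ?thesis
    using 1 2 by unfold_locales (auto simp: gaussian_measure_def centred_def intro: prob_space_distr)
qed

lemma bounded_linear_projection:
  assumes f: "bounded_linear f" shows "bounded_linear (\<lambda>x. x - f x *\<^sub>R (k::'a))"
  by (intro bounded_linear_sub bounded_linear_ident bounded_linear_compose[OF bounded_linear_scaleR_left f])

text \<open>The coordinate \<open>f\<close> and the residual are uncorrelated, hence independent.\<close>

lemma decomposition:
  assumes f: "bounded_linear f" and k: "R_graph \<gamma> f (sq_norm \<gamma> f *\<^sub>R k)"
  shows "distr \<gamma> borel (\<lambda>x. (f x, x - f x *\<^sub>R k)) = distr \<gamma> borel f \<Otimes>\<^sub>M distr \<gamma> borel (\<lambda>x. x - f x *\<^sub>R k)"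
    (is "?J = ?N \<Otimes>\<^sub>M ?P")
proof (rule char_functional_unique)
  define L where "L x = x - f x *\<^sub>R k" for x
  have L: "bounded_linear L" unfolding L_def by (rule bounded_linear_projection[OF f])
  have [measurable]: "f \<in> borel_measurable borel" "f \<in> borel_measurable \<gamma>" "L \<in> borel_measurable \<gamma>"
    using bounded_linear_measurable bounded_linear_measurable' f L by auto
  have N: "prob_space ?N" by (intro prob_space_distr) simp
  have P: "prob_space ?P" unfolding L_def[symmetric] by (intro prob_space_distr) simp
  interpret NP: pair_prob_space ?N ?P
    using N P by (simp add: pair_prob_space_def pair_sigma_finite_def prob_space_imp_sigma_finite)
  have mJ [measurable]: "(\<lambda>x. (f x, L x)) \<in> borel_measurable \<gamma>"
    by (intro borel_measurable_Pair) auto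
  show "prob_space ?J" unfolding L_def[symmetric] by (intro prob_space_distr) simp
  show "prob_space (?N \<Otimes>\<^sub>M ?P)" by (rule NP.P.prob_space_axioms)
  show "sets ?J = sets borel" by simp
  show sNP: "sets (?N \<Otimes>\<^sub>M ?P) = sets borel"
  proof -
    have "sets (?N \<Otimes>\<^sub>M ?P) = sets (borel \<Otimes>\<^sub>M borel)" by (rule sets_pair_measure_cong) simp_all
    then show ?thesis by (simp only: borel_prod)
  qed
  fix F :: "real \<times> 'a \<Rightarrow> real" assume F: "bounded_linear F"
  define a where "a = F (1, 0)"
  define g where "g w = F (0, w)" for w
  have g: "bounded_linear g" unfolding g_def
    by (rule bounded_linear_compose[OF F bounded_linear_Pair[OF bounded_linear_zero bounded_linear_ident]])
  have split: "F (t, w) = a * t + g w" for t w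
  proof -
    have "(t, w) = t *\<^sub>R (1, 0) + (0, w)" by simp
    then have "F (t, w) = t *\<^sub>R F (1, 0) + F (0, w)"
      using linear_add linear_cmul bounded_linear.linear[OF F] by metis
    then show ?thesis by (simp add: a_def g_def)
  qed
  have gL: "bounded_linear (\<lambda>x. g (L x))" by (rule bounded_linear_compose[OF g L])
  have af: "bounded_linear (\<lambda>x. a * f x)" by (rule bounded_linear_const_mult[OF f])
  have [measurable]: "g \<in> borel_measurable borel" using bounded_linear_measurable[OF g] .
  \<comment> \<open>The normalisation of \<open>k\<close> makes this product the covariance of
    \<open>f\<close> and \<open>g\<close>, which is exactly what subtracting
    \<open>f x *\<^sub>R k\<close> removes in \<open>orth\<close>.\<close>
  have gk: "sq_norm \<gamma> f * g k = (LINT x|\<gamma>. f x * g x)"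
    using k g linear_cmul[OF bounded_linear.linear[OF g], of "sq_norm \<gamma> f" k] by (auto simp: R_graph_def)
  have "(LINT x|\<gamma>. f x * g (L x)) = (LINT x|\<gamma>. f x * g x - g k * (f x)\<^sup>2)"
    by (simp add: L_def linear_diff[OF bounded_linear.linear[OF g]] linear_cmul[OF bounded_linear.linear[OF g]]
        algebra_simps power2_eq_square)
  also have "\<dots> = (LINT x|\<gamma>. f x * g x) - g k * sq_norm \<gamma> f"
    using square_integrable_mult[OF square_integrable_linear[OF f] square_integrable_linear[OF g]]
      square_integrable_linear[OF f] by (simp add: sq_norm_def square_integrable_def)
  finally have orth: "(LINT x|\<gamma>. f x * g (L x)) = 0" using gk by (simp add: mult.commute)
  have "sq_norm \<gamma> (\<lambda>x. a * f x + g (L x)) = sq_norm \<gamma> (\<lambda>x. a * f x) + sq_norm \<gamma> (\<lambda>x. g (L x))"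
    using sq_norm_add[OF square_integrable_linear[OF af] square_integrable_linear[OF gL]] orth
    by (simp add: mult.assoc)
  \<comment> \<open>Variances add, and the characteristic functional depends on the variance alone,
    so it factorises; this turns vanishing covariance into independence.\<close>
  then have ch: "(CLINT x|\<gamma>. iexp (a * f x + g (L x))) = (CLINT x|\<gamma>. iexp (a * f x)) * (CLINT x|\<gamma>. iexp (g (L x)))"
    using char_functional[OF bounded_linear_add[OF af gL]] char_functional[OF af] char_functional[OF gL]
    by (simp add: diff_divide_distrib flip: exp_add)
  have "(CLINT z|?J. iexp (F z)) = (CLINT x|\<gamma>. iexp (a * f x + g (L x)))"
  proof -
    have [measurable]: "F \<in> borel_measurable borel"
      by (intro borel_measurable_continuous_onI linear_continuous_on F)
    show ?thesis unfolding L_def[symmetric] by (subst integral_distr) (auto simp: split)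
  qed
  moreover have "(CLINT z|?N \<Otimes>\<^sub>M ?P. iexp (F z)) = (CLINT x|\<gamma>. iexp (a * f x)) * (CLINT x|\<gamma>. iexp (g (L x)))"
  proof -
    have Fm [measurable]: "F \<in> borel_measurable (?N \<Otimes>\<^sub>M ?P)"
      using sNP borel_measurable_continuous_onI[OF linear_continuous_on[OF F]] by (simp cong: measurable_cong_sets)
    have "integrable (?N \<Otimes>\<^sub>M ?P) (\<lambda>z. iexp (F z))"
      by (intro NP.P.integrable_const_bound[where B=1]) auto
    from NP.integral_fst'[OF this]
    have "(CLINT z|?N \<Otimes>\<^sub>M ?P. iexp (F z)) = (CLINT t|?N. CLINT w|?P. iexp (F (t, w)))" by simp
    also have "\<dots> = (CLINT t|?N. CLINT w|?P. iexp (a * t) * iexp (g w))"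
      by (simp add: split distrib_left flip: exp_add)
    also have "\<dots> = (CLINT t|?N. iexp (a * t)) * (CLINT w|?P. iexp (g w))" by simp
    also have "(CLINT t|?N. iexp (a * t)) = (CLINT x|\<gamma>. iexp (a * f x))" by (subst integral_distr) auto
    also have "(CLINT w|?P. iexp (g w)) = (CLINT x|\<gamma>. iexp (g (L x)))"
      unfolding L_def[symmetric] by (subst integral_distr) auto
    finally show ?thesis .
  qed
  ultimately show "(CLINT z|?J. iexp (F z)) = (CLINT z|?N \<Otimes>\<^sub>M ?P. iexp (F z))" using ch by simp
qed

text \<open>Positive variance gives the line factor a density. Both orders of integration are kept:
  Cameron--Martin shifts the line variable inside, whereas Prekopa--Leindler works on the line
  outside.\<close>

lemma decomposition_nn_integral:
  fixes H :: "real \<times> 'a \<Rightarrow> ennreal"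
  assumes f: "bounded_linear f" and pos: "sq_norm \<gamma> f > 0" and k: "R_graph \<gamma> f (sq_norm \<gamma> f *\<^sub>R k)"
    and H: "H \<in> borel_measurable borel"
  defines "N \<equiv> density lborel (\<lambda>x. ennreal (normal_density 0 (sqrt (sq_norm \<gamma> f)) x))"
    and "P \<equiv> distr \<gamma> borel (\<lambda>x. x - f x *\<^sub>R k)"
  shows "(\<integral>\<^sup>+x. H (f x, x - f x *\<^sub>R k) \<partial>\<gamma>) = (\<integral>\<^sup>+t. \<integral>\<^sup>+w. H (t, w) \<partial>P \<partial>N)"
    and "(\<integral>\<^sup>+x. H (f x, x - f x *\<^sub>R k) \<partial>\<gamma>) = (\<integral>\<^sup>+w. \<integral>\<^sup>+t. H (t, w) \<partial>N \<partial>P)"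
proof -
  have L: "bounded_linear (\<lambda>x. x - f x *\<^sub>R k)" by (rule bounded_linear_projection[OF f])
  have m: "f \<in> borel_measurable \<gamma>" "(\<lambda>x. x - f x *\<^sub>R k) \<in> borel_measurable \<gamma>"
    using bounded_linear_measurable'[OF f] bounded_linear_measurable'[OF L] .
  have N: "distr \<gamma> borel f = N"
    by (rule law_cases[OF f]) (use pos in \<open>auto simp: N_def real_sqrt_abs\<close>)
  have "prob_space N" unfolding N[symmetric] using m by (intro prob_space_distr)
  moreover have "prob_space P" unfolding P_def using m by (intro prob_space_distr)
  ultimately interpret NP: pair_sigma_finite N P
    by (simp add: pair_sigma_finite_def prob_space_imp_sigma_finite)
  have mJ: "(\<lambda>x. (f x, x - f x *\<^sub>R k)) \<in> borel_measurable \<gamma>"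
    using m by (rule borel_measurable_Pair)
  have "sets (N \<Otimes>\<^sub>M P) = sets (borel \<Otimes>\<^sub>M borel)"
    by (rule sets_pair_measure_cong) (simp_all add: N_def P_def)
  then have "sets (N \<Otimes>\<^sub>M P) = sets borel" by (simp only: borel_prod)
  then have H': "H \<in> borel_measurable (N \<Otimes>\<^sub>M P)" using H by (simp cong: measurable_cong_sets)
  have "integral\<^sup>N (distr \<gamma> borel (\<lambda>x. (f x, x - f x *\<^sub>R k))) H = (\<integral>\<^sup>+x. H (f x, x - f x *\<^sub>R k) \<partial>\<gamma>)"
    by (rule nn_integral_distr[OF mJ]) (use H in simp)
  then have eq: "(\<integral>\<^sup>+x. H (f x, x - f x *\<^sub>R k) \<partial>\<gamma>) = integral\<^sup>N (N \<Otimes>\<^sub>M P) H"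
    unfolding decomposition[OF f k] N P_def by simp
  show "(\<integral>\<^sup>+x. H (f x, x - f x *\<^sub>R k) \<partial>\<gamma>) = (\<integral>\<^sup>+t. \<integral>\<^sup>+w. H (t, w) \<partial>P \<partial>N)"
    unfolding eq using NP.M2.nn_integral_fst[OF H'] by simp
  show "(\<integral>\<^sup>+x. H (f x, x - f x *\<^sub>R k) \<partial>\<gamma>) = (\<integral>\<^sup>+w. \<integral>\<^sup>+t. H (t, w) \<partial>N \<partial>P)"
    unfolding eq using NP.nn_integral_snd[OF H'] by simp
qed

lemma sq_norm_zero_AE:
  assumes f: "bounded_linear f" and z: "sq_norm \<gamma> f = 0"
  shows "AE x in \<gamma>. f x = 0"
proof -
  have "AE x in \<gamma>. (f x)\<^sup>2 = 0"
    using square_integrable_linear[OF f] z integral_nonneg_eq_0_iff_AE[of \<gamma> "\<lambda>x. (f x)\<^sup>2"]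
    by (simp add: sq_norm_def square_integrable_def)
  then show ?thesis by simp
qed

lemma R_graph_unique:
  assumes "R_graph \<gamma> f h" "R_graph \<gamma> f h'" shows "h = h'"
proof -
  obtain g where g: "bounded_linear g" "g (h - h') = norm (h - h')" using Hahn_Banach_norm[of "h - h'"] by metis
  have "g h = (LINT x|\<gamma>. f x * g x)" "g h' = (LINT x|\<gamma>. f x * g x)"
    using assms g(1) unfolding R_graph_def by blast+
  then show ?thesis using g by (simp add: linear_diff bounded_linear.linear)
qed

text \<open>The representer \<open>h\<close> is a multiple of the direction \<open>k\<close> of the
  line factor, so translation by \<open>h\<close> adds the variance to the coordinate
  \<open>f x\<close> and leaves the residual alone; the one-dimensional shift acts on each line. If
  the variance vanishes, \<open>f\<close> is null and \<open>h\<close> is 0.\<close>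

theorem Cameron_Martin:
  fixes G :: "'a \<Rightarrow> ennreal"
  assumes f: "bounded_linear f" and h: "R_graph \<gamma> f h" and G [measurable]: "G \<in> borel_measurable borel"
  shows "(\<integral>\<^sup>+x. G (x + h) \<partial>\<gamma>) = (\<integral>\<^sup>+x. G x * ennreal (exp (f x - sq_norm \<gamma> f / 2)) \<partial>\<gamma>)"
proof (cases "sq_norm \<gamma> f = 0")
  case True
  have ae: "AE x in \<gamma>. f x = 0" by (rule sq_norm_zero_AE[OF f True])
  have "R_graph \<gamma> f 0"
    unfolding R_graph_def
  proof (intro allI impI)
    fix g :: "'a \<Rightarrow> real" assume g: "bounded_linear g"
    have "(LINT x|\<gamma>. f x * g x) = (LINT x|\<gamma>. 0)"
      using ae bounded_linear_measurable'[OF f] bounded_linear_measurable'[OF g] by (intro integral_cong_AE) auto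
    then show "g 0 = (LINT x|\<gamma>. f x * g x)" using linear_0[OF bounded_linear.linear[OF g]] by simp
  qed
  then have "h = 0" using h R_graph_unique by blast
  then show ?thesis using ae True by (intro nn_integral_cong_AE) auto
next
  case False
  define c where "c = sq_norm \<gamma> f"
  define k where "k = (1 / c) *\<^sub>R h"
  have c: "c > 0" using False sq_norm_nonneg[of \<gamma> f] by (simp add: c_def)
  have hk: "h = c *\<^sub>R k" using c by (simp add: k_def)
  have k: "R_graph \<gamma> f (sq_norm \<gamma> f *\<^sub>R k)" using h hk by (simp add: c_def)
  define N where "N = density lborel (\<lambda>x. ennreal (normal_density 0 (sqrt c) x))"
  define P where "P = distr \<gamma> borel (\<lambda>x. x - f x *\<^sub>R k)"
  note dec = decomposition_nn_integral(2)[OF f _ k, folded c_def, folded N_def P_def, OF c]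
  have [measurable]: "f \<in> borel_measurable borel" using bounded_linear_measurable[OF f] .
  have "(\<lambda>z :: real \<times> 'a. G ((fst z + c) *\<^sub>R k + snd z)) \<in> borel_measurable borel"
    by (rule measurable_compose[OF borel_measurable_continuous_onI G]) (intro continuous_intros)
  from dec[OF this] have "(\<integral>\<^sup>+x. G (x + h) \<partial>\<gamma>) = (\<integral>\<^sup>+w. \<integral>\<^sup>+t. G ((t + c) *\<^sub>R k + w) \<partial>N \<partial>P)"
    by (simp add: hk algebra_simps)
  also have "\<dots> = (\<integral>\<^sup>+w. \<integral>\<^sup>+t. G (t *\<^sub>R k + w) * ennreal (exp (t - c / 2)) \<partial>N \<partial>P)"
  proof (rule nn_integral_cong)
    fix w
    have "(\<lambda>t::real. G (t *\<^sub>R k + w)) \<in> borel_measurable borel"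
      by (rule measurable_compose[OF borel_measurable_continuous_onI G]) (intro continuous_intros)
    from nn_integral_normal_shift[OF this, of "sqrt c"]
    show "(\<integral>\<^sup>+t. G ((t + c) *\<^sub>R k + w) \<partial>N) = (\<integral>\<^sup>+t. G (t *\<^sub>R k + w) * ennreal (exp (t - c / 2)) \<partial>N)"
      using c by (simp add: N_def)
  qed
  also have "\<dots> = (\<integral>\<^sup>+x. G x * ennreal (exp (f x - c / 2)) \<partial>\<gamma>)"
  proof -
    have "(\<lambda>z :: real \<times> 'a. G (fst z *\<^sub>R k + snd z)) \<in> borel_measurable borel"
      by (rule measurable_compose[OF borel_measurable_continuous_onI G]) (intro continuous_intros)
    moreover have "(\<lambda>z :: real \<times> 'a. ennreal (exp (fst z - c / 2))) \<in> borel_measurable borel"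
      by (intro measurable_compose[OF _ measurable_ennreal] borel_measurable_continuous_onI continuous_intros)
    ultimately have "(\<lambda>z :: real \<times> 'a. G (fst z *\<^sub>R k + snd z) * ennreal (exp (fst z - c / 2))) \<in> borel_measurable borel"
      by (rule borel_measurable_times_ennreal)
    from dec[OF this] show ?thesis by simp
  qed
  finally show ?thesis by (simp add: c_def)
qed

text \<open>The characteristic functional sees \<open>f\<close> only through its variance, which is
  the same for \<open>- f\<close>.\<close>

lemma distr_uminus: "distr \<gamma> borel uminus = \<gamma>"
proof (rule char_functional_unique)
  have m [measurable]: "(uminus :: 'a \<Rightarrow> 'a) \<in> borel_measurable \<gamma>"
    by (rule bounded_linear_measurable'[OF bounded_linear_minus[OF bounded_linear_ident]])
  show "prob_space (distr \<gamma> borel uminus)" by (rule prob_space_distr) simp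
  fix f :: "'a \<Rightarrow> real" assume f: "bounded_linear f"
  have [measurable]: "f \<in> borel_measurable borel" using bounded_linear_measurable[OF f] .
  have "(CLINT x|distr \<gamma> borel uminus. iexp (f x)) = (CLINT x|\<gamma>. iexp (- f x))"
    by (subst integral_distr) (auto simp: linear_neg[OF bounded_linear.linear[OF f]])
  also have "\<dots> = (CLINT x|\<gamma>. iexp (f x))"
    using char_functional[OF f] char_functional[OF bounded_linear_minus[OF f]] by (simp add: sq_norm_def)
  finally show "(CLINT x|distr \<gamma> borel uminus. iexp (f x)) = (CLINT x|\<gamma>. iexp (f x))" .
qed (auto intro: prob_space_axioms)

end

section \<open>The Prekopa--Leindler and Anderson inequalities\<close>

text \<open>A set need not contain its supremum and may be unbounded above. Cutting at points
  \<open>z n\<close> that lie below elements of \<open>A\<close> and increase to the supremum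
  exhausts \<open>A\<close> up to at most one point, so bounds for segments ending in
  \<open>A\<close> pass to \<open>A\<close>.\<close>

lemma emeasure_le_of_initial_segments:
  fixes A :: "real set"
  assumes A [measurable]: "A \<in> sets borel" and ne: "A \<noteq> {}"
    and le: "\<And>a. a \<in> A \<Longrightarrow> emeasure lborel (A \<inter> {..a}) + c \<le> L"
  shows "emeasure lborel A + c \<le> L"
proof -
  have le': "emeasure lborel (A \<inter> {..z}) + c \<le> L" if "a \<in> A" "z \<le> a" for a z
  proof -
    have "emeasure lborel (A \<inter> {..z}) \<le> emeasure lborel (A \<inter> {..a})"
      using that(2) by (intro emeasure_mono) auto
    then show ?thesis using le[OF that(1)] by (meson add_right_mono order_trans)
  qed
  obtain z where z: "incseq z" "\<And>n. \<exists>a\<in>A. z n \<le> a"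
    "emeasure lborel (\<Union>n. A \<inter> {..z n::real}) = emeasure lborel A"
  proof (cases "bdd_above A")
    case False
    have "\<exists>a\<in>A. real n \<le> a" for n using False by (meson bdd_above.I linear)
    moreover have "(\<Union>n. A \<inter> {..real n}) = A" using real_arch_simple by auto
    ultimately show ?thesis by (intro that[of real]) (auto simp: incseq_def)
  next
    case True
    define s where "s = Sup A"
    define z where "z n = s - inverse (real (Suc n))" for n
    have "\<exists>a\<in>A. z n \<le> a" for n
    proof -
      have "z n < Sup A" by (simp add: z_def s_def)
      then show ?thesis using less_cSup_iff[OF ne True] by (auto intro: less_imp_le)
    qed
    moreover have "incseq z"
      unfolding z_def incseq_def by (auto simp: field_simps)
    moreover have "emeasure lborel (\<Union>n. A \<inter> {..z n}) = emeasure lborel A"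
    proof (rule emeasure_eq_AE)
      have "AE x in lborel. x \<noteq> s" using AE_lborel_singleton[of s] .
      then show "AE x in lborel. x \<in> (\<Union>n. A \<inter> {..z n}) \<longleftrightarrow> x \<in> A"
      proof eventually_elim
        case (elim x)
        show ?case
        proof
          assume x: "x \<in> A"
          then have "x < s" using elim True cSup_upper[of x A] by (simp add: s_def)
          then obtain n where "inverse (real (Suc n)) < s - x"
            using reals_Archimedean[of "s - x"] by auto
          then have "x \<le> z n" by (simp add: z_def)
          then show "x \<in> (\<Union>n. A \<inter> {..z n})" using x by auto
        qed auto
      qed
    qed auto
    ultimately show ?thesis by (intro that) auto
  qed
  have "(\<lambda>n. emeasure lborel (A \<inter> {..z n})) \<longlonglongrightarrow> emeasure lborel (\<Union>n. A \<inter> {..z n})"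
    using z(1) by (intro Lim_emeasure_incseq) (auto simp: incseq_def intro: order_trans)
  then have "(\<lambda>n. emeasure lborel (A \<inter> {..z n}) + c) \<longlonglongrightarrow> emeasure lborel A + c"
    unfolding z(3) by (intro tendsto_add tendsto_const)
  then show ?thesis using le' z(2) by (intro LIMSEQ_le_const2) blast+
qed

text \<open>The inclusion of \<open>A\<close> in an affine image of \<open>C\<close> is expressed
  through preimages, so no image or sumset has to be shown measurable.\<close>

lemma emeasure_lborel_affine_le:
  fixes A C :: "real set"
  assumes [measurable]: "A \<in> sets borel" "C \<in> sets borel" and c: "c \<noteq> 0"
    and sub: "\<And>z. t + c * z \<in> A \<Longrightarrow> z \<in> C"
  shows "emeasure lborel A \<le> ennreal \<bar>c\<bar> * emeasure lborel C"
proof -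
  have "emeasure lborel A = (\<integral>\<^sup>+x. indicator A x \<partial>lborel)" by simp
  also have "\<dots> = ennreal \<bar>c\<bar> * (\<integral>\<^sup>+x. indicator A (t + c * x) \<partial>lborel)"
    using c by (intro nn_integral_real_affine) auto
  also have "\<dots> \<le> ennreal \<bar>c\<bar> * (\<integral>\<^sup>+x. indicator C x \<partial>lborel)"
    using sub by (intro mult_left_mono nn_integral_mono) (auto simp: indicator_def)
  finally show ?thesis by simp
qed

text \<open>With \<open>a\<close> near the top of \<open>A\<close> and \<open>b\<close> near the bottom of \<open>B\<close>, the sets
  \<open>(A \<inter> {..a} + b) / 2\<close> and \<open>(a + B \<inter> {b..}) / 2\<close> lie in \<open>C\<close> and overlap in one point only.\<close>

lemma Brunn_Minkowski_real:
  fixes A B C :: "real set"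
  assumes [measurable]: "A \<in> sets borel" "B \<in> sets borel" "C \<in> sets borel"
    and ne: "A \<noteq> {}" "B \<noteq> {}"
    and mid: "\<And>x y. x \<in> A \<Longrightarrow> y \<in> B \<Longrightarrow> (x + y) / 2 \<in> C"
  shows "emeasure lborel A + emeasure lborel B \<le> 2 * emeasure lborel C"
proof -
  \<comment> \<open>Reflection turns the bottom of \<open>B\<close> into a top, so the same lemma on
    initial segments serves both sets.\<close>
  define B' where "B' = uminus -` B"
  have [measurable]: "B' \<in> sets borel"
    unfolding B'_def by (rule measurable_sets_borel[of uminus borel]) auto
  have B'ne: "B' \<noteq> {}" using ne(2) unfolding B'_def by (metis all_not_in_conv minus_minus vimage_eq)
  have 1: "emeasure lborel (A \<inter> {..a}) + emeasure lborel (B' \<inter> {..b}) \<le> 2 * emeasure lborel C"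
    if a: "a \<in> A" and b: "b \<in> B'" for a b
  proof -
    have mb: "- b \<in> B" using b by (simp add: B'_def)
    define m where "m = (a - b) / 2"
    have "emeasure lborel (A \<inter> {..a}) \<le> ennreal \<bar>2\<bar> * emeasure lborel (C \<inter> {..m})"
    proof (rule emeasure_lborel_affine_le[where t=b])
      fix z assume "b + 2 * z \<in> A \<inter> {..a}"
      then have z: "b + 2 * z \<in> A" "b + 2 * z \<le> a" by auto
      have "z = (b + 2 * z + - b) / 2" by simp
      with mid[OF z(1) mb] z(2) show "z \<in> C \<inter> {..m}" by (auto simp: m_def)
    qed auto
    moreover have "emeasure lborel (B' \<inter> {..b}) \<le> ennreal \<bar>-2\<bar> * emeasure lborel (C \<inter> {m..})"
    proof (rule emeasure_lborel_affine_le[where t=a])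
      fix z assume "a + (- 2) * z \<in> B' \<inter> {..b}"
      then have z: "2 * z - a \<in> B" "a - 2 * z \<le> b" by (auto simp: B'_def)
      have "z = (a + (2 * z - a)) / 2" by simp
      with mid[OF a z(1)] z(2) show "z \<in> C \<inter> {m..}" by (auto simp: m_def)
    qed auto
    moreover have "emeasure lborel (C \<inter> {m..}) = emeasure lborel (C \<inter> {m<..})"
      using AE_lborel_singleton[of m] by (intro emeasure_eq_AE) auto
    moreover have "emeasure lborel (C \<inter> {..m}) + emeasure lborel (C \<inter> {m<..}) = emeasure lborel C"
      by (subst plus_emeasure) (auto intro!: arg_cong[where f="emeasure lborel"])
    ultimately have "emeasure lborel (A \<inter> {..a}) + emeasure lborel (B' \<inter> {..b})
        \<le> 2 * emeasure lborel (C \<inter> {..m}) + 2 * emeasure lborel (C \<inter> {m<..})"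
      by (intro add_mono) auto
    also have "\<dots> = 2 * emeasure lborel C"
      unfolding \<open>emeasure lborel (C \<inter> {..m}) + emeasure lborel (C \<inter> {m<..}) = emeasure lborel C\<close>[symmetric]
      by (simp add: distrib_left)
    finally show ?thesis .
  qed
  have 2: "emeasure lborel A + emeasure lborel (B' \<inter> {..b}) \<le> 2 * emeasure lborel C" if "b \<in> B'" for b
    by (rule emeasure_le_of_initial_segments[OF _ ne(1) 1[OF _ that]]) simp_all
  have "emeasure lborel B' + emeasure lborel A \<le> 2 * emeasure lborel C"
    by (rule emeasure_le_of_initial_segments[OF _ B'ne]) (simp_all add: 2 add.commute)
  have "emeasure lborel B \<le> ennreal \<bar>-1\<bar> * emeasure lborel B'"
  proof (rule emeasure_lborel_affine_le[where t=0])
    show "z \<in> B'" if "0 + - 1 * z \<in> B" for z using that by (simp add: B'_def)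
  qed auto
  then have "emeasure lborel A + emeasure lborel B \<le> emeasure lborel A + emeasure lborel B'"
    by (intro add_left_mono) simp
  moreover have "emeasure lborel A + emeasure lborel B' \<le> 2 * emeasure lborel C"
    using \<open>emeasure lborel B' + emeasure lborel A \<le> 2 * emeasure lborel C\<close> by (simp add: add.commute)
  ultimately show ?thesis by (rule order_trans)
qed

text \<open>The bound by 1 confines the levels to the open unit interval, the range in which
  functions normalised to supremum 1 have nonempty level sets.\<close>

lemma nn_integral_layer_cake:
  fixes u :: "real \<Rightarrow> real"
  assumes [measurable]: "u \<in> borel_measurable borel" and u: "\<And>x. 0 \<le> u x" "\<And>x. u x \<le> 1"
  shows "(\<integral>\<^sup>+x. ennreal (u x) \<partial>lborel) = (\<integral>\<^sup>+t. emeasure lborel {x. t < u x} * indicator {0<..<1} t \<partial>lborel)"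
proof -
  have "(\<integral>\<^sup>+x. ennreal (u x) \<partial>lborel) = (\<integral>\<^sup>+x. (\<integral>\<^sup>+t. indicator {x. t < u x} x * indicator {0<..<1} t \<partial>lborel) \<partial>lborel)"
  proof (rule nn_integral_cong)
    fix x
    have "(\<integral>\<^sup>+t. indicator {x. t < u x} x * indicator {0<..<1} t \<partial>lborel) = (\<integral>\<^sup>+t. indicator {0<..<u x} t \<partial>lborel)"
      using u(2)[of x] by (intro nn_integral_cong) (auto simp: indicator_def)
    then show "ennreal (u x) = (\<integral>\<^sup>+t. indicator {x. t < u x} x * indicator {0<..<1} t \<partial>lborel)"
      using u(1)[of x] by simp
  qed
  also have "\<dots> = (\<integral>\<^sup>+t. (\<integral>\<^sup>+x. indicator {x. t < u x} x * indicator {0<..<1} t \<partial>lborel) \<partial>lborel)"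
    by (rule lborel_pair.Fubini') measurable
  also have "\<dots> = (\<integral>\<^sup>+t. emeasure lborel {x. t < u x} * indicator {0<..<1} t \<partial>lborel)"
    by (intro nn_integral_cong) (simp add: nn_integral_multc)
  finally show ?thesis .
qed

text \<open>Brunn--Minkowski needs both level sets nonempty at the same level; hence
  \<open>f\<close> and \<open>g\<close> are divided by their suprema \<open>a\<close> and
  \<open>b\<close>, and \<open>h\<close> by \<open>s = sqrt (a * b)\<close>. Integration over levels
  gives the additive bound \<open>F / a + G / b \<le> 2 * (H / s)\<close>, which the
  arithmetic--geometric mean inequality makes multiplicative.\<close>

lemma Prekopa_Leindler_real:
  fixes f g h :: "real \<Rightarrow> real"
  assumes [measurable]: "f \<in> borel_measurable borel" "g \<in> borel_measurable borel" "h \<in> borel_measurable borel"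
    and int: "integrable lborel f" "integrable lborel g" "integrable lborel h"
    and nn: "\<And>x. 0 \<le> f x" "\<And>x. 0 \<le> g x" "\<And>x. 0 \<le> h x"
    and bdd: "\<And>x. f x \<le> B" "\<And>x. g x \<le> B"
    and mid: "\<And>x y. f x * g y \<le> (h ((x + y) / 2))\<^sup>2"
  shows "(LINT x|lborel. f x) * (LINT x|lborel. g x) \<le> (LINT x|lborel. h x)\<^sup>2"
proof (cases "(\<forall>x. f x = 0) \<or> (\<forall>x. g x = 0)")
  case True
  then have "(LINT x|lborel. f x) = 0 \<or> (LINT x|lborel. g x) = 0" by auto
  then show ?thesis by auto
next
  case False
  define a where "a = Sup (range f)"
  define b where "b = Sup (range g)"
  have bf: "bdd_above (range f)" and bg: "bdd_above (range g)" using bdd by (auto intro!: bdd_aboveI)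
  have fa: "f x \<le> a" and gb: "g x \<le> b" for x
    using bf bg by (auto simp: a_def b_def intro!: cSup_upper)
  have a: "a > 0" using False nn(1) fa by (metis antisym_conv not_less order_trans)
  have b: "b > 0" using False nn(2) gb by (metis antisym_conv not_less order_trans)
  define s where "s = sqrt (a * b)"
  have s: "s > 0" "s\<^sup>2 = a * b" using a b by (auto simp: s_def)
  have layer: "emeasure lborel {x. t < f x / a} + emeasure lborel {x. t < g x / b}
      \<le> 2 * emeasure lborel {x. t < min 1 (h x / s)}" if t: "0 < t" "t < 1" for t
  proof (rule Brunn_Minkowski_real)
    have "t * a < Sup (range f)" "t * b < Sup (range g)" using t a b by (simp_all flip: a_def b_def)
    then obtain x y where "t * a < f x" "t * b < g y"
      unfolding less_cSup_iff[OF _ bf, simplified] less_cSup_iff[OF _ bg, simplified] by blast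
    then show "{x. t < f x / a} \<noteq> {}" "{x. t < g x / b} \<noteq> {}" using a b by (auto simp: field_simps)
    fix x y assume "x \<in> {x. t < f x / a}" "y \<in> {x. t < g x / b}"
    then have xy: "t * a < f x" "t * b < g y" using a b by (auto simp: field_simps)
    have "(t * s)\<^sup>2 = (t * a) * (t * b)" by (simp add: power_mult_distrib s(2) power2_eq_square[of t])
    also have "\<dots> < f x * g y" using xy t a b by (intro mult_strict_mono') auto
    also have "\<dots> \<le> (h ((x + y) / 2))\<^sup>2" by (rule mid)
    finally have "t * s < h ((x + y) / 2)" using nn(3) by (rule power2_less_imp_less)
    then show "(x + y) / 2 \<in> {x. t < min 1 (h x / s)}" using t s by (auto simp: field_simps)
  qed measurable
  have "(\<integral>\<^sup>+x. ennreal (f x / a) \<partial>lborel) + (\<integral>\<^sup>+x. ennreal (g x / b) \<partial>lborel)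
      = (\<integral>\<^sup>+t. (emeasure lborel {x. t < f x / a} + emeasure lborel {x. t < g x / b}) * indicator {0<..<1} t \<partial>lborel)"
    using nn fa gb a b by (subst (1 2) nn_integral_layer_cake) (auto simp: nn_integral_add distrib_right)
  also have "\<dots> \<le> (\<integral>\<^sup>+t. 2 * (emeasure lborel {x. t < min 1 (h x / s)} * indicator {0<..<1} t) \<partial>lborel)"
    using layer by (intro nn_integral_mono) (auto simp: indicator_def)
  also have "\<dots> = 2 * (\<integral>\<^sup>+x. ennreal (min 1 (h x / s)) \<partial>lborel)"
    using nn s by (subst nn_integral_layer_cake) (auto simp: nn_integral_cmult)
  also have "\<dots> \<le> 2 * (\<integral>\<^sup>+x. ennreal (h x / s) \<partial>lborel)"
    by (intro mult_left_mono nn_integral_mono ennreal_leI) auto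
  finally have "ennreal (LINT x|lborel. f x / a) + ennreal (LINT x|lborel. g x / b) \<le> 2 * ennreal (LINT x|lborel. h x / s)"
    using int nn a b s by (simp add: nn_integral_eq_integral)
  also have "2 * ennreal (LINT x|lborel. h x / s) = ennreal (2 * (LINT x|lborel. h x / s))"
    using nn s by (subst ennreal_mult) (auto intro!: integral_nonneg_AE)
  finally have "ennreal ((LINT x|lborel. f x / a) + (LINT x|lborel. g x / b)) \<le> ennreal (2 * (LINT x|lborel. h x / s))"
    using nn a b by (subst ennreal_plus) (auto intro!: integral_nonneg_AE)
  then have le: "(LINT x|lborel. f x) / a + (LINT x|lborel. g x) / b \<le> 2 * ((LINT x|lborel. h x) / s)"
    using nn s by (subst (asm) ennreal_le_iff) (auto intro!: integral_nonneg_AE mult_nonneg_nonneg)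
  define F G H where "F = (LINT x|lborel. f x)" "G = (LINT x|lborel. g x)" "H = (LINT x|lborel. h x)"
  have FG: "F \<ge> 0" "G \<ge> 0" "H \<ge> 0" using nn by (auto simp: F_G_H_def)
  have "4 * (F / a * (G / b)) \<le> (F / a + G / b)\<^sup>2"
    using sum_squares_bound[of "F / a" "G / b"] by (simp add: power2_sum)
  also have "\<dots> \<le> (2 * (H / s))\<^sup>2"
    using le FG a b unfolding F_G_H_def by (intro power_mono) auto
  also have "\<dots> = 4 * (H\<^sup>2 / (a * b))" by (simp add: power_mult_distrib power_divide s(2))
  finally have "F * G / (a * b) \<le> H\<^sup>2 / (a * b)" by simp
  then have "F * G \<le> H\<^sup>2" using a b by (simp add: divide_le_cancel)
  then show ?thesis by (simp add: F_G_H_def)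
qed

context centred_gaussian
begin

lemma decomposition_integral:
  fixes u :: "'a \<Rightarrow> real"
  assumes f: "bounded_linear f" and pos: "sq_norm \<gamma> f > 0" and k: "R_graph \<gamma> f (sq_norm \<gamma> f *\<^sub>R k)"
    and u [measurable]: "u \<in> borel_measurable borel" and bd: "\<And>x. 0 \<le> u x" "\<And>x. u x \<le> 1"
  defines "P \<equiv> distr \<gamma> borel (\<lambda>x. x - f x *\<^sub>R k)"
  defines "U \<equiv> \<lambda>t. LINT w|P. u (t *\<^sub>R k + w)"
  shows "U \<in> borel_measurable borel" "\<And>t. 0 \<le> U t" "\<And>t. U t \<le> 1"
    "integrable lborel (\<lambda>t. normal_density 0 (sqrt (sq_norm \<gamma> f)) t * U t)"
    "(LINT x|\<gamma>. u x) = (LINT t|lborel. normal_density 0 (sqrt (sq_norm \<gamma> f)) t * U t)"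
proof -
  define s where "s = sqrt (sq_norm \<gamma> f)"
  have s: "s > 0" using pos by (simp add: s_def)
  have L: "bounded_linear (\<lambda>x. x - f x *\<^sub>R k)" by (rule bounded_linear_projection[OF f])
  interpret P: prob_space P
    unfolding P_def using bounded_linear_measurable'[OF L] by (intro prob_space_distr)
  have um: "(\<lambda>z :: real \<times> 'a. u (fst z *\<^sub>R k + snd z)) \<in> borel_measurable borel"
    by (rule measurable_compose[OF borel_measurable_continuous_onI u]) (intro continuous_intros)
  have "sets ((borel :: real measure) \<Otimes>\<^sub>M P) = sets (borel \<Otimes>\<^sub>M borel)" by (rule sets_pair_measure_cong) (simp_all add: P_def)
  then have "sets ((borel :: real measure) \<Otimes>\<^sub>M P) = sets borel" by (simp only: borel_prod)
  then have um': "(\<lambda>z :: real \<times> 'a. u (fst z *\<^sub>R k + snd z)) \<in> borel_measurable (borel \<Otimes>\<^sub>M P)"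
    using um by (simp cong: measurable_cong_sets)
  then show U [measurable]: "U \<in> borel_measurable borel"
    unfolding U_def by (intro P.borel_measurable_lebesgue_integral) (simp add: case_prod_beta')
  have uw: "(\<lambda>w. u (t *\<^sub>R k + w)) \<in> borel_measurable P" for t
  proof -
    have "(\<lambda>w. u (t *\<^sub>R k + w)) \<in> borel_measurable borel"
      by (rule measurable_compose[OF borel_measurable_continuous_onI u]) (intro continuous_intros)
    then show ?thesis by (simp add: P_def)
  qed
  have iu: "integrable P (\<lambda>w. u (t *\<^sub>R k + w))" for t
    using bd uw by (intro P.integrable_const_bound[where B=1]) auto
  show U0: "0 \<le> U t" for t unfolding U_def using bd by (intro integral_nonneg_AE) auto
  show U1: "U t \<le> 1" for t
    unfolding U_def using bd iu P.integral_le_const[of "\<lambda>w. u (t *\<^sub>R k + w)" 1] by auto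
  have nd: "integrable lborel (\<lambda>t. normal_density 0 s t)" using s by (rule integrable_normal_density)
  show I: "integrable lborel (\<lambda>t. normal_density 0 (sqrt (sq_norm \<gamma> f)) t * U t)"
    unfolding s_def[symmetric]
  proof (rule Bochner_Integration.integrable_bound[OF nd])
    show "AE t in lborel. norm (normal_density 0 s t * U t) \<le> norm (normal_density 0 s t)"
      using U0 U1 by (intro AE_I2) (simp add: abs_mult mult_left_le)
  qed simp
  have "(\<integral>\<^sup>+x. ennreal (u x) \<partial>\<gamma>) = (\<integral>\<^sup>+t. \<integral>\<^sup>+w. ennreal (u (t *\<^sub>R k + w)) \<partial>P \<partial>density lborel (\<lambda>x. ennreal (normal_density 0 s x)))"
    using decomposition_nn_integral(1)[OF f pos k measurable_compose[OF um measurable_ennreal]]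
    by (simp add: s_def P_def)
  also have "\<dots> = (\<integral>\<^sup>+t. ennreal (U t) \<partial>density lborel (\<lambda>x. ennreal (normal_density 0 s x)))"
    unfolding U_def using iu bd by (intro nn_integral_cong nn_integral_eq_integral) auto
  also have "\<dots> = (\<integral>\<^sup>+t. ennreal (normal_density 0 s t * U t) \<partial>lborel)"
    by (subst nn_integral_density) (auto simp: ennreal_mult normal_density_nonneg U0)
  also have "\<dots> = ennreal (LINT t|lborel. normal_density 0 s t * U t)"
    using I U0 by (intro nn_integral_eq_integral) (auto simp: s_def normal_density_nonneg)
  finally have "ennreal (LINT x|\<gamma>. u x) = ennreal (LINT t|lborel. normal_density 0 s t * U t)"
    using bd by (subst (asm) nn_integral_eq_integral) (auto intro!: integrable_const_bound[where B=1])
  then show "(LINT x|\<gamma>. u x) = (LINT t|lborel. normal_density 0 (sqrt (sq_norm \<gamma> f)) t * U t)"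
    using bd U0 by (subst (asm) ennreal_inj) (auto simp: s_def normal_density_nonneg intro!: integral_nonneg_AE)
qed

end

section \<open>Prekopa--Leindler for functions of finitely many functionals\<close>

definition midpoint_bounded :: "('a::real_vector \<Rightarrow> real) \<Rightarrow> ('a \<Rightarrow> real) \<Rightarrow> ('a \<Rightarrow> real) \<Rightarrow> bool" where
  "midpoint_bounded u v w \<longleftrightarrow> (\<forall>x y. u x * v y \<le> (w ((1/2) *\<^sub>R (x + y)))\<^sup>2)"

text \<open>Dependence on the values of \<open>gs\<close> alone is encoded as invariance under their
  common kernel, which avoids choosing coordinates on the quotient.\<close>

definition cylindrical :: "('a::real_normed_vector \<Rightarrow> real) list \<Rightarrow> ('a \<Rightarrow> real) \<Rightarrow> bool" where
  "cylindrical gs u \<longleftrightarrow> u \<in> borel_measurable borel \<and> (\<forall>x. 0 \<le> u x \<and> u x \<le> 1) \<and>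
     (\<forall>x v. (\<forall>g\<in>set gs. g v = 0) \<longrightarrow> u (x + v) = u x)"

definition PL_for :: "('a::{banach, second_countable_topology} \<Rightarrow> real) list \<Rightarrow> 'a measure \<Rightarrow> bool" where
  "PL_for gs M \<longleftrightarrow> (\<forall>u v w. cylindrical gs u \<and> cylindrical gs v \<and> cylindrical gs w \<and> midpoint_bounded u v w \<longrightarrow>
     (LINT x|M. u x) * (LINT x|M. v x) \<le> (LINT x|M. w x)\<^sup>2)"

text \<open>On the hyperplane \<open>g = 0\<close> a function that is cylindrical for \<open>g # gs\<close> agrees with one that is
  cylindrical for \<open>gs\<close>.\<close>

lemma PL_for_Cons_null:
  fixes g :: "'a::{banach, second_countable_topology} \<Rightarrow> real"
  assumes PL: "PL_for gs M" and g: "bounded_linear g" and gs: "\<And>f. f \<in> set gs \<Longrightarrow> bounded_linear f"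
    and sets: "sets M = sets borel" and null: "AE x in M. g x = 0"
  shows "PL_for (g # gs) M"
proof (cases "\<exists>v. (\<forall>f\<in>set gs. f v = 0) \<and> g v \<noteq> 0")
  \<comment> \<open>Here \<open>g\<close> vanishes on the common kernel of \<open>gs\<close>, so
    adding it to the list leaves that kernel unchanged.\<close>
  case False
  then have "cylindrical (g # gs) u = cylindrical gs u" for u
    unfolding cylindrical_def by auto
  then show ?thesis using PL by (simp add: PL_for_def)
next
  case True
  then obtain e0 where e0: "\<And>f. f \<in> set gs \<Longrightarrow> f e0 = 0" "g e0 \<noteq> 0" by blast
  \<comment> \<open>\<open>q\<close> projects onto the kernel of \<open>g\<close> along
    \<open>e0\<close>, a direction invisible to \<open>gs\<close>. Composition with \<open>q\<close>
    makes a function cylindrical for \<open>gs\<close> and alters it only where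
    \<open>g x \<noteq> 0\<close>, a null set.\<close>
  define q where "q x = x - g x *\<^sub>R ((1 / g e0) *\<^sub>R e0)" for x
  have q: "bounded_linear q"
    unfolding q_def
    by (intro bounded_linear_sub bounded_linear_ident bounded_linear_compose[OF bounded_linear_scaleR_left g])
  have gq: "g (q x) = 0" for x
    using e0(2) linear_diff[OF bounded_linear.linear[OF g]] linear_cmul[OF bounded_linear.linear[OF g]]
    by (simp add: q_def)
  have fq: "f (q x) = f x" if "f \<in> set gs" for f x
    using e0(1)[OF that] linear_diff[OF bounded_linear.linear[OF gs[OF that]]]
      linear_cmul[OF bounded_linear.linear[OF gs[OF that]]] by (simp add: q_def)
  have qadd: "q (x + y) = q x + q y" for x y using linear_add[OF bounded_linear.linear[OF q]] .
  have qs: "q (c *\<^sub>R x) = c *\<^sub>R q x" for c x using linear_cmul[OF bounded_linear.linear[OF q]] .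
  have qm: "q \<in> borel_measurable borel"
    using q by (intro borel_measurable_continuous_onI linear_continuous_on)
  have cyl: "cylindrical gs (\<lambda>x. u (q x))" if "cylindrical (g # gs) u" for u
    unfolding cylindrical_def
  proof (intro conjI allI impI)
    show "(\<lambda>x. u (q x)) \<in> borel_measurable borel"
      using that by (intro measurable_compose[OF qm]) (simp add: cylindrical_def)
    show "0 \<le> u (q x)" "u (q x) \<le> 1" for x using that by (simp_all add: cylindrical_def)
    fix x v assume v: "\<forall>f\<in>set gs. f v = 0"
    have "f (q v) = 0" if "f \<in> set (g # gs)" for f
      using that fq[of f v] gq[of v] v by (cases "f = g") auto
    then have "\<forall>f\<in>set (g # gs). f (q v) = 0" by blast
    then show "u (q (x + v)) = u (q x)" unfolding qadd using that unfolding cylindrical_def by blast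
  qed
  have int: "(LINT x|M. u (q x)) = (LINT x|M. u x)" if "cylindrical (g # gs) u" for u
  proof (rule integral_cong_AE)
    have um: "u \<in> borel_measurable borel" using that by (simp add: cylindrical_def)
    show "(\<lambda>x. u (q x)) \<in> borel_measurable M" "u \<in> borel_measurable M"
      using measurable_compose[OF qm um] um sets by (simp_all cong: measurable_cong_sets)
    show "AE x in M. u (q x) = u x" using null by eventually_elim (simp add: q_def)
  qed
  show ?thesis
    unfolding PL_for_def
  proof (intro allI impI, elim conjE)
    fix u v w
    assume c: "cylindrical (g # gs) u" "cylindrical (g # gs) v" "cylindrical (g # gs) w"
      and mid: "midpoint_bounded u v w"
    have "midpoint_bounded (\<lambda>x. u (q x)) (\<lambda>x. v (q x)) (\<lambda>x. w (q x))"
      using mid by (simp add: midpoint_bounded_def qs qadd)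
    then show "(LINT x|M. u x) * (LINT x|M. v x) \<le> (LINT x|M. w x)\<^sup>2"
      using PL cyl[OF c(1)] cyl[OF c(2)] cyl[OF c(3)]
      unfolding PL_for_def int[OF c(1), symmetric] int[OF c(2), symmetric] int[OF c(3), symmetric] by blast
  qed
qed

text \<open>The induction runs over all Gaussian measures at once, since its step uses the
  hypothesis for the residual law \<open>P\<close>. Under \<open>P\<close> the functional
  \<open>g\<close> vanishes almost surely, so the inequality for \<open>gs\<close> upgrades to
  \<open>g # gs\<close>. Applied to slices, it shows that the slice means \<open>I\<close> satisfy
  the midpoint condition on the line; so does the normal density, and the one-dimensional inequality
  applies to the products.\<close>

lemma PL_for_gaussian:
  assumes "centred_gaussian \<gamma>" and "\<And>g. g \<in> set gs \<Longrightarrow> bounded_linear g"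
  shows "PL_for gs \<gamma>"
  using assms
proof (induction gs arbitrary: \<gamma>)
  case Nil
  interpret centred_gaussian \<gamma> by (rule Nil)
  have c: "u x = u 0" if "cylindrical [] u" for u :: "'a \<Rightarrow> real" and x
    using that unfolding cylindrical_def by (metis add.left_neutral empty_iff empty_set)
  have int: "(LINT x|\<gamma>. u x) = u 0" if "cylindrical [] u" for u
  proof -
    have "(LINT x|\<gamma>. u x) = (LINT x|\<gamma>. u 0)" using c[OF that] by (intro Bochner_Integration.integral_cong) auto
    then show ?thesis using prob_space by simp
  qed
  show ?case
    unfolding PL_for_def
  proof (intro allI impI, elim conjE)
    fix u v w :: "'a \<Rightarrow> real"
    assume "cylindrical [] u" "cylindrical [] v" "cylindrical [] w" and mid: "midpoint_bounded u v w"
    moreover have "u 0 * v 0 \<le> (w ((1/2) *\<^sub>R (0 + 0)))\<^sup>2" using mid unfolding midpoint_bounded_def by blast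
    ultimately show "(LINT x|\<gamma>. u x) * (LINT x|\<gamma>. v x) \<le> (LINT x|\<gamma>. w x)\<^sup>2" by (simp add: int)
  qed
next
  case (Cons g gs)
  interpret centred_gaussian \<gamma> by (rule Cons.prems)
  have g: "bounded_linear g" and gs: "\<And>f. f \<in> set gs \<Longrightarrow> bounded_linear f" using Cons.prems by auto
  show ?case
  proof (cases "sq_norm \<gamma> g = 0")
    case True
    show ?thesis
      using Cons.IH[OF Cons.prems(1)] gs sq_norm_zero_AE[OF g True] by (intro PL_for_Cons_null g) auto
  next
    case False
    define c where "c = sq_norm \<gamma> g"
    have c: "c > 0" using False sq_norm_nonneg[of \<gamma> g] by (simp add: c_def)
    obtain h where h: "R_graph \<gamma> g h" using R_graph_exists[OF square_integrable_linear[OF g]] .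
    define k where "k = (1 / c) *\<^sub>R h"
    have k: "R_graph \<gamma> g (sq_norm \<gamma> g *\<^sub>R k)" using h c by (simp add: k_def c_def)
    define P where "P = distr \<gamma> borel (\<lambda>x. x - g x *\<^sub>R k)"
    have L: "bounded_linear (\<lambda>x. x - g x *\<^sub>R k)" by (rule bounded_linear_projection[OF g])
    interpret P: centred_gaussian P unfolding P_def by (rule linear_image_gaussian[OF L])
    have "g (sq_norm \<gamma> g *\<^sub>R k) = (LINT x|\<gamma>. g x * g x)" using k g unfolding R_graph_def by blast
    then have "sq_norm \<gamma> g * g k = sq_norm \<gamma> g"
      using linear_cmul[OF bounded_linear.linear[OF g], of "sq_norm \<gamma> g" k]
      by (simp add: sq_norm_def power2_eq_square)
    \<comment> \<open>With this value the residual \<open>x - g x *\<^sub>R k\<close> lies in the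
      kernel of \<open>g\<close>.\<close>
    then have gk: "g k = 1" using False by simp
    have "AE x in \<gamma>. g (x - g x *\<^sub>R k) = 0"
      by (simp add: gk linear_diff[OF bounded_linear.linear[OF g]] linear_cmul[OF bounded_linear.linear[OF g]])
    then have null: "AE x in P. g x = 0"
      unfolding P_def using bounded_linear_measurable'[OF L] bounded_linear_measurable[OF g]
      by (subst AE_distr_iff) auto
    have PLP: "PL_for (g # gs) P"
      using Cons.IH[OF P.centred_gaussian_axioms] gs null by (intro PL_for_Cons_null g) auto
    have tr: "cylindrical (g # gs) (\<lambda>x. u (t *\<^sub>R k + x))" if "cylindrical (g # gs) u" for u and t :: real
      unfolding cylindrical_def
    proof (intro conjI allI impI)
      have um: "u \<in> borel_measurable borel" using that by (simp add: cylindrical_def)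
      show "(\<lambda>x. u (t *\<^sub>R k + x)) \<in> borel_measurable borel"
        by (rule measurable_compose[OF borel_measurable_continuous_onI um]) (intro continuous_intros)
      show "0 \<le> u (t *\<^sub>R k + x)" "u (t *\<^sub>R k + x) \<le> 1" for x using that by (simp_all add: cylindrical_def)
      fix x v assume "\<forall>f\<in>set (g # gs). f v = 0"
      then show "u (t *\<^sub>R k + (x + v)) = u (t *\<^sub>R k + x)"
        using that unfolding cylindrical_def add.assoc[symmetric] by blast
    qed
    show ?thesis
      unfolding PL_for_def
    proof (intro allI impI, elim conjE)
      fix u v w :: "'a \<Rightarrow> real"
      assume cy: "cylindrical (g # gs) u" "cylindrical (g # gs) v" "cylindrical (g # gs) w"
        and mid: "midpoint_bounded u v w"
      define I where "I u t = (LINT x|P. u (t *\<^sub>R k + x))" for u :: "'a \<Rightarrow> real" and t :: real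
      define \<phi> where "\<phi> = normal_density 0 (sqrt c)"
      have dec: "I u \<in> borel_measurable borel" "\<And>t. 0 \<le> I u t" "\<And>t. I u t \<le> 1"
          "integrable lborel (\<lambda>t. \<phi> t * I u t)" "(LINT x|\<gamma>. u x) = (LINT t|lborel. \<phi> t * I u t)"
        if "cylindrical (g # gs) u" for u
        using decomposition_integral[OF g _ k, of u] that c
        unfolding I_def[abs_def] \<phi>_def c_def P_def cylindrical_def by auto
      have I_mid: "I u s * I v t \<le> (I w ((s + t) / 2))\<^sup>2" for s t
      proof -
        have "midpoint_bounded (\<lambda>x. u (s *\<^sub>R k + x)) (\<lambda>x. v (t *\<^sub>R k + x)) (\<lambda>x. w (((s + t) / 2) *\<^sub>R k + x))"
          unfolding midpoint_bounded_def
        proof (intro allI)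
          fix x y
          have "(1/2) *\<^sub>R ((s *\<^sub>R k + x) + (t *\<^sub>R k + y)) = ((s + t) / 2) *\<^sub>R k + (1/2) *\<^sub>R (x + y)"
            by (simp add: algebra_simps add_divide_distrib)
          then show "u (s *\<^sub>R k + x) * v (t *\<^sub>R k + y) \<le> (w (((s + t) / 2) *\<^sub>R k + (1/2) *\<^sub>R (x + y)))\<^sup>2"
            using mid unfolding midpoint_bounded_def by metis
        qed
        then show ?thesis
          using PLP tr[OF cy(1)] tr[OF cy(2)] tr[OF cy(3)] unfolding PL_for_def I_def by blast
      qed
      have \<phi>0: "0 \<le> \<phi> t" for t by (simp add: \<phi>_def)
      have \<phi>1: "\<phi> t \<le> 1 / sqrt (2 * pi * c)" for t
      proof -
        have "1 / sqrt (2 * pi * c) * exp (- (t - 0)\<^sup>2 / (2 * (sqrt c)\<^sup>2)) \<le> 1 / sqrt (2 * pi * c) * 1"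
          using c by (intro mult_left_mono) auto
        then show ?thesis using c by (simp add: \<phi>_def normal_density_def)
      qed
      have \<phi>_mid: "\<phi> s * \<phi> t \<le> (\<phi> ((s + t) / 2))\<^sup>2" for s t
      proof -
        have "- s\<^sup>2 / (2 * c) + - t\<^sup>2 / (2 * c) \<le> - ((s + t) / 2)\<^sup>2 / (2 * c) + - ((s + t) / 2)\<^sup>2 / (2 * c)"
        proof -
          have "((s + t) / 2)\<^sup>2 + ((s + t) / 2)\<^sup>2 \<le> s\<^sup>2 + t\<^sup>2"
            using sum_squares_bound[of s t] by (simp add: power2_sum power_divide field_simps)
          then have "(((s + t) / 2)\<^sup>2 + ((s + t) / 2)\<^sup>2) / (2 * c) \<le> (s\<^sup>2 + t\<^sup>2) / (2 * c)"
            using c by (intro divide_right_mono) auto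
          then show ?thesis by (simp add: add_divide_distrib)
        qed
        then have "exp (- s\<^sup>2 / (2 * c)) * exp (- t\<^sup>2 / (2 * c)) \<le> (exp (- ((s + t) / 2)\<^sup>2 / (2 * c)))\<^sup>2"
          unfolding power2_eq_square[of "exp _"] exp_add[symmetric] by simp
        then have "(1 / sqrt (2 * pi * c))\<^sup>2 * (exp (- s\<^sup>2 / (2 * c)) * exp (- t\<^sup>2 / (2 * c)))
            \<le> (1 / sqrt (2 * pi * c))\<^sup>2 * (exp (- ((s + t) / 2)\<^sup>2 / (2 * c)))\<^sup>2"
          by (rule mult_left_mono) simp
        then show ?thesis
          using c unfolding \<phi>_def normal_density_def by (simp add: power_mult_distrib power_divide mult_ac)
      qed
      have "(LINT t|lborel. \<phi> t * I u t) * (LINT t|lborel. \<phi> t * I v t) \<le> (LINT t|lborel. \<phi> t * I w t)\<^sup>2"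
      proof (rule Prekopa_Leindler_real)
        have \<phi>m: "\<phi> \<in> borel_measurable borel" by (simp add: \<phi>_def)
        show "(\<lambda>t. \<phi> t * I u t) \<in> borel_measurable borel" "(\<lambda>t. \<phi> t * I v t) \<in> borel_measurable borel"
          "(\<lambda>t. \<phi> t * I w t) \<in> borel_measurable borel"
          using \<phi>m dec(1)[OF cy(1)] dec(1)[OF cy(2)] dec(1)[OF cy(3)] by (intro borel_measurable_times; simp)+
        show "integrable lborel (\<lambda>t. \<phi> t * I u t)" "integrable lborel (\<lambda>t. \<phi> t * I v t)" "integrable lborel (\<lambda>t. \<phi> t * I w t)"
          using dec(4) cy by auto
        show "0 \<le> \<phi> t * I u t" "0 \<le> \<phi> t * I v t" "0 \<le> \<phi> t * I w t" for t
          using \<phi>0 dec(2) cy by auto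
        have "\<phi> t * I u t \<le> 1 / sqrt (2 * pi * c)" if "cylindrical (g # gs) u" for u t
          using mult_mono[OF \<phi>1 dec(3)[OF that] _ dec(2)[OF that], of t t] c by simp
        then show "\<phi> t * I u t \<le> 1 / sqrt (2 * pi * c)" "\<phi> t * I v t \<le> 1 / sqrt (2 * pi * c)" for t
          using cy by auto
        show "\<phi> s * I u s * (\<phi> t * I v t) \<le> (\<phi> ((s + t) / 2) * I w ((s + t) / 2))\<^sup>2" for s t
        proof -
          have "(\<phi> s * \<phi> t) * (I u s * I v t) \<le> (\<phi> ((s + t) / 2))\<^sup>2 * (I w ((s + t) / 2))\<^sup>2"
            using \<phi>_mid I_mid \<phi>0 dec(2)[OF cy(1)] dec(2)[OF cy(2)] by (intro mult_mono) auto
          then show ?thesis by (simp add: power_mult_distrib mult_ac)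
        qed
      qed
      then show "(LINT x|\<gamma>. u x) * (LINT x|\<gamma>. v x) \<le> (LINT x|\<gamma>. w x)\<^sup>2"
        using dec(5) cy by simp
    qed
  qed
qed

text \<open>Prekopa--Leindler is applied to indicators of slab intersections centred at
  \<open>x\<close>, \<open>- x\<close> and 0. Midpoints of the first two lie in the third, and
  symmetry gives the first two equal mass, so the product of their masses is a square. Letting the
  number of slabs grow yields the ball.\<close>

theorem (in centred_gaussian) Anderson_inequality:
  "measure \<gamma> (cball x r) \<le> measure \<gamma> (cball 0 r)"
proof -
  obtain g :: "nat \<Rightarrow> 'a \<Rightarrow> real" where g: "\<And>n. bounded_linear (g n)" "\<And>x r. norm x \<le> r \<longleftrightarrow> (\<forall>n. \<bar>g n x\<bar> \<le> r)"
    using norming_sequence by metis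
  have gm [measurable]: "g n \<in> borel_measurable borel" for n using bounded_linear_measurable[OF g(1)] .
  have gl: "g n (a + b) = g n a + g n b" "g n (a - b) = g n a - g n b" "g n (c *\<^sub>R a) = c * g n a" "g n (- a) = - g n a" for n a b c
    using bounded_linear.linear[OF g(1)[of n]] by (simp_all add: linear_add linear_diff linear_cmul linear_neg)
  define C where "C m z = {y. \<forall>n<m. \<bar>g n (y - z)\<bar> \<le> r}" for m :: nat and z
  have Ceq: "C m z = {y. \<forall>n<m. \<bar>g n y - g n z\<bar> \<le> r}" for m z by (simp add: C_def gl)
  have Cm [measurable]: "C m z \<in> sets borel" for m z unfolding Ceq by measurable
  have sym: "measure \<gamma> (C m (- z)) = measure \<gamma> (C m z)" for m z
  proof -
    have "measure \<gamma> (C m z) = measure (distr \<gamma> borel uminus) (C m z)" by (simp add: distr_uminus)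
    also have "\<dots> = measure \<gamma> (uminus -` C m z \<inter> space \<gamma>)"
      using bounded_linear_measurable'[OF bounded_linear_minus[OF bounded_linear_ident]]
      by (intro measure_distr) auto
    also have "uminus -` C m z \<inter> space \<gamma> = C m (- z)"
    proof -
      have "\<bar>- a - b\<bar> = \<bar>a - - b\<bar>" for a b :: real by simp
      then show ?thesis by (auto simp: Ceq gl)
    qed
    finally show ?thesis ..
  qed
  have le: "measure \<gamma> (C m x) \<le> measure \<gamma> (C m 0)" for m
  proof -
    have cyl: "cylindrical (map g [0..<m]) (indicator (C m z))" for z
      unfolding cylindrical_def by (auto simp: indicator_def Ceq gl)
    have "midpoint_bounded (indicator (C m x)) (indicator (C m (- x))) (indicator (C m 0))"
      unfolding midpoint_bounded_def
    proof (intro allI)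
      fix a b
      have "(1/2) *\<^sub>R (a + b) \<in> C m 0" if ab: "a \<in> C m x" "b \<in> C m (- x)"
        unfolding C_def
      proof (intro CollectI allI impI)
        fix n assume n: "n < m"
        have "\<bar>g n a - g n x\<bar> \<le> r" "\<bar>g n b + g n x\<bar> \<le> r" using ab n by (auto simp: Ceq gl)
        then have "\<bar>(1/2) * (g n a + g n b)\<bar> \<le> r"
          unfolding abs_le_iff by (elim conjE, intro conjI) (simp_all add: field_simps)
        then show "\<bar>g n ((1/2) *\<^sub>R (a + b) - 0)\<bar> \<le> r" by (simp add: gl)
      qed
      then show "indicator (C m x) a * indicator (C m (- x)) b \<le> (indicator (C m 0) ((1/2) *\<^sub>R (a + b)) :: real)\<^sup>2"
        by (cases "a \<in> C m x"; cases "b \<in> C m (- x)") (simp_all del: scaleR_add_right)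
    qed
    moreover have "PL_for (map g [0..<m]) \<gamma>"
      using g(1) by (intro PL_for_gaussian centred_gaussian_axioms) auto
    ultimately have "(LINT y|\<gamma>. indicator (C m x) y) * (LINT y|\<gamma>. indicator (C m (- x)) y) \<le> (LINT y|\<gamma>. indicator (C m 0) y :: real)\<^sup>2"
      using cyl unfolding PL_for_def by blast
    then have "(measure \<gamma> (C m x))\<^sup>2 \<le> (measure \<gamma> (C m 0))\<^sup>2" by (simp add: sym power2_eq_square)
    then show ?thesis by (rule power2_le_imp_le) simp
  qed
  have ball: "(\<Inter>m. C m z) = cball z r" for z
  proof (intro set_eqI)
    fix y
    have "y \<in> (\<Inter>m. C m z) \<longleftrightarrow> (\<forall>n. \<bar>g n (y - z)\<bar> \<le> r)" by (auto simp: C_def)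
    also have "\<dots> \<longleftrightarrow> y \<in> cball z r" using g(2)[of "y - z" r] by (simp add: dist_norm norm_minus_commute)
    finally show "y \<in> (\<Inter>m. C m z) \<longleftrightarrow> y \<in> cball z r" .
  qed
  have lim: "(\<lambda>m. measure \<gamma> (C m z)) \<longlonglongrightarrow> measure \<gamma> (cball z r)" for z
    unfolding ball[symmetric] by (intro finite_Lim_measure_decseq) (auto simp: decseq_def C_def)
  show ?thesis using le by (intro LIMSEQ_le[OF lim lim]) auto
qed

section \<open>Small balls and the Cameron--Martin norm\<close>

lemma LIMSEQ_zero_of_square_le:
  fixes a b :: "nat \<Rightarrow> real"
  assumes le: "\<And>n. (a n)\<^sup>2 \<le> b n" and b: "b \<longlonglongrightarrow> 0"
  shows "a \<longlonglongrightarrow> 0"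
proof -
  have "(\<lambda>n. (a n)\<^sup>2) \<longlonglongrightarrow> 0"
    by (rule tendsto_sandwich[OF _ _ tendsto_const b]) (simp_all add: le)
  from tendsto_real_sqrt[OF this] show ?thesis by (simp add: tendsto_rabs_zero_iff)
qed

text \<open>The geometric rate replaces the passage to a subsequence: increments have L1 norm at
  most \<open>(1/2) ^ n\<close>, hence are almost surely summable, and Fatou's lemma carries the L2
  bound to the limit.\<close>

lemma (in prob_space) L2_complete:
  fixes f :: "nat \<Rightarrow> 'a \<Rightarrow> real"
  assumes sq: "\<And>n. square_integrable M (f n)"
    and cauchy: "\<And>N m n. N \<le> m \<Longrightarrow> N \<le> n \<Longrightarrow> sq_norm M (\<lambda>x. f m x - f n x) \<le> (1/4) ^ N"
  obtains F where "square_integrable M F" "\<And>n. sq_norm M (\<lambda>x. f n x - F x) \<le> (1/4) ^ n"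
proof -
  have fm [measurable]: "f n \<in> borel_measurable M" for n using sq by (simp add: square_integrable_def)
  have sqd: "square_integrable M (\<lambda>x. f m x - f n x)" for m n by (intro square_integrable_diff sq)
  define D where "D n x = f (Suc n) x - f n x" for n x
  have Dm [measurable]: "D n \<in> borel_measurable M" for n unfolding D_def by measurable
  have one: "square_integrable M (\<lambda>x. 1 :: real)" by (simp add: square_integrable_def)
  have D1: "(\<integral>\<^sup>+x. ennreal \<bar>D n x\<bar> \<partial>M) \<le> ennreal ((1/2) ^ n)" for n
  proof -
    have abs: "square_integrable M (\<lambda>x. \<bar>D n x\<bar>)" using sqd[of "Suc n" n] by (simp add: square_integrable_def D_def)
    have "(LINT x|M. \<bar>D n x\<bar> * 1)\<^sup>2 \<le> sq_norm M (\<lambda>x. \<bar>D n x\<bar>) * sq_norm M (\<lambda>x. 1)"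
      by (rule integral_Cauchy_Schwarz[OF abs one])
    also have "\<dots> = sq_norm M (D n)" by (simp add: sq_norm_def prob_space)
    also have "\<dots> \<le> (1/4) ^ n" using cauchy[of n "Suc n" n] by (simp add: D_def[abs_def])
    also have "(1/4 :: real) ^ n = ((1/2) ^ n)\<^sup>2" by (simp add: power2_eq_square flip: power_mult_distrib)
    finally have "(LINT x|M. \<bar>D n x\<bar>) \<le> (1/2) ^ n" by (simp add: abs_le_square_iff[symmetric] power2_le_iff_abs_le)
    then show ?thesis
      using square_integrable_mult[OF abs one] by (subst nn_integral_eq_integral) (auto intro: ennreal_leI)
  qed
  have "(\<integral>\<^sup>+x. (\<Sum>n. ennreal \<bar>D n x\<bar>) \<partial>M) = (\<Sum>n. \<integral>\<^sup>+x. ennreal \<bar>D n x\<bar> \<partial>M)"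
    by (rule nn_integral_suminf) measurable
  also have "\<dots> \<le> (\<Sum>n. ennreal ((1/2) ^ n))" by (intro suminf_le D1) auto
  also have "\<dots> = ennreal (\<Sum>n. (1/2) ^ n)" by (intro suminf_ennreal2) (auto intro: summable_geometric)
  finally have "(\<integral>\<^sup>+x. (\<Sum>n. ennreal \<bar>D n x\<bar>) \<partial>M) \<noteq> \<infinity>" by (auto simp: top_unique)
  then have "AE x in M. (\<Sum>n. ennreal \<bar>D n x\<bar>) \<noteq> \<infinity>"
    by (intro nn_integral_PInf_AE) measurable
  then have conv: "AE x in M. convergent (\<lambda>n. f n x)"
  proof eventually_elim
    case (elim x)
    then have "summable (\<lambda>n. \<bar>D n x\<bar>)" by (intro summable_suminf_not_top) auto
    then have "summable (\<lambda>n. D n x)" by (rule summable_rabs_cancel)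
    then have "convergent (\<lambda>n. \<Sum>i<n. D i x)" by (simp add: summable_iff_convergent)
    moreover have "(\<Sum>i<n. D i x) = f n x - f 0 x" for n
      unfolding D_def by (rule sum_lessThan_telescope)
    ultimately have "convergent (\<lambda>n. (f n x - f 0 x) + f 0 x)"
      by (intro convergent_add convergent_const) simp
    then show ?case by simp
  qed
  define F where "F x = lim (\<lambda>n. f n x)" for x
  have Fm [measurable]: "F \<in> borel_measurable M" unfolding F_def by (rule borel_measurable_lim_metric) measurable
  have le: "(\<integral>\<^sup>+x. ennreal ((f n x - F x)\<^sup>2) \<partial>M) \<le> ennreal ((1/4) ^ n)" for n
  proof -
    have "(\<integral>\<^sup>+x. ennreal ((f n x - F x)\<^sup>2) \<partial>M) = (\<integral>\<^sup>+x. liminf (\<lambda>m. ennreal ((f n x - f m x)\<^sup>2)) \<partial>M)"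
    proof (rule nn_integral_cong_AE)
      show "AE x in M. ennreal ((f n x - F x)\<^sup>2) = liminf (\<lambda>m. ennreal ((f n x - f m x)\<^sup>2))"
        using conv
      proof eventually_elim
        case (elim x)
        then have "(\<lambda>m. f m x) \<longlonglongrightarrow> F x" unfolding F_def by (simp add: convergent_LIMSEQ_iff)
        then have "(\<lambda>m. ennreal ((f n x - f m x)\<^sup>2)) \<longlonglongrightarrow> ennreal ((f n x - F x)\<^sup>2)"
          by (intro tendsto_intros)
        then show ?case by (metis lim_imp_Liminf trivial_limit_sequentially)
      qed
    qed
    also have "\<dots> \<le> liminf (\<lambda>m. \<integral>\<^sup>+x. ennreal ((f n x - f m x)\<^sup>2) \<partial>M)"
      by (rule nn_integral_liminf) measurable
    also have "\<dots> \<le> limsup (\<lambda>m. \<integral>\<^sup>+x. ennreal ((f n x - f m x)\<^sup>2) \<partial>M)"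
      by (rule Liminf_le_Limsup) simp
    also have "\<dots> \<le> ennreal ((1/4) ^ n)"
    proof (rule Limsup_bounded)
      have "(\<integral>\<^sup>+x. ennreal ((f n x - f m x)\<^sup>2) \<partial>M) \<le> ennreal ((1/4) ^ n)" if "m \<ge> n" for m
        using cauchy[of n n m] that sqd[of n m] unfolding square_integrable_def sq_norm_def
        by (subst nn_integral_eq_integral) (auto intro: ennreal_leI)
      then show "\<forall>\<^sub>F m in sequentially. (\<integral>\<^sup>+x. ennreal ((f n x - f m x)\<^sup>2) \<partial>M) \<le> ennreal ((1/4) ^ n)"
        by (auto simp: eventually_sequentially)
    qed
    finally show ?thesis .
  qed
  have int: "integrable M (\<lambda>x. (f n x - F x)\<^sup>2)" for n
    using le[of n] by (intro integrableI_nonneg) (auto simp: top_unique less_top[symmetric])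
  then have sqF: "square_integrable M (\<lambda>x. f n x - F x)" for n by (simp add: square_integrable_def)
  have "square_integrable M (\<lambda>x. f 0 x - (f 0 x - F x))" by (rule square_integrable_diff[OF sq sqF])
  then have "square_integrable M F" by simp
  moreover have "sq_norm M (\<lambda>x. f n x - F x) \<le> (1/4) ^ n" for n
    using le[of n] int[of n] unfolding sq_norm_def by (simp add: nn_integral_eq_integral)
  ultimately show thesis by (rule that)
qed

context centred_gaussian
begin

lemma cball_sets [simp, measurable]: "cball x r \<in> sets borel" "cball x r \<in> events"
  for x :: 'a by simp_all

lemma measure_shifted_ball:
  assumes f: "bounded_linear f" and h: "R_graph \<gamma> f h"
  shows "emeasure \<gamma> (cball (x - h) r) = (\<integral>\<^sup>+y. indicator (cball x r) y * ennreal (exp (f y - sq_norm \<gamma> f / 2)) \<partial>\<gamma>)"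
proof -
  have "emeasure \<gamma> (cball (x - h) r) = (\<integral>\<^sup>+y. indicator (cball (x - h) r) y \<partial>\<gamma>)" by simp
  also have "\<dots> = (\<integral>\<^sup>+y. indicator (cball x r) (y + h) \<partial>\<gamma>)"
    by (intro nn_integral_cong) (auto simp: indicator_def dist_norm algebra_simps)
  also have "\<dots> = (\<integral>\<^sup>+y. indicator (cball x r) y * ennreal (exp (f y - sq_norm \<gamma> f / 2)) \<partial>\<gamma>)"
    by (rule Cameron_Martin[OF f h]) measurable
  finally show ?thesis .
qed

text \<open>On the ball around \<open>x\<close> the Cameron--Martin density is at least
  \<open>exp (f x - c * r - sq_norm \<gamma> f / 2)\<close>, while the ball shifted by the
  representer is no heavier than the centred one.\<close>

lemma ball_upper_bound:
  assumes f: "bounded_linear f" and c: "\<And>z. \<bar>f z\<bar> \<le> c * norm z" "0 \<le> c"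
  shows "measure \<gamma> (cball x r) \<le> exp (sq_norm \<gamma> f / 2 - f x + c * r) * measure \<gamma> (cball 0 r)"
proof -
  obtain h where h: "R_graph \<gamma> f h" using R_graph_exists[OF square_integrable_linear[OF f]] .
  define e where "e = exp (f x - c * r - sq_norm \<gamma> f / 2)"
  have "emeasure \<gamma> (cball x r) * ennreal e = (\<integral>\<^sup>+y. indicator (cball x r) y * ennreal e \<partial>\<gamma>)"
    by (subst nn_integral_multc) auto
  also have "\<dots> \<le> (\<integral>\<^sup>+y. indicator (cball x r) y * ennreal (exp (f y - sq_norm \<gamma> f / 2)) \<partial>\<gamma>)"
  proof (rule nn_integral_mono)
    fix y
    show "indicator (cball x r) y * ennreal e \<le> indicator (cball x r) y * ennreal (exp (f y - sq_norm \<gamma> f / 2))"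
    proof (cases "y \<in> cball x r")
      case True
      then have "f x - f y \<le> c * r"
        using c(1)[of "x - y"] mult_left_mono[OF _ c(2), of "norm (x - y)" r]
          linear_diff[OF bounded_linear.linear[OF f], of x y] by (simp add: dist_norm)
      then show ?thesis using True by (auto simp: e_def intro!: ennreal_leI)
    qed simp
  qed
  also have "\<dots> = emeasure \<gamma> (cball (x - h) r)" by (rule measure_shifted_ball[OF f h, symmetric])
  also have "\<dots> \<le> emeasure \<gamma> (cball 0 r)" using Anderson_inequality by (simp add: emeasure_eq_measure)
  finally have "measure \<gamma> (cball x r) * e \<le> measure \<gamma> (cball 0 r)"
    by (simp add: emeasure_eq_measure e_def flip: ennreal_mult)
  then have "measure \<gamma> (cball x r) \<le> measure \<gamma> (cball 0 r) / e" by (simp add: e_def field_simps)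
  also have "\<dots> = exp (- (f x - c * r - sq_norm \<gamma> f / 2)) * measure \<gamma> (cball 0 r)"
    unfolding e_def exp_minus by (simp add: field_simps)
  finally show ?thesis by (simp add: algebra_simps)
qed

lemma measure_ball_uminus: "measure \<gamma> (cball (- x) r) = measure \<gamma> (cball x r)"
proof -
  have "measure \<gamma> (cball x r) = measure (distr \<gamma> borel uminus) (cball x r)" by (simp add: distr_uminus)
  also have "\<dots> = measure \<gamma> (uminus -` cball x r \<inter> space \<gamma>)"
    using bounded_linear_measurable'[OF bounded_linear_minus[OF bounded_linear_ident]]
    by (intro measure_distr) auto
  also have "uminus -` cball x r \<inter> space \<gamma> = cball (- x) r"
    by (auto simp: dist_norm) (metis add.commute minus_add_distrib minus_diff_eq norm_minus_cancel diff_minus_eq_add uminus_add_conv_diff)+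
  finally show ?thesis ..
qed

text \<open>The balls around \<open>h\<close> and \<open>- h\<close> have equal mass. Adding their
  Cameron--Martin formulas over the centred ball produces
  \<open>exp (f y) + exp (- f y) \<ge> 2\<close>, so no factor depending on \<open>r\<close> is
  lost.\<close>

lemma ball_lower_bound_dual:
  assumes f: "bounded_linear f" and h: "R_graph \<gamma> f h"
  shows "exp (- sq_norm \<gamma> f / 2) * measure \<gamma> (cball 0 r) \<le> measure \<gamma> (cball h r)"
proof -
  have f': "bounded_linear (\<lambda>x. - f x)" by (rule bounded_linear_minus[OF f])
  have h': "R_graph \<gamma> (\<lambda>x. - f x) (- h)"
    using h by (auto simp: R_graph_def linear_neg bounded_linear.linear)
  have sq: "sq_norm \<gamma> (\<lambda>x. - f x) = sq_norm \<gamma> f" by (simp add: sq_norm_def)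
  have [measurable]: "f \<in> borel_measurable borel" using bounded_linear_measurable[OF f] .
  define e where "e = exp (- sq_norm \<gamma> f / 2)"
  have "ennreal (2 * e * measure \<gamma> (cball 0 r)) = (\<integral>\<^sup>+y. indicator (cball 0 r) y * ennreal (2 * e) \<partial>\<gamma>)"
    by (subst nn_integral_multc)
      (auto simp: emeasure_eq_measure e_def mult.commute simp flip: ennreal_mult)
  also have "\<dots> \<le> (\<integral>\<^sup>+y. indicator (cball 0 r) y * ennreal (exp (f y - sq_norm \<gamma> f / 2)) +
      indicator (cball 0 r) y * ennreal (exp (- f y - sq_norm \<gamma> f / 2)) \<partial>\<gamma>)"
  proof (rule nn_integral_mono)
    fix y
    have "2 * 1 \<le> exp (f y) + exp (- f y)"
      using exp_ge_add_one_self[of "f y"] exp_ge_add_one_self[of "- f y"] by linarith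
    then have "e * 2 \<le> e * (exp (f y) + exp (- f y))" by (intro mult_left_mono) (auto simp: e_def)
    also have "\<dots> = exp (f y - sq_norm \<gamma> f / 2) + exp (- f y - sq_norm \<gamma> f / 2)"
      by (simp add: e_def distrib_left flip: exp_add)
    finally have "2 * e \<le> exp (f y - sq_norm \<gamma> f / 2) + exp (- f y - sq_norm \<gamma> f / 2)" by simp
    then show "indicator (cball 0 r) y * ennreal (2 * e) \<le> indicator (cball 0 r) y * ennreal (exp (f y - sq_norm \<gamma> f / 2)) +
      indicator (cball 0 r) y * ennreal (exp (- f y - sq_norm \<gamma> f / 2))"
      by (auto simp: indicator_def simp flip: ennreal_plus intro!: ennreal_leI)
  qed
  also have "\<dots> = emeasure \<gamma> (cball (0 - h) r) + emeasure \<gamma> (cball (0 - - h) r)"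
    unfolding measure_shifted_ball[OF f h] measure_shifted_ball[OF f' h'] sq
    by (rule nn_integral_add) measurable
  also have "\<dots> = ennreal (2 * measure \<gamma> (cball h r))"
    by (simp add: emeasure_eq_measure measure_ball_uminus flip: ennreal_plus)
  finally have "2 * e * measure \<gamma> (cball 0 r) \<le> 2 * measure \<gamma> (cball h r)"
    by (subst (asm) ennreal_le_iff) auto
  then show ?thesis by (simp add: e_def)
qed

lemma R_graph_norm_le:
  assumes S: "0 < S" "\<And>f c. bounded_linear f \<Longrightarrow> (\<And>x. \<bar>f x\<bar> \<le> c * norm x) \<Longrightarrow> sq_norm \<gamma> f \<le> S * c\<^sup>2"
    and f: "square_integrable \<gamma> f" "R_graph \<gamma> f h" and g: "square_integrable \<gamma> g" "R_graph \<gamma> g k"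
  shows "(norm (h - k))\<^sup>2 \<le> S * sq_norm \<gamma> (\<lambda>x. f x - g x)"
proof -
  obtain l where l: "bounded_linear l" "\<And>x. \<bar>l x\<bar> \<le> norm x" "l (h - k) = norm (h - k)"
    using Hahn_Banach_norm[of "h - k"] by metis
  note ls = square_integrable_linear[OF l(1)]
  have "l h = (LINT x|\<gamma>. f x * l x)" "l k = (LINT x|\<gamma>. g x * l x)"
    using f(2) g(2) l(1) unfolding R_graph_def by blast+
  then have "norm (h - k) = (LINT x|\<gamma>. (f x - g x) * l x)"
    using l(3) square_integrable_mult[OF f(1) ls] square_integrable_mult[OF g(1) ls]
      linear_diff[OF bounded_linear.linear[OF l(1)], of h k] by (simp add: left_diff_distrib)
  then have "(norm (h - k))\<^sup>2 \<le> sq_norm \<gamma> (\<lambda>x. f x - g x) * sq_norm \<gamma> l"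
    using integral_Cauchy_Schwarz[OF square_integrable_diff[OF f(1) g(1)] ls] by simp
  also have "\<dots> \<le> sq_norm \<gamma> (\<lambda>x. f x - g x) * S"
    using S(2)[OF l(1), of 1] l(2) by (intro mult_left_mono sq_norm_nonneg) auto
  finally show ?thesis by (simp add: mult.commute)
qed

text \<open>Closedness of the balls gives continuity from the right; a ball may be enlarged slightly
  and the enlargement removed afterwards.\<close>

lemma ball_radius_continuous:
  "((\<lambda>\<delta>. measure \<gamma> (cball x (r + \<delta>))) \<longlongrightarrow> measure \<gamma> (cball x r)) (at_right 0)"
proof (rule order_tendstoI)
  fix a assume a: "a < measure \<gamma> (cball x r)"
  have "measure \<gamma> (cball x r) \<le> measure \<gamma> (cball x (r + \<delta>))" if "\<delta> > 0" for \<delta>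
    using that by (intro finite_measure_mono) auto
  then show "\<forall>\<^sub>F \<delta> in at_right 0. a < measure \<gamma> (cball x (r + \<delta>))"
    using a by (auto intro!: eventually_at_rightI[of 0 1] less_le_trans[OF a])
next
  fix a assume a: "measure \<gamma> (cball x r) < a"
  have I: "(\<Inter>n. cball x (r + inverse (real (Suc n)))) = cball x r"
  proof safe
    fix y assume y: "y \<in> (\<Inter>n. cball x (r + inverse (real (Suc n))))"
    have "dist x y \<le> r"
    proof (rule field_le_epsilon)
      fix e :: real assume "e > 0"
      then obtain n where n: "inverse (real (Suc n)) < e" using reals_Archimedean by blast
      have "dist x y \<le> r + inverse (real (Suc n))" using y by auto
      then show "dist x y \<le> r + e" using n by linarith
    qed
    then show "y \<in> cball x r" by simp
  next
    fix y n assume "y \<in> cball x r"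
    then show "y \<in> cball x (r + inverse (real (Suc n)))"
      by (simp add: add_increasing2)
  qed
  have "(\<lambda>n. measure \<gamma> (cball x (r + inverse (real (Suc n))))) \<longlonglongrightarrow> measure \<gamma> (cball x r)"
    unfolding I[symmetric]
  proof (rule finite_Lim_measure_decseq)
    show "decseq (\<lambda>n. cball x (r + inverse (real (Suc n))))"
      unfolding decseq_def by (intro allI impI subset_cball) (simp add: field_simps)
  qed auto
  then have "\<forall>\<^sub>F n in sequentially. measure \<gamma> (cball x (r + inverse (real (Suc n)))) < a"
    using a by (rule order_tendstoD)
  then obtain n where n: "measure \<gamma> (cball x (r + inverse (real (Suc n)))) < a"
    by (auto simp: eventually_sequentially)
  have "measure \<gamma> (cball x (r + \<delta>)) < a" if "\<delta> < inverse (real (Suc n))" for \<delta>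
    using that n by (intro le_less_trans[OF finite_measure_mono n]) auto
  then show "\<forall>\<^sub>F \<delta> in at_right 0. measure \<gamma> (cball x (r + \<delta>)) < a"
    by (auto intro!: eventually_at_rightI[of 0 "inverse (real (Suc n))"])
qed

text \<open>The supremum \<open>energy x\<close> is half the squared Cameron--Martin norm of \<open>x\<close>, and a junk value if
  \<open>x\<close> is not in the Cameron--Martin space, where the actions are unbounded.\<close>

definition action :: "'a \<Rightarrow> ('a \<Rightarrow> real) \<Rightarrow> real" where
  "action x f = f x - sq_norm \<gamma> f / 2"

definition energy :: "'a \<Rightarrow> real" where
  "energy x = (SUP f\<in>{f. bounded_linear f}. action x f)"

lemma cameron_martin_square_integrable:
  assumes "F \<in> dual_L2_closure \<gamma>" shows "square_integrable \<gamma> F"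
  using assms by (simp add: dual_L2_closure_def square_integrable_def)

text \<open>Completing the square in L2: the action misses half the squared norm of \<open>F\<close>
  by half the squared distance from \<open>f\<close> to \<open>F\<close>, so approximating
  \<open>F\<close> from the dual space approaches the supremum.\<close>

lemma action_eq:
  assumes F: "square_integrable \<gamma> F" "R_graph \<gamma> F x" and f: "bounded_linear f"
  shows "action x f = sq_norm \<gamma> F / 2 - sq_norm \<gamma> (\<lambda>y. F y - f y) / 2"
proof -
  have "f x = (LINT y|\<gamma>. F y * f y)" using F(2) f unfolding R_graph_def by blast
  then show ?thesis using sq_norm_diff[OF F(1) square_integrable_linear[OF f]]
    by (simp add: action_def diff_divide_distrib add_divide_distrib)
qed

lemma action_bdd_above:
  assumes x: "x \<in> cameron_martin_space \<gamma>"
  shows "bdd_above (action x ` {f. bounded_linear f})"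
proof -
  obtain F where F: "F \<in> dual_L2_closure \<gamma>" "R_graph \<gamma> F x" using x unfolding cameron_martin_space_def by blast
  show ?thesis
    using action_eq[OF cameron_martin_square_integrable[OF F(1)] F(2)] sq_norm_nonneg
    by (intro bdd_aboveI2[where M="sq_norm \<gamma> F / 2"]) auto
qed

text \<open>Extension by density from dual functionals: the representers \<open>h n\<close> of
  functionals approaching \<open>F\<close> converge to \<open>x\<close>, and the ball around
  \<open>h n\<close> eventually lies in the ball around \<open>x\<close> of radius
  \<open>r + \<delta>\<close>. At fixed \<open>r\<close>, first \<open>n\<close> grows, then
  \<open>\<delta>\<close> shrinks.\<close>

lemma ball_lower_bound:
  assumes x: "x \<in> cameron_martin_space \<gamma>"
  shows "exp (- energy x) * measure \<gamma> (cball 0 r) \<le> measure \<gamma> (cball x r)"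
proof -
  obtain S where S: "S > 0" "\<And>f c. bounded_linear f \<Longrightarrow> (\<And>x. \<bar>f x\<bar> \<le> c * norm x) \<Longrightarrow> sq_norm \<gamma> f \<le> S * c\<^sup>2"
    by (rule sq_norm_bound) blast
  obtain F where F: "F \<in> dual_L2_closure \<gamma>" "R_graph \<gamma> F x" using x unfolding cameron_martin_space_def by blast
  note sF = cameron_martin_square_integrable[OF F(1)]
  have "\<exists>f. bounded_linear f \<and> sq_norm \<gamma> (\<lambda>y. F y - f y) < inverse (real (Suc n))" for n
    using F(1) unfolding dual_L2_closure_def sq_norm_def by auto
  then obtain f where f: "\<And>n. bounded_linear (f n)" "\<And>n. sq_norm \<gamma> (\<lambda>y. F y - f n y) < inverse (real (Suc n))"
    by metis
  have lim: "(\<lambda>n. sq_norm \<gamma> (\<lambda>y. F y - f n y)) \<longlonglongrightarrow> 0"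
    using f(2) by (intro tendsto_sandwich[OF _ _ tendsto_const LIMSEQ_inverse_real_of_nat]) (auto simp: sq_norm_nonneg less_imp_le)
  have act: "(\<lambda>n. action x (f n)) \<longlonglongrightarrow> sq_norm \<gamma> F / 2 - 0 / 2"
    unfolding action_eq[OF sF F(2) f(1)] by (intro tendsto_intros lim) auto
  have "action x (f n) \<le> energy x" for n
    unfolding energy_def using action_bdd_above[OF x] f(1) by (intro cSUP_upper) auto
  then have en: "sq_norm \<gamma> F / 2 \<le> energy x" using act by (intro LIMSEQ_le_const2) auto
  have "\<forall>n. \<exists>h. R_graph \<gamma> (f n) h" using R_graph_exists[OF square_integrable_linear[OF f(1)]] by metis
  then obtain h where h: "\<And>n. R_graph \<gamma> (f n) (h n)" by metis
  have nh: "(norm (x - h n))\<^sup>2 \<le> S * sq_norm \<gamma> (\<lambda>y. F y - f n y)" for n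
    by (rule R_graph_norm_le[OF S sF F(2) square_integrable_linear[OF f(1)] h])
  have hx: "(\<lambda>n. norm (x - h n)) \<longlonglongrightarrow> 0"
    by (rule LIMSEQ_zero_of_square_le[OF nh]) (use tendsto_mult[OF tendsto_const[of S] lim] in simp)
  have sqlim: "(\<lambda>n. sq_norm \<gamma> (f n)) \<longlonglongrightarrow> sq_norm \<gamma> F"
  proof -
    define I where "I n = (LINT y|\<gamma>. F y * (F y - f n y))" for n
    note sd = square_integrable_diff[OF sF square_integrable_linear[OF f(1)]]
    have "(I n)\<^sup>2 \<le> sq_norm \<gamma> F * sq_norm \<gamma> (\<lambda>y. F y - f n y)" for n
      unfolding I_def by (rule integral_Cauchy_Schwarz[OF sF sd])
    then have I: "I \<longlonglongrightarrow> 0"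
      by (rule LIMSEQ_zero_of_square_le) (use tendsto_mult[OF tendsto_const[of "sq_norm \<gamma> F"] lim] in simp)
    have "sq_norm \<gamma> (f n) = sq_norm \<gamma> F + sq_norm \<gamma> (\<lambda>y. F y - f n y) - 2 * I n" for n
      using sq_norm_diff[OF sF sd, of n] by (simp add: I_def)
    moreover have "(\<lambda>n. sq_norm \<gamma> F + sq_norm \<gamma> (\<lambda>y. F y - f n y) - 2 * I n) \<longlonglongrightarrow> sq_norm \<gamma> F + 0 - 2 * 0"
      by (intro tendsto_intros lim I)
    ultimately show ?thesis by simp
  qed
  have "exp (- sq_norm \<gamma> F / 2) * measure \<gamma> (cball 0 r) \<le> measure \<gamma> (cball x (r + \<delta>))" if "\<delta> > 0" for \<delta>
  proof (rule LIMSEQ_le_const2)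
    show "(\<lambda>n. exp (- sq_norm \<gamma> (f n) / 2) * measure \<gamma> (cball 0 r)) \<longlonglongrightarrow> exp (- sq_norm \<gamma> F / 2) * measure \<gamma> (cball 0 r)"
      by (intro tendsto_intros sqlim) auto
    have "\<forall>\<^sub>F n in sequentially. norm (x - h n) < \<delta>" using hx that by (rule order_tendstoD)
    then obtain N where N: "\<And>n. n \<ge> N \<Longrightarrow> norm (x - h n) < \<delta>" by (auto simp: eventually_sequentially)
    have "exp (- sq_norm \<gamma> (f n) / 2) * measure \<gamma> (cball 0 r) \<le> measure \<gamma> (cball x (r + \<delta>))" if "n \<ge> N" for n
    proof -
      have "cball (h n) r \<subseteq> cball x (r + \<delta>)"
      proof
        fix y assume "y \<in> cball (h n) r"
        then show "y \<in> cball x (r + \<delta>)"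
          using N[OF that] dist_triangle[of x y "h n"] by (simp add: dist_norm[of x "h n"])
      qed
      then have "measure \<gamma> (cball (h n) r) \<le> measure \<gamma> (cball x (r + \<delta>))" by (intro finite_measure_mono) auto
      then show ?thesis using ball_lower_bound_dual[OF f(1) h, of n r] by linarith
    qed
    then show "\<exists>N. \<forall>n\<ge>N. exp (- sq_norm \<gamma> (f n) / 2) * measure \<gamma> (cball 0 r) \<le> measure \<gamma> (cball x (r + \<delta>))" by blast
  qed
  then have "exp (- sq_norm \<gamma> F / 2) * measure \<gamma> (cball 0 r) \<le> measure \<gamma> (cball x r)"
    by (intro tendsto_lowerbound[OF ball_radius_continuous])
      (auto intro!: eventually_at_rightI[of 0 1])
  moreover have "exp (- energy x) * measure \<gamma> (cball 0 r) \<le> exp (- sq_norm \<gamma> F / 2) * measure \<gamma> (cball 0 r)"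
    using en by (intro mult_right_mono) auto
  ultimately show ?thesis by linarith
qed

text \<open>Riesz representation: a maximising sequence of the strictly concave action is Cauchy, and the
  Euler--Lagrange equation of its limit says that the limit represents \<open>x\<close>.\<close>

lemma cameron_martin_if_action_bdd:
  assumes bdd: "bdd_above (action x ` {f. bounded_linear f})"
  shows "x \<in> cameron_martin_space \<gamma>"
proof -
  have le: "action x f \<le> energy x" if "bounded_linear f" for f
    unfolding energy_def using bdd that by (intro cSUP_upper) auto
  have "\<exists>f. bounded_linear f \<and> energy x - (1/4) ^ n / 8 < action x f" for n :: nat
  proof -
    have "energy x - (1/4) ^ n / 8 < energy x" by simp
    moreover have "{f :: 'a \<Rightarrow> real. bounded_linear f} \<noteq> {}" using bounded_linear_zero by blast
    ultimately show ?thesis unfolding energy_def using less_cSUP_iff[OF _ bdd] by blast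
  qed
  then obtain f where f: "\<And>n. bounded_linear (f n)" "\<And>n. energy x - (1/4) ^ n / 8 < action x (f n)" by metis
  note sf = square_integrable_linear[OF f(1)]
  \<comment> \<open>The action at the average of \<open>f m\<close> and \<open>f n\<close> exceeds
    the average of the actions by an eighth of the squared distance, while both deficits are below
    \<open>(1/4) ^ N / 8\<close>; hence the eighth in the choice of the sequence.\<close>
  have cauchy: "sq_norm \<gamma> (\<lambda>y. f m y - f n y) \<le> (1/4) ^ N" if N: "N \<le> m" "N \<le> n" for N m n
  proof -
    have avg: "bounded_linear (\<lambda>y. (1/2) * (f m y + f n y))"
      by (intro bounded_linear_const_mult bounded_linear_add f)
    have "sq_norm \<gamma> (\<lambda>y. (1/2) * (f m y + f n y)) = (1/2)\<^sup>2 * (sq_norm \<gamma> (f m) + sq_norm \<gamma> (f n) + 2 * (LINT y|\<gamma>. f m y * f n y))"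
      by (simp only: sq_norm_scale sq_norm_add[OF sf sf])
    then have "action x (\<lambda>y. (1/2) * (f m y + f n y)) = (action x (f m) + action x (f n)) / 2 + sq_norm \<gamma> (\<lambda>y. f m y - f n y) / 8"
      unfolding action_def sq_norm_diff[OF sf sf] by (simp add: power2_eq_square field_simps)
    then have "sq_norm \<gamma> (\<lambda>y. f m y - f n y) / 8 \<le> energy x - (action x (f m) + action x (f n)) / 2"
      using le[OF avg] by linarith
    moreover define p where "p k = (1/4 :: real) ^ k" for k
    moreover have "p m \<le> p N" "p n \<le> p N"
      unfolding p_def using N by (auto intro: power_decreasing)
    ultimately show ?thesis
      using f(2)[of m, folded p_def] f(2)[of n, folded p_def] unfolding p_def[symmetric] by argo
  qed
  obtain F where F: "square_integrable \<gamma> F" "\<And>n. sq_norm \<gamma> (\<lambda>y. f n y - F y) \<le> (1/4) ^ n"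
    by (rule L2_complete[OF sf cauchy]) blast+
  have pow: "(\<lambda>n. (1/4 :: real) ^ n) \<longlonglongrightarrow> 0" by (rule LIMSEQ_power_zero) simp
  have lim: "(\<lambda>n. sq_norm \<gamma> (\<lambda>y. f n y - F y)) \<longlonglongrightarrow> 0"
    by (rule tendsto_sandwich[OF _ _ tendsto_const pow]) (auto simp: F sq_norm_nonneg)
  have actlim: "(\<lambda>n. action x (f n)) \<longlonglongrightarrow> energy x"
  proof (rule tendsto_sandwich)
    have "(\<lambda>n. energy x - (1/4) ^ n / 8) \<longlonglongrightarrow> energy x - 0 / 8" by (intro tendsto_intros pow) auto
    then show "(\<lambda>n. energy x - (1/4) ^ n / 8) \<longlonglongrightarrow> energy x" by simp
    show "(\<lambda>n. energy x) \<longlonglongrightarrow> energy x" by simp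
  qed (auto simp: le f less_imp_le)
  have "F \<in> dual_L2_closure \<gamma>"
    unfolding dual_L2_closure_def
  proof (intro CollectI conjI allI impI)
    show "F \<in> borel_measurable \<gamma>" "integrable \<gamma> (\<lambda>x. (F x)\<^sup>2)" using F(1) by (auto simp: square_integrable_def)
    fix e :: real assume "e > 0"
    from order_tendstoD(2)[OF lim this] obtain n where n: "sq_norm \<gamma> (\<lambda>y. f n y - F y) < e"
      by (auto simp: eventually_sequentially)
    have "(LINT y|\<gamma>. (F y - f n y)\<^sup>2) < e" using n by (simp add: sq_norm_def power2_commute)
    then show "\<exists>g. bounded_linear g \<and> (LINT y|\<gamma>. (F y - g y)\<^sup>2) < e" using f(1) by blast
  qed
  moreover have "R_graph \<gamma> F x"
    unfolding R_graph_def
  proof (intro allI impI)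
    fix g :: "'a \<Rightarrow> real" assume g: "bounded_linear g"
    note sg = square_integrable_linear[OF g]
    define I where "I n = (LINT y|\<gamma>. f n y * g y)" for n
    have Ilim: "I \<longlonglongrightarrow> (LINT y|\<gamma>. F y * g y)"
    proof -
      have "(LINT y|\<gamma>. (f n y - F y) * g y) = I n - (LINT y|\<gamma>. F y * g y)" for n
        using square_integrable_mult[OF sf sg, of n] square_integrable_mult[OF F(1) sg]
        by (simp add: I_def left_diff_distrib)
      then have "(I n - (LINT y|\<gamma>. F y * g y))\<^sup>2 \<le> sq_norm \<gamma> (\<lambda>y. f n y - F y) * sq_norm \<gamma> g" for n
        using integral_Cauchy_Schwarz[OF square_integrable_diff[OF sf F(1)] sg, of n] by simp
      then have "(\<lambda>n. I n - (LINT y|\<gamma>. F y * g y)) \<longlonglongrightarrow> 0"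
        by (rule LIMSEQ_zero_of_square_le) (use tendsto_mult[OF lim tendsto_const[of "sq_norm \<gamma> g"]] in simp)
      then show ?thesis by (simp add: LIM_zero_iff)
    qed
    define d where "d = g x - (LINT y|\<gamma>. F y * g y)"
    \<comment> \<open>First variation at the maximiser in the direction \<open>g\<close>: a
      nonnegative quadratic in \<open>t\<close> without constant term has linear coefficient
      0.\<close>
    have "0 \<le> 0 - 2 * t * d + t\<^sup>2 * sq_norm \<gamma> g" for t
    proof -
      have "action x (\<lambda>y. f n y + t * g y) = action x (f n) + t * (g x - I n) - t\<^sup>2 * sq_norm \<gamma> g / 2" for n
        unfolding action_def sq_norm_add[OF sf square_integrable_scale[OF sg]] sq_norm_scale
        by (simp add: I_def mult.left_commute algebra_simps add_divide_distrib)
      moreover have "action x (\<lambda>y. f n y + t * g y) \<le> energy x" for n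
        by (intro le bounded_linear_add bounded_linear_const_mult f g)
      ultimately have "action x (f n) + t * (g x - I n) - t\<^sup>2 * sq_norm \<gamma> g / 2 \<le> energy x" for n by simp
      moreover have "(\<lambda>n. action x (f n) + t * (g x - I n) - t\<^sup>2 * sq_norm \<gamma> g / 2) \<longlonglongrightarrow> energy x + t * d - t\<^sup>2 * sq_norm \<gamma> g / 2"
        unfolding d_def by (intro tendsto_intros actlim Ilim)
      ultimately have "energy x + t * d - t\<^sup>2 * sq_norm \<gamma> g / 2 \<le> energy x" by (intro LIMSEQ_le_const2) auto
      then show ?thesis by simp
    qed
    from nonneg_quadratic_discriminant[OF this sq_norm_nonneg] have "d\<^sup>2 \<le> 0" by simp
    then show "g x = (LINT y|\<gamma>. F y * g y)" by (simp add: d_def)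
  qed
  ultimately show ?thesis unfolding cameron_martin_space_def by blast
qed

end

section \<open>Compactness of heavy balls\<close>

text \<open>Rounding values down to multiples of \<open>e\<close> leaves finitely many patterns on
  \<open>Y\<close>; one element of \<open>A\<close> per pattern forms a net inside \<open>A\<close>.
  It serves both for functionals evaluated at points and for points evaluated under
  functionals.\<close>

lemma finite_rounding:
  fixes v :: "'b \<Rightarrow> 'c \<Rightarrow> real"
  assumes Y: "finite Y" and bd: "\<And>a y. a \<in> A \<Longrightarrow> y \<in> Y \<Longrightarrow> \<bar>v a y\<bar> \<le> R" and e: "0 < e"
  obtains B where "finite B" "B \<subseteq> A" "\<And>a. a \<in> A \<Longrightarrow> \<exists>b\<in>B. \<forall>y\<in>Y. \<bar>v a y - v b y\<bar> \<le> e"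
proof -
  define \<phi> where "\<phi> a = restrict (\<lambda>y. \<lfloor>v a y / e\<rfloor>) Y" for a
  have "\<lfloor>v a y / e\<rfloor> \<in> {\<lfloor>- R / e\<rfloor>..\<lfloor>R / e\<rfloor>}" if "a \<in> A" "y \<in> Y" for a y
  proof -
    have "- R \<le> v a y" "v a y \<le> R" using bd[OF that] by (auto simp: abs_le_iff)
    then have "- R / e \<le> v a y / e" "v a y / e \<le> R / e" using e by (auto intro: divide_right_mono simp del: divide_minus_left)
    then show ?thesis by (auto intro!: floor_mono simp del: divide_minus_left)
  qed
  then have "\<phi> ` A \<subseteq> PiE Y (\<lambda>_. {\<lfloor>- R / e\<rfloor>..\<lfloor>R / e\<rfloor>})" by (auto simp: \<phi>_def)
  moreover have "finite (PiE Y (\<lambda>_. {\<lfloor>- R / e\<rfloor>..\<lfloor>R / e\<rfloor>}))" using Y by (intro finite_PiE) auto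
  ultimately have fin: "finite (\<phi> ` A)" by (rule finite_subset)
  define B where "B = inv_into A \<phi> ` (\<phi> ` A)"
  show thesis
  proof (rule that)
    show "finite B" using fin by (simp add: B_def)
    show "B \<subseteq> A" by (auto simp: B_def inv_into_into)
    fix a assume a: "a \<in> A"
    define b where "b = inv_into A \<phi> (\<phi> a)"
    have "\<phi> b = \<phi> a" unfolding b_def using a by (intro f_inv_into_f) auto
    have "\<bar>v a y - v b y\<bar> \<le> e" if y: "y \<in> Y" for y
    proof -
      have "\<lfloor>v b y / e\<rfloor> = \<lfloor>v a y / e\<rfloor>" using fun_cong[OF \<open>\<phi> b = \<phi> a\<close>, of y] y by (simp add: \<phi>_def)
      then have "\<bar>v a y / e - v b y / e\<bar> \<le> 1" by linarith
      then have "\<bar>(v a y - v b y) / e\<bar> \<le> 1" by (simp add: diff_divide_distrib)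
      then show ?thesis using e by (simp add: abs_divide pos_divide_le_eq)
    qed
    moreover have "b \<in> B" using a by (auto simp: B_def b_def)
    ultimately show "\<exists>b\<in>B. \<forall>y\<in>Y. \<bar>v a y - v b y\<bar> \<le> e" by blast
  qed
qed

context centred_gaussian
begin

text \<open>On a compact set of mass at least one half the unit ball of the dual space is equicontinuous, and a
  uniform bound on such a set controls the variance of a Gaussian variable.\<close>

lemma dual_unit_ball_net:
  assumes s: "s > 0"
  obtains G where "finite G" "\<And>g. g \<in> G \<Longrightarrow> bounded_linear g" "\<And>g x. g \<in> G \<Longrightarrow> \<bar>g x\<bar> \<le> norm x"
    "\<And>g. bounded_linear g \<Longrightarrow> (\<And>x. \<bar>g x\<bar> \<le> norm x) \<Longrightarrow> \<exists>g'\<in>G. sq_norm \<gamma> (\<lambda>x. g x - g' x) \<le> s\<^sup>2"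
proof -
  obtain K where K: "compact K" "1/2 \<le> measure \<gamma> K" by (rule half_compact)
  \<comment> \<open>Matched functionals differ by at most \<open>3 * e\<close> on \<open>K\<close>,
    and the variance bound doubles this, giving \<open>s\<close>.\<close>
  define e where "e = s / 6"
  have e: "e > 0" using s by (simp add: e_def)
  obtain Y where Y: "finite Y" "K \<subseteq> (\<Union>y\<in>Y. ball y e)"
    using K(1) e unfolding compact_eq_totally_bounded by blast
  define A where "A = {g :: 'a \<Rightarrow> real. bounded_linear g \<and> (\<forall>x. \<bar>g x\<bar> \<le> norm x)}"
  have bd: "\<bar>g y\<bar> \<le> (\<Sum>y\<in>Y. norm y)" if "g \<in> A" "y \<in> Y" for g y
  proof -
    have "\<bar>g y\<bar> \<le> norm y" using that by (auto simp: A_def)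
    also have "\<dots> \<le> (\<Sum>y\<in>Y. norm y)" using Y(1) that by (intro member_le_sum) auto
    finally show ?thesis .
  qed
  obtain G where G: "finite G" "G \<subseteq> A" "\<And>g. g \<in> A \<Longrightarrow> \<exists>g'\<in>G. \<forall>y\<in>Y. \<bar>g y - g' y\<bar> \<le> e"
    by (rule finite_rounding[where v="\<lambda>g y. g y" and A=A and Y=Y and R="\<Sum>y\<in>Y. norm y" and e=e, OF Y(1)])
      (use bd e in auto)
  show thesis
  proof (rule that[OF G(1)])
    show "bounded_linear g" "\<bar>g x\<bar> \<le> norm x" if "g \<in> G" for g x using that G(2) by (auto simp: A_def)
    fix g :: "'a \<Rightarrow> real" assume g: "bounded_linear g" "\<And>x. \<bar>g x\<bar> \<le> norm x"
    then have "g \<in> A" by (simp add: A_def)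
    then obtain g' where g': "g' \<in> G" "\<And>y. y \<in> Y \<Longrightarrow> \<bar>g y - g' y\<bar> \<le> e" using G(3) by blast
    have l': "bounded_linear g'" "\<And>x. \<bar>g' x\<bar> \<le> norm x" using g'(1) G(2) by (auto simp: A_def)
    have "sq_norm \<gamma> (\<lambda>x. g x - g' x) \<le> (2 * (3 * e))\<^sup>2"
    proof (rule sq_norm_le_of_bound[OF bounded_linear_sub[OF g(1) l'(1)] _ K(2)])
      show "K \<in> sets borel" using K(1) by (simp add: compact_imp_closed borel_closed)
      fix x assume "x \<in> K"
      then obtain y where y: "y \<in> Y" "dist y x < e" using Y(2) by auto
      have "\<bar>g (x - y)\<bar> \<le> e" "\<bar>g' (x - y)\<bar> \<le> e"
        using g(2)[of "x - y"] l'(2)[of "x - y"] y(2) by (simp_all add: dist_norm norm_minus_commute)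
      then have "\<bar>g x - g y\<bar> \<le> e" "\<bar>g' x - g' y\<bar> \<le> e"
        using linear_diff[OF bounded_linear.linear[OF g(1)]] linear_diff[OF bounded_linear.linear[OF l'(1)]] by simp_all
      then show "\<bar>g x - g' x\<bar> \<le> 3 * e" using g'(2)[OF y(1)] by linarith
    qed
    also have "2 * (3 * e) = s" by (simp add: e_def)
    finally show "\<exists>g'\<in>G. sq_norm \<gamma> (\<lambda>x. g x - g' x) \<le> s\<^sup>2" using g'(1) by blast
  qed
qed

text \<open>The scale \<open>a\<close> is free: the upper ball bound for \<open>a * l\<close>, set
  against heaviness, is solved for \<open>l x\<close>. Scale 1 bounds the centres in norm; scale
  \<open>1 / s\<close> turns a variance \<open>s\<^sup>2\<close> into a bound of order
  \<open>s\<close>, up to the vanishing term \<open>c * r\<close>.\<close>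

lemma functional_bound_of_heavy_ball:
  assumes pos: "0 < measure \<gamma> (cball 0 r)" and heavy: "exp (- C) * measure \<gamma> (cball 0 r) \<le> measure \<gamma> (cball x r)"
    and k: "bounded_linear k" "\<And>z. \<bar>k z\<bar> \<le> c * norm z" "0 \<le> c" "sq_norm \<gamma> k \<le> v" and a: "0 < a"
  shows "\<bar>k x\<bar> \<le> C / a + a * v / 2 + c * r"
proof -
  have *: "l x \<le> C / a + a * v / 2 + c * r"
    if l: "bounded_linear l" "\<And>z. \<bar>l z\<bar> \<le> c * norm z" "sq_norm \<gamma> l \<le> v" for l
  proof -
    have "measure \<gamma> (cball x r) \<le> exp (sq_norm \<gamma> (\<lambda>z. a * l z) / 2 - a * l x + (a * c) * r) * measure \<gamma> (cball 0 r)"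
      using l(2) a k(3)
      by (intro ball_upper_bound bounded_linear_const_mult l) (auto simp: abs_mult mult.assoc)
    then have "exp (- C) * measure \<gamma> (cball 0 r) \<le> exp (sq_norm \<gamma> (\<lambda>z. a * l z) / 2 - a * l x + (a * c) * r) * measure \<gamma> (cball 0 r)"
      using heavy by linarith
    then have "- C \<le> sq_norm \<gamma> (\<lambda>z. a * l z) / 2 - a * l x + (a * c) * r" using pos by simp
    then have "a * l x \<le> C + a\<^sup>2 * sq_norm \<gamma> l / 2 + a * c * r" by (simp add: sq_norm_scale)
    also have "\<dots> \<le> C + a\<^sup>2 * v / 2 + a * c * r"
      using mult_left_mono[OF l(3), of "a\<^sup>2"] by simp
    also have "\<dots> = a * (C / a + a * v / 2 + c * r)" using a by (simp add: field_simps power2_eq_square)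
    finally show ?thesis using a by simp
  qed
  have "- k x \<le> C / a + a * v / 2 + c * r"
    using k by (intro *[of "\<lambda>z. - k z"]) (auto intro: bounded_linear_minus simp: sq_norm_def)
  then show ?thesis using *[OF k(1,2,4)] by linarith
qed

text \<open>A net of the dual unit ball that is fine in L2 reduces norm distances of centres to
  finitely many bounded coordinates: a norming functional differs from its net element by a
  functional of small variance, and such a functional is small at all centres with small
  radius.\<close>

proposition heavy_balls_precompact:
  fixes x :: "nat \<Rightarrow> 'a"
  assumes r: "\<And>n. 0 < r n" "r \<longlonglongrightarrow> 0" and pos: "\<And>n. 0 < measure \<gamma> (cball 0 (r n))"
    and heavy: "\<And>n. exp (- C) * measure \<gamma> (cball 0 (r n)) \<le> measure \<gamma> (cball (x n) (r n))"
  obtains l s where "strict_mono (s :: nat \<Rightarrow> nat)" "(x \<circ> s) \<longlonglongrightarrow> l"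
proof -
  obtain S where S: "S > 0" "\<And>f c. bounded_linear f \<Longrightarrow> (\<And>x. \<bar>f x\<bar> \<le> c * norm x) \<Longrightarrow> sq_norm \<gamma> f \<le> S * c\<^sup>2"
    by (rule sq_norm_bound) blast
  obtain Q where "\<forall>n. norm (r n) \<le> Q"
    using convergent_imp_Bseq[OF convergentI[OF r(2)]] unfolding Bseq_def by blast
  then have Q: "r n \<le> Q" for n by (simp add: abs_le_iff)
  have norm_x: "norm (x n) \<le> C + S / 2 + Q" for n
  proof -
    obtain g where g: "bounded_linear g" "\<And>z. \<bar>g z\<bar> \<le> norm z" "g (x n) = norm (x n)"
      using Hahn_Banach_norm[of "x n"] by metis
    have "\<bar>g (x n)\<bar> \<le> C / 1 + 1 * S / 2 + 1 * r n"
      using g S(2)[OF g(1), of 1] by (intro functional_bound_of_heavy_ball[OF pos heavy]) auto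
    then show ?thesis using g(3) Q[of n] by simp
  qed
  have tb: "\<exists>k. finite k \<and> range x \<subseteq> (\<Union>y\<in>k. ball y (6 * e))" if e: "e > 0" for e
  proof -
    \<comment> \<open>With scale \<open>1 / s\<close> the functional bound contains
      \<open>C * s + s / 2\<close>, which this choice keeps at most \<open>e\<close>.\<close>
    define s where "s = e / (\<bar>C\<bar> + 1)"
    have s: "s > 0" using e by (auto simp: s_def)
    have Cs: "C * s + s / 2 \<le> e"
    proof -
      have "C * s \<le> \<bar>C\<bar> * s" using s by (intro mult_right_mono) auto
      then have "C * s + s / 2 \<le> (\<bar>C\<bar> + 1) * s" using s unfolding distrib_right by linarith
      also have "\<dots> = e" by (simp add: s_def)
      finally show ?thesis .
    qed
    obtain G where G: "finite G" "\<And>g. g \<in> G \<Longrightarrow> bounded_linear g" "\<And>g x. g \<in> G \<Longrightarrow> \<bar>g x\<bar> \<le> norm x"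
      "\<And>g. bounded_linear g \<Longrightarrow> (\<And>x. \<bar>g x\<bar> \<le> norm x) \<Longrightarrow> \<exists>g'\<in>G. sq_norm \<gamma> (\<lambda>x. g x - g' x) \<le> s\<^sup>2"
      by (rule dual_unit_ball_net[OF s]) blast
    have "\<forall>\<^sub>F n in sequentially. r n < e / 2" using r(2) e by (intro order_tendstoD) auto
    then obtain N where N: "\<And>n. n \<ge> N \<Longrightarrow> r n < e / 2" by (auto simp: eventually_sequentially)
    have bd: "\<bar>g (x n)\<bar> \<le> C + S / 2 + Q" if "n \<in> {N..}" "g \<in> G" for n g
      using G(3)[OF that(2), of "x n"] norm_x[of n] by linarith
    obtain B where B: "finite B" "B \<subseteq> {N..}" "\<And>n. n \<in> {N..} \<Longrightarrow> \<exists>m\<in>B. \<forall>g\<in>G. \<bar>g (x n) - g (x m)\<bar> \<le> e"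
      by (rule finite_rounding[where v="\<lambda>n g. g (x n)" and A="{N..}" and Y=G and R="C + S / 2 + Q" and e=e, OF G(1)])
        (use bd e in auto)
    have close: "\<exists>m\<in>B. norm (x n - x m) < 6 * e" if n: "n \<ge> N" for n
    proof -
      obtain m where m: "m \<in> B" "\<And>g. g \<in> G \<Longrightarrow> \<bar>g (x n) - g (x m)\<bar> \<le> e" using B(3)[of n] n by auto
      have mN: "m \<ge> N" using m(1) B(2) by auto
      obtain g where g: "bounded_linear g" "\<And>z. \<bar>g z\<bar> \<le> norm z" "g (x n - x m) = norm (x n - x m)"
        using Hahn_Banach_norm[of "x n - x m"] by metis
      obtain g' where g': "g' \<in> G" "sq_norm \<gamma> (\<lambda>x. g x - g' x) \<le> s\<^sup>2" using G(4)[OF g(1,2)] by blast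
      have k: "\<bar>g (x i) - g' (x i)\<bar> \<le> 2 * e" if i: "i \<ge> N" for i
      proof -
        have b2: "\<bar>g z - g' z\<bar> \<le> 2 * norm z" for z using g(2)[of z] G(3)[OF g'(1), of z] by linarith
        have "\<bar>g (x i) - g' (x i)\<bar> \<le> C / (1 / s) + (1 / s) * s\<^sup>2 / 2 + 2 * r i"
          using s g' b2 by (intro functional_bound_of_heavy_ball[OF pos heavy] bounded_linear_sub g G) auto
        also have "C / (1 / s) + (1 / s) * s\<^sup>2 / 2 + 2 * r i = C * s + s / 2 + 2 * r i"
          using s by (simp add: power2_eq_square)
        finally show ?thesis using Cs N[OF i] by linarith
      qed
      have "norm (x n - x m) = g (x n) - g (x m)"
        using g linear_diff[OF bounded_linear.linear[OF g(1)]] by simp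
      \<comment> \<open>Replacing \<open>g\<close> by its net element costs \<open>2 * e\<close> at
        each centre, and the net coordinates differ by at most \<open>e\<close>.\<close>
      then have "norm (x n - x m) \<le> 5 * e" using k[OF n] k[OF mN] m(2)[OF g'(1)] by linarith
      then show ?thesis using m(1) e by (intro bexI[of _ m]) auto
    qed
    have "range x \<subseteq> (\<Union>y\<in>x ` (B \<union> {..<N}). ball y (6 * e))"
    proof (rule image_subsetI)
      fix n
      show "x n \<in> (\<Union>y\<in>x ` (B \<union> {..<N}). ball y (6 * e))"
      proof (cases "n < N")
        case True
        then show ?thesis using e by (intro UN_I[of "x n"]) auto
      next
        case False
        then obtain m where "m \<in> B" "norm (x n - x m) < 6 * e" using close[of n] by auto
        then show ?thesis by (intro UN_I[of "x m"]) (auto simp: dist_norm norm_minus_commute)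
      qed
    qed
    then show ?thesis using B(1) by (intro exI[of _ "x ` (B \<union> {..<N})"]) auto
  qed
  have "compact (closure (range x))"
    unfolding compact_eq_totally_bounded
  proof (intro conjI allI impI, goal_cases)
    case 1
    then show ?case by (simp add: complete_eq_closed)
  next
    case e: (2 e)
    then obtain k where k: "finite k" "range x \<subseteq> (\<Union>y\<in>k. ball y (e / 2))" using tb[of "e / 12"] by auto
    have "(\<Union>y\<in>k. ball y (e / 2)) \<subseteq> (\<Union>y\<in>k. cball y (e / 2))" by (intro UN_mono ball_subset_cball order_refl)
    with k(2) have "range x \<subseteq> (\<Union>y\<in>k. cball y (e / 2))" by (rule order_trans)
    then have "closure (range x) \<subseteq> (\<Union>y\<in>k. cball y (e / 2))"
      by (rule closure_minimal) (use k(1) in \<open>auto intro: closed_UN\<close>)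
    also have "\<dots> \<subseteq> (\<Union>y\<in>k. ball y e)" using e by (intro UN_mono order_refl) auto
    finally show ?case using k(1) by blast
  qed
  then have "seq_compact (closure (range x))" by (rule compact_imp_seq_compact)
  moreover have "\<forall>n. x n \<in> closure (range x)" using closure_subset[of "range x"] by blast
  ultimately obtain l s where "strict_mono s" "(x \<circ> s) \<longlonglongrightarrow> l" by (rule seq_compactE)
  then show thesis by (rule that)
qed

end

section \<open>Modes of the tilted measure\<close>

locale tilted_gaussian = centred_gaussian +
  fixes \<Phi> :: "'a \<Rightarrow> real"
  assumes nondeg: "nondegenerate \<gamma>" and cont: "continuous_on UNIV \<Phi>"
    and prob_tilted: "prob_space (density \<gamma> (\<lambda>x. ennreal (exp (- \<Phi> x))))"
    and growth: "\<And>\<eta>. \<eta> > 0 \<Longrightarrow> \<exists>K. \<forall>x. \<Phi> x \<ge> K - \<eta> * (norm x)\<^sup>2"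
begin

definition \<mu> :: "'a measure" where
  "\<mu> = density \<gamma> (\<lambda>x. ennreal (exp (- \<Phi> x)))"

abbreviation b :: "real \<Rightarrow> real" where
  "b r \<equiv> measure \<gamma> (cball 0 r)"

abbreviation E :: "'a set" where
  "E \<equiv> cameron_martin_space \<gamma>"

text \<open>The limit of \<open>measure \<mu> (cball x r) / b r\<close> as \<open>r\<close> tends to zero.\<close>

definition weight :: "'a \<Rightarrow> real" where
  "weight x = (if x \<in> E then exp (- \<Phi> x - energy x) else 0)"

sublocale tilted: prob_space \<mu>
  using prob_tilted by (simp add: \<mu>_def)

lemma \<Phi>_measurable [measurable]: "\<Phi> \<in> borel_measurable borel"
  using cont by (rule borel_measurable_continuous_onI)

lemma tilted_sets [simp, measurable_cong]: "sets \<mu> = sets borel"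
  by (simp add: \<mu>_def)

lemma tilted_emeasure:
  "A \<in> sets borel \<Longrightarrow> emeasure \<mu> A = (\<integral>\<^sup>+x. ennreal (exp (- \<Phi> x)) * indicator A x \<partial>\<gamma>)"
  unfolding \<mu>_def by (rule emeasure_density) auto

lemma tilted_le:
  assumes A: "A \<in> sets borel" and L: "\<And>x. x \<in> A \<Longrightarrow> L \<le> \<Phi> x"
  shows "measure \<mu> A \<le> exp (- L) * measure \<gamma> A"
proof -
  have "emeasure \<mu> A \<le> (\<integral>\<^sup>+x. ennreal (exp (- L)) * indicator A x \<partial>\<gamma>)"
    unfolding tilted_emeasure[OF A] using L by (intro nn_integral_mono) (auto simp: indicator_def intro!: ennreal_leI)
  also have "\<dots> = ennreal (exp (- L)) * emeasure \<gamma> A" using A by (intro nn_integral_cmult_indicator) simp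
  finally show ?thesis by (simp add: emeasure_eq_measure tilted.emeasure_eq_measure flip: ennreal_mult)
qed

lemma tilted_ge:
  assumes A: "A \<in> sets borel" and L: "\<And>x. x \<in> A \<Longrightarrow> \<Phi> x \<le> L"
  shows "exp (- L) * measure \<gamma> A \<le> measure \<mu> A"
proof -
  have "ennreal (exp (- L)) * emeasure \<gamma> A = (\<integral>\<^sup>+x. ennreal (exp (- L)) * indicator A x \<partial>\<gamma>)"
    using A by (intro nn_integral_cmult_indicator[symmetric]) simp
  also have "\<dots> \<le> emeasure \<mu> A"
    unfolding tilted_emeasure[OF A] using L by (intro nn_integral_mono) (auto simp: indicator_def intro!: ennreal_leI)
  finally show ?thesis by (simp add: emeasure_eq_measure tilted.emeasure_eq_measure flip: ennreal_mult)
qed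

lemma ball_pos: "r > 0 \<Longrightarrow> 0 < measure \<gamma> (cball x r)"
  using nondeg by (auto simp: nondegenerate_def msupport_def)

lemma \<Phi>_near:
  assumes "\<delta> > 0"
  obtains d where "d > 0" "\<And>y. dist x y < d \<Longrightarrow> \<bar>\<Phi> y - \<Phi> x\<bar> < \<delta>"
proof -
  have "isCont \<Phi> x" using cont by (simp add: continuous_on_eq_continuous_at)
  then show thesis
    using that assms unfolding continuous_at_eps_delta by (metis dist_commute dist_real_def)
qed

lemma tilted_ball_pos:
  assumes "r > 0" shows "0 < measure \<mu> (cball x r)"
proof -
  obtain d where d: "d > 0" "\<And>y. dist x y < d \<Longrightarrow> \<bar>\<Phi> y - \<Phi> x\<bar> < 1" using \<Phi>_near[of 1 x] by auto
  define s where "s = min r (d / 2)"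
  have s: "s > 0" "s \<le> r" "s < d" using assms d(1) by (auto simp: s_def)
  have "\<Phi> y \<le> \<Phi> x + 1" if "y \<in> cball x s" for y
    using d(2)[of y] that s(3) by fastforce
  then have "exp (- (\<Phi> x + 1)) * measure \<gamma> (cball x s) \<le> measure \<mu> (cball x s)" by (intro tilted_ge) auto
  moreover have "0 < exp (- (\<Phi> x + 1)) * measure \<gamma> (cball x s)" using ball_pos[OF s(1)] by simp
  moreover have "measure \<mu> (cball x s) \<le> measure \<mu> (cball x r)"
    using s(2) by (intro tilted.finite_measure_mono) auto
  ultimately show ?thesis by linarith
qed

lemma tilted_support: "x \<in> msupport \<mu>"
  using tilted_ball_pos by (simp add: msupport_def)

lemma weight_nonneg: "0 \<le> weight x" by (simp add: weight_def)

text \<open>The centres may move and \<open>l\<close> may lie outside \<open>E\<close>: one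
  functional almost optimal for \<open>l\<close> is fixed, and its bound is continuous in centre and
  radius. Outside \<open>E\<close> the weight is 0, and the unbounded actions supply a functional
  for every \<open>e > 0\<close>.\<close>

lemma weight_upper:
  assumes r: "\<And>n. 0 < r n" "r \<longlonglongrightarrow> 0" and x: "x \<longlonglongrightarrow> l" and e: "weight l < e"
  shows "\<forall>\<^sub>F n in sequentially. measure \<mu> (cball (x n) (r n)) \<le> e * b (r n)"
proof -
  have epos: "e > 0" using e weight_nonneg[of l] by linarith
  have "\<exists>f. bounded_linear f \<and> - \<Phi> l - ln e < action l f"
  proof (cases "l \<in> E")
    case True
    have "exp (- \<Phi> l - energy l) < exp (ln e)" using e epos True by (simp add: weight_def)
    then have "- \<Phi> l - ln e < energy l" by simp
    moreover have "{f :: 'a \<Rightarrow> real. bounded_linear f} \<noteq> {}" using bounded_linear_zero by blast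
    ultimately show ?thesis
      unfolding energy_def using less_cSUP_iff[OF _ action_bdd_above[OF True]] by blast
  next
    case False
    then have "\<not> bdd_above (action l ` {f. bounded_linear f})" using cameron_martin_if_action_bdd by blast
    then show ?thesis unfolding bdd_above_def by (auto simp: not_le)
  qed
  then obtain f where f: "bounded_linear f" "- \<Phi> l - ln e < action l f" by blast
  \<comment> \<open>Half of the slack pays for the oscillation of \<open>\<Phi>\<close>, half for
    the variation of the exponent along the sequence.\<close>
  define \<delta> where "\<delta> = (\<Phi> l + ln e + action l f) / 2"
  have \<delta>: "\<delta> > 0" using f(2) by (simp add: \<delta>_def)
  obtain c where c: "\<And>z. \<bar>f z\<bar> \<le> c * norm z" "0 \<le> c"
    using bounded_linear.nonneg_bounded[OF f(1)] by (auto simp: mult.commute)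
  obtain d where d: "d > 0" "\<And>y. dist l y < d \<Longrightarrow> \<bar>\<Phi> y - \<Phi> l\<bar> < \<delta>" using \<Phi>_near[OF \<delta>] by blast
  have "(\<lambda>n. dist (x n) l + r n) \<longlonglongrightarrow> dist l l + 0" by (intro tendsto_intros x r)
  then have ev1: "\<forall>\<^sub>F n in sequentially. dist (x n) l + r n < d" using d(1) by (intro order_tendstoD) auto
  have "(\<lambda>n. sq_norm \<gamma> f / 2 - f (x n) + c * r n) \<longlonglongrightarrow> sq_norm \<gamma> f / 2 - f l + c * 0"
    by (intro tendsto_intros r bounded_linear.tendsto[OF f(1)] x)
  moreover have "sq_norm \<gamma> f / 2 - f l + c * 0 < - action l f + \<delta>" using \<delta> by (simp add: action_def)
  ultimately have ev2: "\<forall>\<^sub>F n in sequentially. sq_norm \<gamma> f / 2 - f (x n) + c * r n < - action l f + \<delta>"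
    by (rule order_tendstoD)
  show ?thesis
    using ev1 ev2
  proof eventually_elim
    case (elim n)
    have "\<Phi> l - \<delta> \<le> \<Phi> y" if "y \<in> cball (x n) (r n)" for y
    proof -
      have "dist l y < d" using elim(1) that dist_triangle[of l y "x n"] by (simp add: dist_commute)
      from d(2)[OF this] show ?thesis by linarith
    qed
    then have "measure \<mu> (cball (x n) (r n)) \<le> exp (- (\<Phi> l - \<delta>)) * measure \<gamma> (cball (x n) (r n))"
      by (intro tilted_le) auto
    also have "\<dots> \<le> exp (- (\<Phi> l - \<delta>)) * (exp (sq_norm \<gamma> f / 2 - f (x n) + c * r n) * b (r n))"
      by (intro mult_left_mono ball_upper_bound f c) auto
    also have "\<dots> = exp (- (\<Phi> l - \<delta>) + (sq_norm \<gamma> f / 2 - f (x n) + c * r n)) * b (r n)"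
      by (simp only: exp_add mult.assoc)
    also have "\<dots> \<le> exp (ln e) * b (r n)"
    proof (intro mult_right_mono)
      have "- (\<Phi> l - \<delta>) + (sq_norm \<gamma> f / 2 - f (x n) + c * r n) \<le> ln e" using elim(2) unfolding \<delta>_def by argo
      then show "exp (- (\<Phi> l - \<delta>) + (sq_norm \<gamma> f / 2 - f (x n) + c * r n)) \<le> exp (ln e)" by simp
    qed simp
    finally show ?case using epos by simp
  qed
qed

lemma weight_lower:
  assumes r: "\<And>n. 0 < r n" "r \<longlonglongrightarrow> 0" and e: "e < weight x"
  shows "\<forall>\<^sub>F n in sequentially. e * b (r n) \<le> measure \<mu> (cball x (r n))"
proof (cases "e \<le> 0")
  case True
  have "e * b (r n) \<le> 0" for n using True by (intro mult_nonpos_nonneg) auto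
  then have "e * b (r n) \<le> measure \<mu> (cball x (r n))" for n using measure_nonneg order_trans by blast
  then show ?thesis by simp
next
  case False
  then have xE: "x \<in> E" using e by (auto simp: weight_def split: if_splits)
  define \<delta> where "\<delta> = - \<Phi> x - energy x - ln e"
  have "exp (ln e) < exp (- \<Phi> x - energy x)" using e xE False by (simp add: weight_def)
  then have \<delta>: "\<delta> > 0" by (simp add: \<delta>_def)
  obtain d where d: "d > 0" "\<And>y. dist x y < d \<Longrightarrow> \<bar>\<Phi> y - \<Phi> x\<bar> < \<delta>" using \<Phi>_near[OF \<delta>] by blast
  have "\<forall>\<^sub>F n in sequentially. r n < d" using r(2) d(1) by (rule order_tendstoD)
  then show ?thesis
  proof eventually_elim
    case (elim n)
    have "\<Phi> y \<le> \<Phi> x + \<delta>" if "y \<in> cball x (r n)" for y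
    proof -
      have "dist x y < d" using that elim by simp
      from d(2)[OF this] show ?thesis by linarith
    qed
    then have ge: "exp (- (\<Phi> x + \<delta>)) * measure \<gamma> (cball x (r n)) \<le> measure \<mu> (cball x (r n))"
      by (intro tilted_ge) auto
    have "e * b (r n) = exp (- (\<Phi> x + \<delta>)) * (exp (- energy x) * b (r n))"
      using False by (simp add: \<delta>_def flip: exp_add mult.assoc)
    also have "\<dots> \<le> exp (- (\<Phi> x + \<delta>)) * measure \<gamma> (cball x (r n))"
      by (intro mult_left_mono ball_lower_bound xE) auto
    finally show ?case using ge by linarith
  qed
qed

lemma weight_limit:
  assumes r: "\<And>n. 0 < r n" "r \<longlonglongrightarrow> 0"
  shows "(\<lambda>n. measure \<mu> (cball x (r n)) / b (r n)) \<longlonglongrightarrow> weight x"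
proof (rule order_tendstoI)
  fix e assume "e < weight x"
  then obtain e' where e': "e < e'" "e' < weight x" using dense by blast
  show "\<forall>\<^sub>F n in sequentially. e < measure \<mu> (cball x (r n)) / b (r n)"
    using weight_lower[OF r e'(2)]
  proof eventually_elim
    case (elim n)
    then have "e' \<le> measure \<mu> (cball x (r n)) / b (r n)" using ball_pos[OF r(1)] by (simp add: pos_le_divide_eq)
    then show ?case using e'(1) by linarith
  qed
next
  fix e assume "weight x < e"
  then obtain e' where e': "weight x < e'" "e' < e" using dense by blast
  show "\<forall>\<^sub>F n in sequentially. measure \<mu> (cball x (r n)) / b (r n) < e"
    using weight_upper[OF r tendsto_const e'(1)]
  proof eventually_elim
    case (elim n)
    then have "measure \<mu> (cball x (r n)) / b (r n) \<le> e'" using ball_pos[OF r(1)] by (simp add: pos_divide_le_eq)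
    then show ?case using e'(2) by linarith
  qed
qed

lemma gaussian_decay:
  obtains S where "S > 0" "\<And>x r. measure \<gamma> (cball x r) \<le> exp (- (norm x)\<^sup>2 / (2 * S) + norm x * r / S) * b r"
proof -
  obtain S where S: "S > 0" "\<And>f c. bounded_linear f \<Longrightarrow> (\<And>x. \<bar>f x\<bar> \<le> c * norm x) \<Longrightarrow> sq_norm \<gamma> f \<le> S * c\<^sup>2"
    by (rule sq_norm_bound) blast
  have "measure \<gamma> (cball x r) \<le> exp (- (norm x)\<^sup>2 / (2 * S) + norm x * r / S) * b r" for x r
  proof -
    obtain g where g: "bounded_linear g" "\<And>z. \<bar>g z\<bar> \<le> norm z" "g x = norm x"
      using Hahn_Banach_norm[of x] by metis
    \<comment> \<open>This multiple minimises \<open>S * a\<^sup>2 / 2 - a * norm x\<close>.\<close>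
    define a where "a = norm x / S"
    have a: "a \<ge> 0" using S(1) by (simp add: a_def)
    have bd: "\<bar>a * g z\<bar> \<le> a * norm z" for z using a g(2)[of z] by (simp add: abs_mult mult_left_mono)
    have l: "bounded_linear (\<lambda>z. a * g z)" by (rule bounded_linear_const_mult[OF g(1)])
    have "measure \<gamma> (cball x r) \<le> exp (sq_norm \<gamma> (\<lambda>z. a * g z) / 2 - a * g x + a * r) * b r"
      by (rule ball_upper_bound[OF l bd a])
    also have "\<dots> \<le> exp (- (norm x)\<^sup>2 / (2 * S) + norm x * r / S) * b r"
    proof (intro mult_right_mono)
      have "sq_norm \<gamma> (\<lambda>z. a * g z) / 2 - a * g x + a * r \<le> S * a\<^sup>2 / 2 - a * norm x + a * r"
        using S(2)[OF l bd] g(3) by simp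
      also have "\<dots> = - (norm x)\<^sup>2 / (2 * S) + norm x * r / S"
        using S(1) by (simp add: a_def power2_eq_square field_simps)
      finally show "exp (sq_norm \<gamma> (\<lambda>z. a * g z) / 2 - a * g x + a * r) \<le> exp (- (norm x)\<^sup>2 / (2 * S) + norm x * r / S)"
        by simp
    qed simp
    finally show ?thesis .
  qed
  then show thesis using that S(1) by blast
qed

text \<open>The growth condition enters here. Once the centres are bounded in norm, a single
  constant bounds \<open>\<Phi>\<close> from below on all the balls, which converts heaviness for
  \<open>\<mu>\<close> into heaviness for \<open>\<gamma>\<close>.\<close>

proposition heavy_tilted_balls_precompact:
  fixes x :: "nat \<Rightarrow> 'a"
  assumes r: "\<And>n. 0 < r n" "\<And>n. r n \<le> 1" "r \<longlonglongrightarrow> 0" and c: "c > 0"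
    and heavy: "\<And>n. c * b (r n) \<le> measure \<mu> (cball (x n) (r n))"
  obtains l s where "strict_mono (s :: nat \<Rightarrow> nat)" "(x \<circ> s) \<longlonglongrightarrow> l"
proof -
  obtain S where S: "S > 0" "\<And>x r. measure \<gamma> (cball x r) \<le> exp (- (norm x)\<^sup>2 / (2 * S) + norm x * r / S) * b r"
    by (rule gaussian_decay) blast
  \<comment> \<open>Since \<open>(q + 1)\<^sup>2 \<le> 2 * q\<^sup>2 + 2\<close>, the growth costs
    the rate \<open>2 * \<eta> = 1 / (4 * S)\<close> out of the decay rate
    \<open>1 / (2 * S)\<close>, so a negative quadratic term remains.\<close>
  define \<eta> where "\<eta> = 1 / (8 * S)"
  have \<eta>: "\<eta> > 0" using S(1) by (simp add: \<eta>_def)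
  obtain K where K: "\<And>x. K - \<eta> * (norm x)\<^sup>2 \<le> \<Phi> x" using growth[OF \<eta>] by blast
  have \<Phi>_ball: "K - \<eta> * (norm (x n) + 1)\<^sup>2 \<le> \<Phi> y" if "y \<in> cball (x n) (r n)" for n y
  proof -
    have "norm y \<le> norm (x n) + dist (x n) y" using norm_triangle_ineq[of "x n" "y - x n"]
      by (simp add: dist_norm norm_minus_commute)
    then have "norm y \<le> norm (x n) + 1" using that r(2)[of n] by simp
    then have "(norm y)\<^sup>2 \<le> (norm (x n) + 1)\<^sup>2" by (intro power_mono) auto
    then have "\<eta> * (norm y)\<^sup>2 \<le> \<eta> * (norm (x n) + 1)\<^sup>2" using \<eta> by simp
    then show ?thesis using K[of y] by linarith
  qed
  have le: "c * b (r n) \<le> exp (- (K - \<eta> * (norm (x n) + 1)\<^sup>2)) * measure \<gamma> (cball (x n) (r n))" for n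
  proof -
    have "measure \<mu> (cball (x n) (r n)) \<le> exp (- (K - \<eta> * (norm (x n) + 1)\<^sup>2)) * measure \<gamma> (cball (x n) (r n))"
      by (rule tilted_le[OF _ \<Phi>_ball]) simp_all
    then show ?thesis using heavy[of n] by linarith
  qed
  \<comment> \<open>Multiplied by \<open>4 * S\<close>, the comparison of exponents reads
    \<open>q * (q - 4) \<le> D\<close>, which fails once
    \<open>q > 5 + \<bar>D\<bar>\<close>.\<close>
  define D where "D = 4 * S * (- K - ln c) + 1"
  have nx: "norm (x n) \<le> 5 + \<bar>D\<bar>" for n
  proof (rule ccontr)
    define q where "q = norm (x n)"
    assume "\<not> norm (x n) \<le> 5 + \<bar>D\<bar>"
    then have q: "q > 5 + \<bar>D\<bar>" by (simp add: q_def)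
    have "c * b (r n) \<le> exp (- (K - \<eta> * (q + 1)\<^sup>2)) * (exp (- q\<^sup>2 / (2 * S) + q * r n / S) * b (r n))"
      unfolding q_def by (rule order_trans[OF le[of n]]) (intro mult_left_mono S(2), simp)
    also have "\<dots> = exp (- (K - \<eta> * (q + 1)\<^sup>2) + (- q\<^sup>2 / (2 * S) + q * r n / S)) * b (r n)"
      by (simp only: exp_add mult.assoc)
    finally have "c \<le> exp (- (K - \<eta> * (q + 1)\<^sup>2) + (- q\<^sup>2 / (2 * S) + q * r n / S))"
      using ball_pos[OF r(1)] by (rule mult_right_le_imp_le)
    then have "exp (ln c) \<le> exp (- (K - \<eta> * (q + 1)\<^sup>2) + (- q\<^sup>2 / (2 * S) + q * r n / S))" using c by simp
    then have "ln c \<le> - (K - \<eta> * (q + 1)\<^sup>2) + (- q\<^sup>2 / (2 * S) + q * r n / S)" by (simp only: exp_le_cancel_iff)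
    also have "\<dots> \<le> - K + \<eta> * (2 * q\<^sup>2 + 2) - q\<^sup>2 / (2 * S) + q / S"
    proof -
      have "(q + 1)\<^sup>2 \<le> 2 * q\<^sup>2 + 2" using sum_squares_bound[of q 1] by (simp add: power2_sum)
      then have "\<eta> * (q + 1)\<^sup>2 \<le> \<eta> * (2 * q\<^sup>2 + 2)" using \<eta> by (intro mult_left_mono) auto
      moreover have "q * r n / S \<le> q / S"
        using S(1) r(2)[of n] q by (intro divide_right_mono) (auto simp: mult_left_le)
      ultimately show ?thesis by linarith
    qed
    finally have "4 * S * ln c \<le> 4 * S * (- K + \<eta> * (2 * q\<^sup>2 + 2) - q\<^sup>2 / (2 * S) + q / S)"
      using S(1) by (intro mult_left_mono) auto
    also have "\<dots> = - 4 * S * K + 1 - q\<^sup>2 + 4 * q" using S(1) by (simp add: \<eta>_def field_simps)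
    finally have "q * (q - 4) \<le> D" by (simp add: D_def power2_eq_square algebra_simps)
    moreover have "D < q * (q - 4)"
    proof -
      have "D < q * 1" using q by simp
      also have "\<dots> \<le> q * (q - 4)" using q by (intro mult_left_mono) auto
      finally show ?thesis .
    qed
    ultimately show False by simp
  qed
  define R where "R = 5 + \<bar>D\<bar>"
  define C where "C = - ln c - (K - \<eta> * (R + 1)\<^sup>2)"
  have "exp (- C) * b (r n) \<le> measure \<gamma> (cball (x n) (r n))" for n
  proof -
    define k where "k = K - \<eta> * (R + 1)\<^sup>2"
    have "(norm (x n) + 1)\<^sup>2 \<le> (R + 1)\<^sup>2" using nx[of n] by (intro power_mono) (auto simp: R_def)
    then have "\<eta> * (norm (x n) + 1)\<^sup>2 \<le> \<eta> * (R + 1)\<^sup>2" using \<eta> by simp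
    then have "exp (- (K - \<eta> * (norm (x n) + 1)\<^sup>2)) \<le> exp (- k)" by (simp add: k_def)
    then have "exp (- (K - \<eta> * (norm (x n) + 1)\<^sup>2)) * measure \<gamma> (cball (x n) (r n)) \<le> exp (- k) * measure \<gamma> (cball (x n) (r n))"
      by (intro mult_right_mono) auto
    then have "exp k * (c * b (r n)) \<le> exp k * (exp (- k) * measure \<gamma> (cball (x n) (r n)))"
      using le[of n] by (intro mult_left_mono) auto
    also have "\<dots> = measure \<gamma> (cball (x n) (r n))" by (simp flip: mult.assoc exp_add)
    also have "exp k * (c * b (r n)) = exp (- C) * b (r n)"
      using c by (simp add: C_def k_def[symmetric] exp_add)
    finally show ?thesis .
  qed
  then show thesis
    using heavy_balls_precompact[OF r(1,3) ball_pos[OF r(1)]] that by blast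
qed

section \<open>Asymptotics of the maximal ball mass\<close>

abbreviation max_mass :: "real \<Rightarrow> real" where
  "max_mass \<equiv> max_ball_mass \<mu>"

lemma mass_le_max: "measure \<mu> (cball x r) \<le> max_mass r"
  unfolding max_ball_mass_def by (rule cSUP_upper) (auto intro!: bdd_aboveI2[where M=1])

lemma max_mass_approx:
  assumes "t < 1" "r > 0"
  obtains x where "t * max_mass r < measure \<mu> (cball x r)"
proof -
  have "0 < max_mass r" using tilted_ball_pos[OF assms(2)] mass_le_max less_le_trans by blast
  then have "t * max_mass r < max_mass r" using assms(1) by simp
  then have "\<exists>x. t * max_mass r < measure \<mu> (cball x r)"
    unfolding max_ball_mass_def by (subst (asm) less_cSUP_iff) (auto intro!: bdd_aboveI2[where M=1])
  then show thesis using that by blast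
qed

lemma zero_in_E: "0 \<in> E"
  unfolding cameron_martin_space_def
proof (intro CollectI bexI)
  show "R_graph \<gamma> (\<lambda>_. 0) 0" by (auto simp: R_graph_def linear_0 bounded_linear.linear)
  show "(\<lambda>_. 0) \<in> dual_L2_closure \<gamma>"
    unfolding dual_L2_closure_def using bounded_linear_zero by (auto intro!: exI[of _ "\<lambda>_. 0"])
qed

text \<open>Centres attaining a fraction \<open>t n\<close> of the supremum, with \<open>t n\<close>
  tending to 1, stand in for maximisers. Up to a constant they are eventually as heavy as the balls
  at 0, hence subconverge; the upper bound at their limit controls the maximal mass and thereby the
  weight of every point.\<close>

lemma maximiser_along_subsequence:
  assumes r: "\<And>n. 0 < r n" "r \<longlonglongrightarrow> 0"
  obtains l s where "strict_mono (s :: nat \<Rightarrow> nat)" "\<And>z. weight z \<le> weight l"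
    "\<And>e. weight l < e \<Longrightarrow> \<forall>\<^sub>F n in sequentially. max_mass (r (s n)) \<le> e * b (r (s n))"
proof -
  \<comment> \<open>The offset in \<open>Suc (Suc n)\<close> keeps \<open>t n\<close> at least one
    half from the start, so heaviness loses only a factor 2.\<close>
  define t where "t n = 1 - inverse (real (Suc (Suc n)))" for n
  have t: "t n < 1" "1/2 \<le> t n" for n by (auto simp: t_def field_simps)
  have tlim: "t \<longlonglongrightarrow> 1 - 0"
    unfolding t_def by (intro tendsto_intros LIMSEQ_Suc[OF LIMSEQ_inverse_real_of_nat])
  have "\<exists>x. t n * max_mass (r n) < measure \<mu> (cball x (r n))" for n
    using max_mass_approx[OF t(1) r(1)] by blast
  then obtain x where x: "\<And>n. t n * max_mass (r n) < measure \<mu> (cball (x n) (r n))" by metis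
  define c where "c = weight 0 / 2"
  have c: "c > 0" "c < weight 0" using zero_in_E by (auto simp: c_def weight_def)
  have "\<forall>\<^sub>F n in sequentially. c * b (r n) \<le> measure \<mu> (cball 0 (r n)) \<and> r n < 1"
    using weight_lower[OF r c(2)] order_tendstoD(2)[OF r(2) zero_less_one] by eventually_elim auto
  then obtain N where N: "\<And>n. n \<ge> N \<Longrightarrow> c * b (r n) \<le> measure \<mu> (cball 0 (r n)) \<and> r n < 1"
    by (auto simp: eventually_sequentially)
  have heavy: "c / 2 * b (r (n + N)) \<le> measure \<mu> (cball (x (n + N)) (r (n + N)))" for n
  proof -
    have "c * b (r (n + N)) \<le> max_mass (r (n + N))" using N[of "n + N"] mass_le_max[of 0 "r (n + N)"] by simp
    moreover have "0 \<le> max_mass (r (n + N))" using mass_le_max measure_nonneg order_trans by blast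
    then have "1/2 * max_mass (r (n + N)) \<le> t (n + N) * max_mass (r (n + N))"
      using t(2) by (intro mult_right_mono) auto
    ultimately show ?thesis using x[of "n + N"] by linarith
  qed
  have "0 < r (n + N)" "r (n + N) \<le> 1" for n using r(1) N[of "n + N"] by auto
  then obtain l s where s: "strict_mono (s :: nat \<Rightarrow> nat)" "((\<lambda>n. x (n + N)) \<circ> s) \<longlonglongrightarrow> l"
    by (rule heavy_tilted_balls_precompact[of "\<lambda>n. r (n + N)" "c / 2" "\<lambda>n. x (n + N)",
          OF _ _ LIMSEQ_ignore_initial_segment[OF r(2)] _ heavy]) (use c(1) in auto)
  define s' where "s' n = s n + N" for n
  have s': "strict_mono s'" using s(1) by (simp add: s'_def strict_mono_def)
  have xs: "(\<lambda>n. x (s' n)) \<longlonglongrightarrow> l" using s(2) by (simp add: s'_def comp_def)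
  have rs: "(\<lambda>n. r (s' n)) \<longlonglongrightarrow> 0" using LIMSEQ_subseq_LIMSEQ[OF r(2) s'] by (simp add: comp_def)
  have ts: "(\<lambda>n. t (s' n)) \<longlonglongrightarrow> 1" using LIMSEQ_subseq_LIMSEQ[OF tlim s'] by (simp add: comp_def)
  have up: "\<forall>\<^sub>F n in sequentially. max_mass (r (s' n)) \<le> e * b (r (s' n))" if e: "weight l < e" for e
  proof -
    obtain e' where e': "weight l < e'" "e' < e" using dense[OF e] by blast
    have epos: "e > 0" "e' > 0" using e' weight_nonneg[of l] by linarith+
    have "e' / e < 1" using e' epos by simp
    then have "\<forall>\<^sub>F n in sequentially. e' / e < t (s' n)" using ts by (intro order_tendstoD)
    moreover have "\<forall>\<^sub>F n in sequentially. measure \<mu> (cball (x (s' n)) (r (s' n))) \<le> e' * b (r (s' n))"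
      by (rule weight_upper[OF r(1) rs xs e'(1)])
    ultimately show ?thesis
    proof eventually_elim
      case (elim n)
      have M0: "0 \<le> max_mass (r (s' n))" using mass_le_max measure_nonneg order_trans by blast
      have "e' / e * max_mass (r (s' n)) \<le> t (s' n) * max_mass (r (s' n))"
        using elim(1) M0 by (intro mult_right_mono) auto
      also have "\<dots> \<le> e' * b (r (s' n))" using x[of "s' n"] elim(2) by linarith
      finally have "e' * (max_mass (r (s' n)) / e) \<le> e' * b (r (s' n))" by simp
      then have "max_mass (r (s' n)) / e \<le> b (r (s' n))" using epos(2) by (rule mult_left_le_imp_le)
      then show ?case using epos(1) by (simp add: pos_divide_le_eq mult.commute)
    qed
  qed
  have "weight z \<le> weight l" for z
  proof (rule field_le_epsilon)
    fix d :: real assume "d > 0"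
    then have "weight l < weight l + d" by simp
    from up[OF this] have "\<forall>\<^sub>F n in sequentially. measure \<mu> (cball z (r (s' n))) / b (r (s' n)) \<le> weight l + d"
    proof eventually_elim
      case (elim n)
      have "measure \<mu> (cball z (r (s' n))) \<le> (weight l + d) * b (r (s' n))"
        using elim mass_le_max[of z "r (s' n)"] by linarith
      then show ?case using ball_pos[OF r(1)] by (simp add: pos_divide_le_eq)
    qed
    then show "weight z \<le> weight l + d"
      using weight_limit[OF r(1) rs, of z] by (intro tendsto_upperbound) auto
  qed
  then show thesis using that[OF s'] up by blast
qed

lemma maximiser_exists:
  obtains l where "l \<in> E" "0 < weight l" "\<And>z. weight z \<le> weight l"
proof -
  define r where "r n = inverse (real (Suc n))" for n
  have r: "\<And>n. 0 < r n" "r \<longlonglongrightarrow> 0" unfolding r_def using LIMSEQ_inverse_real_of_nat by auto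
  obtain l where l: "\<And>z. weight z \<le> weight l"
    by (rule maximiser_along_subsequence[of r, OF r]) blast
  have "0 < weight 0" using zero_in_E by (simp add: weight_def)
  then have pos: "0 < weight l" using l[of 0] by linarith
  then have "l \<in> E" by (auto simp: weight_def split: if_splits)
  then show thesis using that pos l by blast
qed

text \<open>Radii violating the upper bound would form a sequence with a subsequence and a maximiser
  \<open>l'\<close> of its own; since \<open>weight l' \<le> weight l\<close>, the bound at
  \<open>l'\<close> contradicts the violation.\<close>

lemma max_mass_limit:
  assumes l: "\<And>z. weight z \<le> weight l" and r: "\<And>n. 0 < r n" "r \<longlonglongrightarrow> 0"
  shows "(\<lambda>n. max_mass (r n) / b (r n)) \<longlonglongrightarrow> weight l"
proof (rule order_tendstoI)
  fix e assume "e < weight l"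
  with weight_limit[OF r, of l] have "\<forall>\<^sub>F n in sequentially. e < measure \<mu> (cball l (r n)) / b (r n)"
    by (rule order_tendstoD)
  then show "\<forall>\<^sub>F n in sequentially. e < max_mass (r n) / b (r n)"
  proof eventually_elim
    case (elim n)
    have "measure \<mu> (cball l (r n)) / b (r n) \<le> max_mass (r n) / b (r n)"
      by (intro divide_right_mono mass_le_max) simp
    then show ?case using elim by linarith
  qed
next
  fix e assume e: "weight l < e"
  show "\<forall>\<^sub>F n in sequentially. max_mass (r n) / b (r n) < e"
  proof (rule ccontr)
    assume "\<not> ?thesis"
    then have "infinite {n. \<not> max_mass (r n) / b (r n) < e}"
      by (simp add: eventually_cofinite flip: cofinite_eq_sequentially)
    then obtain k where k: "strict_mono (k :: nat \<Rightarrow> nat)" "\<And>n. \<not> max_mass (r (k n)) / b (r (k n)) < e"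
      using infinite_enumerate by blast
    have rk: "(\<lambda>n. r (k n)) \<longlonglongrightarrow> 0" using LIMSEQ_subseq_LIMSEQ[OF r(2) k(1)] by (simp add: comp_def)
    obtain l' s where l': "\<And>z. weight z \<le> weight l'"
      "\<And>e. weight l' < e \<Longrightarrow> \<forall>\<^sub>F n in sequentially. max_mass (r (k (s n))) \<le> e * b (r (k (s n)))"
      by (rule maximiser_along_subsequence[of "\<lambda>n. r (k n)", OF r(1) rk]) blast
    obtain e' where e': "weight l < e'" "e' < e" using dense[OF e] by blast
    have "weight l' < e'" using l[of l'] e'(1) by linarith
    from l'(2)[OF this] obtain n where "max_mass (r (k (s n))) \<le> e' * b (r (k (s n)))"
      by (auto simp: eventually_sequentially)
    then have "max_mass (r (k (s n))) / b (r (k (s n))) \<le> e'" using ball_pos[OF r(1)] by (simp add: pos_divide_le_eq)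
    then show False using k(2)[of "s n"] e'(2) by linarith
  qed
qed

lemma filterlim_at_right_0I:
  fixes r :: "nat \<Rightarrow> real"
  assumes "\<And>n. 0 < r n" "r \<longlonglongrightarrow> 0"
  shows "filterlim r (at_right 0) sequentially"
proof -
  have "r n \<in> {0<..} \<and> r n \<noteq> 0" for n using assms(1)[of n] by simp
  then show ?thesis using assms(2) by (simp add: filterlim_at)
qed

lemma tendsto_at_right_0I:
  fixes g :: "real \<Rightarrow> real"
  assumes "\<And>r. (\<And>n. 0 < r n) \<Longrightarrow> r \<longlonglongrightarrow> 0 \<Longrightarrow> (\<lambda>n. g (r n)) \<longlonglongrightarrow> L"
  shows "(g \<longlongrightarrow> L) (at_right 0)"
  by (rule tendsto_at_right_sequentially[of 0 1]) (use assms in auto)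

section \<open>Limits of mass ratios and characterisation of the modes by maximal weight\<close>

lemma mass_max_ratio_limit:
  assumes l: "\<And>z. weight z \<le> weight l" "0 < weight l"
  shows "((\<lambda>r. measure \<mu> (cball x r) / max_mass r) \<longlongrightarrow> weight x / weight l) (at_right 0)"
proof (rule tendsto_at_right_0I)
  fix r :: "nat \<Rightarrow> real" assume r: "\<And>n. 0 < r n" "r \<longlonglongrightarrow> 0"
  have "(\<lambda>n. (measure \<mu> (cball x (r n)) / b (r n)) / (max_mass (r n) / b (r n))) \<longlonglongrightarrow> weight x / weight l"
    using l(2) by (intro tendsto_divide weight_limit max_mass_limit l r) auto
  moreover have "(measure \<mu> (cball x (r n)) / b (r n)) / (max_mass (r n) / b (r n)) = measure \<mu> (cball x (r n)) / max_mass (r n)" for n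
    using ball_pos[OF r(1)[of n], of 0] by simp
  ultimately show "(\<lambda>n. measure \<mu> (cball x (r n)) / max_mass (r n)) \<longlonglongrightarrow> weight x / weight l" by (simp only:)
qed

lemma mass_ratio_limit:
  assumes "0 < weight y"
  shows "((\<lambda>r. measure \<mu> (cball x r) / measure \<mu> (cball y r)) \<longlongrightarrow> weight x / weight y) (at_right 0)"
proof (rule tendsto_at_right_0I)
  fix r :: "nat \<Rightarrow> real" assume r: "\<And>n. 0 < r n" "r \<longlonglongrightarrow> 0"
  have "(\<lambda>n. (measure \<mu> (cball x (r n)) / b (r n)) / (measure \<mu> (cball y (r n)) / b (r n))) \<longlonglongrightarrow> weight x / weight y"
    using assms by (intro tendsto_divide weight_limit r) auto
  moreover have "(measure \<mu> (cball x (r n)) / b (r n)) / (measure \<mu> (cball y (r n)) / b (r n)) = measure \<mu> (cball x (r n)) / measure \<mu> (cball y (r n))" for n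
    using ball_pos[OF r(1)[of n], of 0] by simp
  ultimately show "(\<lambda>n. measure \<mu> (cball x (r n)) / measure \<mu> (cball y (r n))) \<longlonglongrightarrow> weight x / weight y" by (simp only:)
qed

lemma strong_mode_iff: "strong_mode \<mu> x \<longleftrightarrow> (\<forall>z. weight z \<le> weight x)"
proof -
  obtain l where l: "0 < weight l" "\<And>z. weight z \<le> weight l" using maximiser_exists by blast
  have "strong_mode \<mu> x \<longleftrightarrow> weight x / weight l = 1"
    unfolding strong_mode_def using tilted_support mass_max_ratio_limit[OF l(2,1), of x]
    by (auto dest: tendsto_unique[OF trivial_limit_at_right_real])
  also have "\<dots> \<longleftrightarrow> weight x = weight l" using l(1) by auto
  also have "\<dots> \<longleftrightarrow> (\<forall>z. weight z \<le> weight x)" using l(2) by (metis antisym)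
  finally show ?thesis .
qed

lemma weak_mode_iff: "weak_mode \<mu> x \<longleftrightarrow> (\<forall>z. weight z \<le> weight x)"
proof
  obtain l where l: "0 < weight l" "\<And>z. weight z \<le> weight l" using maximiser_exists by blast
  assume max: "\<forall>z. weight z \<le> weight x"
  then have pos: "0 < weight x" using l(1) less_le_trans by blast
  show "weak_mode \<mu> x"
    unfolding weak_mode_def
  proof (intro conjI allI tilted_support)
    fix z
    have "((\<lambda>r. ereal (measure \<mu> (cball z r) / measure \<mu> (cball x r))) \<longlongrightarrow> ereal (weight z / weight x)) (at_right 0)"
      using mass_ratio_limit[OF pos] by simp
    then have "Limsup (at_right 0) (\<lambda>r. ereal (measure \<mu> (cball z r) / measure \<mu> (cball x r))) = ereal (weight z / weight x)"
      by (intro lim_imp_Limsup) auto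
    then show "Limsup (at_right 0) (\<lambda>r. ereal (measure \<mu> (cball z r) / measure \<mu> (cball x r))) \<le> 1"
      using max pos by simp
  qed
next
  assume wm: "weak_mode \<mu> x"
  obtain l where l: "0 < weight l" "\<And>z. weight z \<le> weight l" using maximiser_exists by blast
  define r where "r n = inverse (real (Suc n))" for n
  have r: "\<And>n. 0 < r n" "r \<longlonglongrightarrow> 0" unfolding r_def using LIMSEQ_inverse_real_of_nat by auto
  have le: "weight l \<le> e * weight x" if e: "1 < e" for e
  proof -
    have "Limsup (at_right 0) (\<lambda>r. ereal (measure \<mu> (cball l r) / measure \<mu> (cball x r))) \<le> 1"
      using wm unfolding weak_mode_def by blast
    also have "1 < ereal e" using e by simp
    finally have "Limsup (at_right 0) (\<lambda>r. ereal (measure \<mu> (cball l r) / measure \<mu> (cball x r))) < ereal e" .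
    then have "\<forall>\<^sub>F r in at_right 0. ereal (measure \<mu> (cball l r) / measure \<mu> (cball x r)) < ereal e"
      by (rule Limsup_lessD)
    then have "\<forall>\<^sub>F n in sequentially. ereal (measure \<mu> (cball l (r n)) / measure \<mu> (cball x (r n))) < ereal e"
      by (rule eventually_compose_filterlim[OF _ filterlim_at_right_0I[OF r]])
    then have "\<forall>\<^sub>F n in sequentially. measure \<mu> (cball l (r n)) / b (r n) \<le> e * (measure \<mu> (cball x (r n)) / b (r n))"
    proof eventually_elim
      case (elim n)
      then have "measure \<mu> (cball l (r n)) \<le> e * measure \<mu> (cball x (r n))"
        using tilted_ball_pos[OF r(1)] by (simp add: pos_divide_less_eq less_imp_le)
      from divide_right_mono[OF this, of "b (r n)"] show ?case by simp
    qed
    moreover have "(\<lambda>n. e * (measure \<mu> (cball x (r n)) / b (r n))) \<longlonglongrightarrow> e * weight x"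
      by (intro tendsto_intros weight_limit r)
    ultimately show ?thesis using weight_limit[OF r, of l] by (intro tendsto_le[of sequentially]) auto
  qed
  have pos: "0 < weight x" using le[of 2] l(1) by simp
  have "weight l / weight x \<le> 1"
  proof (rule field_le_epsilon)
    fix d :: real assume "d > 0"
    then show "weight l / weight x \<le> 1 + d" using le[of "1 + d"] pos by (simp add: pos_divide_le_eq)
  qed
  then have "weight l \<le> weight x" using pos by simp
  then show "\<forall>z. weight z \<le> weight x" using l(2) order_trans by blast
qed

text \<open>The approximating centres move, and the upper bound along convergent centres is the
  direction required: it gives \<open>weight l \<le> weight x\<close> for a maximiser
  \<open>l\<close>. Conversely, a strong mode serves with a constant sequence.\<close>

lemma generalised_strong_mode_iff: "generalised_strong_mode \<mu> x \<longleftrightarrow> (\<forall>z. weight z \<le> weight x)"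
proof
  obtain l where l: "0 < weight l" "\<And>z. weight z \<le> weight l" using maximiser_exists by blast
  define r where "r n = inverse (real (Suc n))" for n
  have r: "\<And>n. 0 < r n" "r \<longlonglongrightarrow> 0" unfolding r_def using LIMSEQ_inverse_real_of_nat by auto
  assume "generalised_strong_mode \<mu> x"
  then obtain z where z: "z \<longlonglongrightarrow> x" "(\<lambda>n. measure \<mu> (cball (z n) (r n)) / max_mass (r n)) \<longlonglongrightarrow> 1"
    unfolding generalised_strong_mode_def using r by blast
  have "(\<lambda>n. (measure \<mu> (cball (z n) (r n)) / max_mass (r n)) * (max_mass (r n) / b (r n))) \<longlonglongrightarrow> 1 * weight l"
    by (intro tendsto_mult z max_mass_limit l r)
  moreover have "(measure \<mu> (cball (z n) (r n)) / max_mass (r n)) * (max_mass (r n) / b (r n)) = measure \<mu> (cball (z n) (r n)) / b (r n)" for n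
    using tilted_ball_pos[OF r(1)[of n], of x] mass_le_max[of x "r n"] by simp
  ultimately have lim: "(\<lambda>n. measure \<mu> (cball (z n) (r n)) / b (r n)) \<longlonglongrightarrow> weight l" by (simp only: mult_1)
  have "weight l \<le> weight x"
  proof (rule field_le_epsilon)
    fix d :: real assume "d > 0"
    then have "weight x < weight x + d" by simp
    from weight_upper[OF r z(1) this]
    have "\<forall>\<^sub>F n in sequentially. measure \<mu> (cball (z n) (r n)) / b (r n) \<le> weight x + d"
      by eventually_elim (use ball_pos[OF r(1)] in \<open>simp add: pos_divide_le_eq\<close>)
    then show "weight l \<le> weight x + d" using lim by (intro tendsto_upperbound) auto
  qed
  then show "\<forall>z. weight z \<le> weight x" using l(2) order_trans by blast
next
  assume max: "\<forall>z. weight z \<le> weight x"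
  then have "strong_mode \<mu> x" by (simp add: strong_mode_iff)
  then have lim: "((\<lambda>r. measure \<mu> (cball x r) / max_mass r) \<longlongrightarrow> 1) (at_right 0)" by (simp add: strong_mode_def)
  show "generalised_strong_mode \<mu> x"
    unfolding generalised_strong_mode_def
  proof (intro allI impI exI conjI)
    fix r :: "nat \<Rightarrow> real" assume r: "(\<forall>n. r n > 0) \<and> r \<longlonglongrightarrow> 0"
    show "(\<lambda>n. x) \<longlonglongrightarrow> x" by simp
    have "filterlim r (at_right 0) sequentially" using r by (intro filterlim_at_right_0I) auto
    from filterlim_compose[OF lim this]
    show "(\<lambda>n. measure \<mu> (cball x (r n)) / max_mass (r n)) \<longlonglongrightarrow> 1" .
  qed
qed

text \<open>On \<open>E\<close> the logarithm of the weight is minus the functional; points outside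
  have weight 0 and are excluded by the maximiser of positive weight, which also reduces maximality
  over the whole space to comparison within \<open>E\<close>.\<close>

lemma weight_maximal_iff:
  "(\<forall>z. weight z \<le> weight x) \<longleftrightarrow> x \<in> E \<and> (\<forall>h\<in>E. \<Phi> x + energy x \<le> \<Phi> h + energy h)"
proof
  assume max: "\<forall>z. weight z \<le> weight x"
  have "0 < weight x" using maximiser_exists max less_le_trans by metis
  then have x: "x \<in> E" by (auto simp: weight_def split: if_splits)
  moreover have "\<Phi> x + energy x \<le> \<Phi> h + energy h" if "h \<in> E" for h
    using spec[OF max, of h] x that by (simp add: weight_def)
  ultimately show "x \<in> E \<and> (\<forall>h\<in>E. \<Phi> x + energy x \<le> \<Phi> h + energy h)" by blast
next
  assume x: "x \<in> E \<and> (\<forall>h\<in>E. \<Phi> x + energy x \<le> \<Phi> h + energy h)"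
  obtain l where l: "l \<in> E" "\<And>z. weight z \<le> weight l" using maximiser_exists by blast
  have "weight l \<le> weight x" using x l(1) by (auto simp: weight_def)
  then show "\<forall>z. weight z \<le> weight x" using l(2) order_trans by blast
qed

lemma OM_functional_energy: "OM_functional \<mu> E (\<lambda>x. \<Phi> x + energy x)"
  unfolding OM_functional_def
proof (intro conjI ballI)
  show "E \<noteq> {}" using zero_in_E by blast
  show "E \<subseteq> msupport \<mu>" using tilted_support by blast
  fix x x' assume "x \<in> E" "x' \<in> E"
  then have "0 < weight x'" "weight x / weight x' = exp ((\<Phi> x' + energy x') - (\<Phi> x + energy x))"
    by (auto simp: weight_def algebra_simps simp flip: exp_diff)
  then show "((\<lambda>r. measure \<mu> (cball x r) / measure \<mu> (cball x' r)) \<longlongrightarrow> exp ((\<Phi> x' + energy x') - (\<Phi> x + energy x))) (at_right 0)"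
    using mass_ratio_limit[of x' x] by simp
qed

end

theorem theorem1p1:
  fixes \<mu>0 \<mu>y :: "'a::{banach, second_countable_topology} measure"
    and \<Phi> :: "'a \<Rightarrow> real"
    and E :: "'a set"
  assumes gauss: "gaussian_measure \<mu>0"
    and centred: "centred \<mu>0"
    and nondeg: "nondegenerate \<mu>0"
    and E: "E = cameron_martin_space \<mu>0"
    and cont: "continuous_on UNIV \<Phi>"
    and \<mu>y: "\<mu>y = density \<mu>0 (\<lambda>x. ennreal (exp (- \<Phi> x)))"
    and prob: "prob_space \<mu>y"
    and bound: "\<And>\<eta>. \<eta> > 0 \<Longrightarrow> \<exists>K. \<forall>x. \<Phi> x \<ge> K - \<eta> * (norm x)\<^sup>2"
  shows "(\<exists>x. strong_mode \<mu>y x) \<and> (\<forall>x. strong_mode \<mu>y x \<longrightarrow> x \<in> E) \<and>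
    (\<exists>I. OM_functional \<mu>y E I \<and>
       (\<forall>x. (strong_mode \<mu>y x \<longleftrightarrow> generalised_strong_mode \<mu>y x) \<and>
            (strong_mode \<mu>y x \<longleftrightarrow> weak_mode \<mu>y x) \<and>
            (strong_mode \<mu>y x \<longleftrightarrow> x \<in> E \<and> (\<forall>h\<in>E. I x \<le> I h))))"
proof -
  interpret T: tilted_gaussian \<mu>0 \<Phi>
    using gauss centred nondeg cont prob bound unfolding \<mu>y
    by (intro tilted_gaussian.intro centred_gaussian.intro tilted_gaussian_axioms.intro)
  have \<mu>: "\<mu>y = T.\<mu>" by (simp add: \<mu>y T.\<mu>_def)
  show ?thesis
    unfolding \<mu> E
    using T.maximiser_exists T.OM_functional_energy T.weight_maximal_iff
      T.strong_mode_iff T.weak_mode_iff T.generalised_strong_mode_iff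
    by (metis (no_types, lifting))
qed

end
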